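(* Let $1<p<\infty$ and $n\in\mathbb{N}$. Then the class $\mathcal{L}_{mCoh,p}^n$ of all multiple Cohen strongly $p$-summing $n$-linear operators between Banach spaces, equipped with the norm $\|\cdot\|_{mCoh,p}$, is a complete normed ideal of $n$-linear operators.
   Context: Banach spaces are over $\mathbb{K}=\mathbb{R}$ or $\mathbb{C}$; $F'$ is the topological dual; $\mathcal{L}(E_1,\dots,E_n;F)$ is the space of continuous $n$-linear operators; $1/p+1/p^{*}=1$. For a countable family $(\varphi_i)_{i\in I}$ in $F'$, $\|(\varphi_i)_{i\in I}\|_{w,p^{*}}=\sup_{y\in B_F}\big(\sum_{i\in I}|\varphi_i(y)|^{p^{*}}\big)^{1/p^{*}}$, and $\ell_{p^{*}}^w(F')$ (indexed by $I$) is the set of families for which this is finite. For a sequence $(x_j)$ in a Banach space, $\|(x_j)_j\|_p=(\sum_j\|x_j\|^p)^{1/p}$, and $\ell_p(E)$ is the space of sequences in $E$ for which this is finite. A family $(y_i)_{i\in I}$ in $F$ belongs to $\ell_p\langle F\rangle$ (is Cohen strongly $p$-summing) if $\sum_{i\in I}|\varphi_i(y_i)|<\infty$ for all $(\varphi_i)_{i\in I}\in\ell_{p^{*}}^w(F')$. An operator $T\in\mathcal{L}(E_1,\dots,E_n;F)$ is multiple Cohen strongly $p$-summing if $\big(T(x_{j_1}^{(1)},\dots,x_{j_n}^{(n)})\big)_{(j_1,\dots,j_n)\in\mathbb{N}^n}\in\ell_p\langle F\rangle$ (families indexed by $\mathbb{N}^n$) whenever $(x_j^{(i)})_{j=1}^\infty\in\ell_p(E_i)$,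 $i=1,\dots,n$. The set of these operators is $\mathcal{L}_{mCoh,p}(E_1,\dots,E_n;F)$. The norm $\|T\|_{mCoh,p}$ is the smallest constant $C$ such that $$\sum_{j_1,\dots,j_n=1}^m\big|\varphi_{j_1,\dots,j_n}\big(T(x_{j_1}^{(1)},\dots,x_{j_n}^{(n)})\big)\big|\le C\prod_{i=1}^n\big\|(x_j^{(i)})_{j=1}^m\big\|_p\,\big\|(\varphi_{j_1,\dots,j_n})_{j_1,\dots,j_n=1}^m\big\|_{w,p^{*}}$$ for all $m\in\mathbb{N}$, $x_j^{(i)}\in E_i$, $\varphi_{j_1,\dots,j_n}\in F'$. Complete normed ideal of $n$-linear operators: a subclass $\mathcal{M}_n$ of the class of continuous $n$-linear operators between Banach spaces, with a function $\|\cdot\|_{\mathcal{M}}:\mathcal{M}_n\to[0,\infty)$, such that for all Banach spaces: (a) the component $\mathcal{M}_n(E_1,\dots,E_n;F)=\mathcal{L}(E_1,\dots,E_n;F)\cap\mathcal{M}_n$ is a linear subspace of $\mathcal{L}(E_1,\dots,E_n;F)$ containing the $n$-linear operators of finite type (finite sums of maps $(x_1,\dots,x_n)\mapsto\varphi_1(x_1)\cdots\varphi_n(x_n)b$ with $\varphi_i\in E_i'$, $b\in F$), and $\|\cdot\|_{\mathcal{M}}$ is a norm on it for which it is complete; (b) $\|id_{\mathbb{K}^n}\|_{\mathcal{M}}=1$, where $id_{\mathbb{K}^n}:\mathbb{K}^n\to\mathbb{K}$, $(x_1,\dots,x_n)\mapsto x_1\cdots x_n$; (c) if $M\in\mathcal{M}_n(E_1,\dots,E_n;F)$,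 $u_j\in\mathcal{L}(G_j;E_j)$ ($j=1,\dots,n$) and $t\in\mathcal{L}(F;H)$, then $t\circ M\circ(u_1,\dots,u_n)\in\mathcal{M}_n(G_1,\dots,G_n;H)$ and $\|t\circ M\circ(u_1,\dots,u_n)\|_{\mathcal{M}}\le\|t\|\,\|M\|_{\mathcal{M}}\,\|u_1\|\cdots\|u_n\|$. *)

theory Defs
  imports "HOL-Analysis.Analysis" "HOL-Algebra.Module"
begin

text \<open>
  An ideal of \<open>n\<close>-linear operators ranges over many Banach spaces at once, and the \<open>n\<close> domain spaces
  differ from each other. Banach spaces are therefore carrier-based (modules over the scalar field
  in the sense of \<open>HOL-Algebra\<close>, plus a norm) instead of types of class \<open>banach\<close>. The scalar field is
  a type \<open>'k\<close>, meant to be \<open>real\<close> or \<open>complex\<close>. A finite index type \<open>'n\<close> plays the role of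
  \<open>{1,\<dots>,n}\<close>, so \<open>n = CARD('n)\<close> is an arbitrary positive natural number.
\<close>

section \<open>Banach spaces\<close>

text \<open>The fields \<open>mult\<close> and \<open>one\<close> inherited from \<open>module\<close> are never used.\<close>

record ('k, 'a) nspace = "('k, 'a) module" +
  vnorm :: "'a \<Rightarrow> real"

definition scalar_ring :: "'k::real_normed_field ring" where
  "scalar_ring = \<lparr>carrier = UNIV, mult = (*), one = 1, zero = 0, add = (+)\<rparr>"

text \<open>The case distinction is there because \<open>Metric_space\<close> requires its distance function to be
  nonnegative and symmetric on the whole type.\<close>

definition ndist :: "('k, 'a) nspace \<Rightarrow> 'a \<Rightarrow> 'a \<Rightarrow> real" where
  "ndist E x y = (if x \<in> carrier E \<and> y \<in> carrier E then vnorm E (x \<ominus>\<^bsub>E\<^esub> y) else 0)"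

definition ntopology :: "('k, 'a) nspace \<Rightarrow> 'a topology" where
  "ntopology E = Metric_space.mtopology (carrier E) (ndist E)"

definition normed_space :: "('k::real_normed_field, 'a) nspace \<Rightarrow> bool" where
  "normed_space E \<longleftrightarrow>
     Module.module scalar_ring E \<and>
     (\<forall>x\<in>carrier E. 0 \<le> vnorm E x) \<and>
     (\<forall>x\<in>carrier E. vnorm E x = 0 \<longleftrightarrow> x = \<zero>\<^bsub>E\<^esub>) \<and>
     (\<forall>x\<in>carrier E. \<forall>y\<in>carrier E. vnorm E (x \<oplus>\<^bsub>E\<^esub> y) \<le> vnorm E x + vnorm E y) \<and>
     (\<forall>c. \<forall>x\<in>carrier E. vnorm E (c \<odot>\<^bsub>E\<^esub> x) = norm c * vnorm E x)"

definition banach_space :: "('k::real_normed_field, 'a) nspace \<Rightarrow> bool" where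
  "banach_space E \<longleftrightarrow> normed_space E \<and> Metric_space.mcomplete (carrier E) (ndist E)"

definition unit_ball :: "('k, 'a) nspace \<Rightarrow> 'a set" where
  "unit_ball E = {x \<in> carrier E. vnorm E x \<le> 1}"

text \<open>The scalar field as a Banach space, carried by an injective copy of \<open>'k\<close> in \<open>'a\<close>.\<close>

definition scalar_copy :: "('k \<Rightarrow> 'a) \<Rightarrow> ('k::real_normed_field, 'a) nspace" where
  "scalar_copy \<iota> =
     \<lparr>carrier = range \<iota>,
      mult = (\<lambda>x y. \<iota> (the_inv \<iota> x * the_inv \<iota> y)),
      one = \<iota> 1,
      zero = \<iota> 0,
      add = (\<lambda>x y. \<iota> (the_inv \<iota> x + the_inv \<iota> y)),
      smult = (\<lambda>c x. \<iota> (c * the_inv \<iota> x)),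
      vnorm = (\<lambda>x. norm (the_inv \<iota> x))\<rparr>"

section \<open>Linear and multilinear operators\<close>

text \<open>Operators are extensional, that is, \<open>undefined\<close> off their domain, so that equality of
  functions is equality of operators.\<close>

definition linear_ops ::
  "('k::real_normed_field, 'a) nspace \<Rightarrow> ('k, 'b) nspace \<Rightarrow> ('a \<Rightarrow> 'b) set" where
  "linear_ops E F =
     {t \<in> carrier E \<rightarrow>\<^sub>E carrier F.
        (\<forall>x\<in>carrier E. \<forall>y\<in>carrier E. t (x \<oplus>\<^bsub>E\<^esub> y) = t x \<oplus>\<^bsub>F\<^esub> t y) \<and>
        (\<forall>c. \<forall>x\<in>carrier E. t (c \<odot>\<^bsub>E\<^esub> x) = c \<odot>\<^bsub>F\<^esub> t x) \<and>
        continuous_map (ntopology E) (ntopology F) t}"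

definition opnorm :: "('k, 'a) nspace \<Rightarrow> ('k, 'b) nspace \<Rightarrow> ('a \<Rightarrow> 'b) \<Rightarrow> real" where
  "opnorm E F t = (SUP x\<in>unit_ball E. vnorm F (t x))"

definition dual :: "('k::real_normed_field, 'a) nspace \<Rightarrow> ('a \<Rightarrow> 'k) set" where
  "dual F = linear_ops F (scalar_copy (\<lambda>c. c))"

definition prod_carrier :: "('n \<Rightarrow> ('k, 'a) nspace) \<Rightarrow> ('n \<Rightarrow> 'a) set" where
  "prod_carrier E = (\<Pi>\<^sub>E i\<in>UNIV. carrier (E i))"

definition multilinear_ops ::
  "('n::finite \<Rightarrow> ('k::real_normed_field, 'a) nspace) \<Rightarrow> ('k, 'b) nspace \<Rightarrow> (('n \<Rightarrow> 'a) \<Rightarrow> 'b) set"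
  where
  "multilinear_ops E F =
     {T \<in> prod_carrier E \<rightarrow>\<^sub>E carrier F.
        (\<forall>x\<in>prod_carrier E. \<forall>i. \<forall>y\<in>carrier (E i). \<forall>z\<in>carrier (E i).
           T (x(i := y \<oplus>\<^bsub>E i\<^esub> z)) = T (x(i := y)) \<oplus>\<^bsub>F\<^esub> T (x(i := z))) \<and>
        (\<forall>x\<in>prod_carrier E. \<forall>i. \<forall>c. \<forall>y\<in>carrier (E i).
           T (x(i := c \<odot>\<^bsub>E i\<^esub> y)) = c \<odot>\<^bsub>F\<^esub> T (x(i := y))) \<and>
        continuous_map (product_topology (\<lambda>i. ntopology (E i)) UNIV) (ntopology F) T}"

definition multilinear_module ::
  "('n::finite \<Rightarrow> ('k::real_normed_field, 'a) nspace) \<Rightarrow> ('k, 'b) nspace \<Rightarrow>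
   ('k, ('n \<Rightarrow> 'a) \<Rightarrow> 'b) module" where
  "multilinear_module E F =
     \<lparr>carrier = multilinear_ops E F,
      mult = undefined,
      one = undefined,
      zero = (\<lambda>x\<in>prod_carrier E. \<zero>\<^bsub>F\<^esub>),
      add = (\<lambda>S T. \<lambda>x\<in>prod_carrier E. S x \<oplus>\<^bsub>F\<^esub> T x),
      smult = (\<lambda>c T. \<lambda>x\<in>prod_carrier E. c \<odot>\<^bsub>F\<^esub> T x)\<rparr>"

definition finite_type_ops ::
  "('n::finite \<Rightarrow> ('k::real_normed_field, 'a) nspace) \<Rightarrow> ('k, 'b) nspace \<Rightarrow> (('n \<Rightarrow> 'a) \<Rightarrow> 'b) set"
  where
  "finite_type_ops E F =
     {(\<lambda>x\<in>prod_carrier E. \<Oplus>\<^bsub>F\<^esub>k\<in>{..<N}. (\<Prod>i\<in>UNIV. \<phi> k i (x i)) \<odot>\<^bsub>F\<^esub> b k) |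
        (N::nat) \<phi> b. (\<forall>k<N. (\<forall>i. \<phi> k i \<in> dual (E i)) \<and> b k \<in> carrier F)}"

section \<open>Ideals of multilinear operators\<close>

text \<open>A class of operators is a set of triples (domain spaces, codomain, operator). All spaces have
  their carriers in one type \<open>'u\<close>, which acts as the universe.\<close>

type_synonym ('k, 'n, 'u) operator =
  "('n \<Rightarrow> ('k, 'u) nspace) \<times> ('k, 'u) nspace \<times> (('n \<Rightarrow> 'u) \<Rightarrow> 'u)"

definition continuous_multilinear :: "('k::real_normed_field, 'n::finite, 'u) operator set" where
  "continuous_multilinear =
     {(E, F, T). (\<forall>i. banach_space (E i)) \<and> banach_space F \<and> T \<in> multilinear_ops E F}"

definition component ::
  "('k::real_normed_field, 'n::finite, 'u) operator set \<Rightarrow>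
   ('n \<Rightarrow> ('k, 'u) nspace) \<Rightarrow> ('k, 'u) nspace \<Rightarrow> (('n \<Rightarrow> 'u) \<Rightarrow> 'u) set" where
  "component M E F = {T \<in> multilinear_ops E F. (E, F, T) \<in> M}"

definition component_space ::
  "('k::real_normed_field, 'n::finite, 'u) operator set \<Rightarrow> (('k, 'n, 'u) operator \<Rightarrow> real) \<Rightarrow>
   ('n \<Rightarrow> ('k, 'u) nspace) \<Rightarrow> ('k, 'u) nspace \<Rightarrow> ('k, ('n \<Rightarrow> 'u) \<Rightarrow> 'u) nspace" where
  "component_space M \<nu> E F =
     \<lparr>carrier = component M E F,
      mult = mult (multilinear_module E F),
      one = one (multilinear_module E F),
      zero = zero (multilinear_module E F),
      add = add (multilinear_module E F),
      smult = smult (multilinear_module E F),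
      vnorm = (\<lambda>T. \<nu> (E, F, T))\<rparr>"

text \<open>In the normalization of \<open>id\<close>, the Banach space of scalars may be any copy of the scalars inside \<open>'u\<close>. If \<open>'u\<close> is
  too small to contain one, then every Banach space with carrier in \<open>'u\<close> is trivial.\<close>

definition complete_normed_ideal ::
  "('k::real_normed_field, 'n::finite, 'u) operator set \<Rightarrow>
   (('k, 'n, 'u) operator \<Rightarrow> real) \<Rightarrow> bool" where
  "complete_normed_ideal M \<nu> \<longleftrightarrow>
     M \<subseteq> continuous_multilinear \<and>
     (\<forall>A\<in>M. 0 \<le> \<nu> A) \<and>
     (\<forall>E F. (\<forall>i. banach_space (E i)) \<and> banach_space F \<longrightarrow>
        submodule (component M E F) scalar_ring (multilinear_module E F) \<and>
        finite_type_ops E F \<subseteq> component M E F \<and>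
        banach_space (component_space M \<nu> E F)) \<and>
     (\<forall>\<iota>::'k \<Rightarrow> 'u. inj \<iota> \<longrightarrow>
        \<nu> (\<lambda>i. scalar_copy \<iota>, scalar_copy \<iota>,
            \<lambda>x\<in>prod_carrier (\<lambda>i::'n. scalar_copy \<iota>). \<iota> (\<Prod>i\<in>UNIV. the_inv \<iota> (x i))) = 1) \<and>
     (\<forall>E F G H T u t.
        (\<forall>i. banach_space (E i)) \<and> banach_space F \<and> (\<forall>i. banach_space (G i)) \<and> banach_space H \<and>
        T \<in> component M E F \<and> (\<forall>i. u i \<in> linear_ops (G i) (E i)) \<and> t \<in> linear_ops F H \<longrightarrow>
        (let S = (\<lambda>x\<in>prod_carrier G. t (T (\<lambda>i. u i (x i)))) in
           S \<in> component M G H \<and>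
           \<nu> (G, H, S) \<le> opnorm F H t * \<nu> (E, F, T) * (\<Prod>i\<in>UNIV. opnorm (G i) (E i) (u i))))"

section \<open>Summability\<close>

definition conj_exponent :: "real \<Rightarrow> real" where
  "conj_exponent p = p / (p - 1)"

text \<open>Families are total functions of which only the values on the index set \<open>I\<close> matter.\<close>

definition strong_norm :: "real \<Rightarrow> 'i set \<Rightarrow> ('k, 'a) nspace \<Rightarrow> ('i \<Rightarrow> 'a) \<Rightarrow> real" where
  "strong_norm p I E x = (\<Sum>\<^sub>\<infinity>i\<in>I. vnorm E (x i) powr p) powr (1 / p)"

definition ell_p :: "real \<Rightarrow> ('k, 'a) nspace \<Rightarrow> (nat \<Rightarrow> 'a) set" where
  "ell_p p E = {x. range x \<subseteq> carrier E \<and> (\<lambda>j. vnorm E (x j) powr p) summable_on UNIV}"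

definition weak_norm ::
  "real \<Rightarrow> 'i set \<Rightarrow> ('k::real_normed_field, 'a) nspace \<Rightarrow> ('i \<Rightarrow> 'a \<Rightarrow> 'k) \<Rightarrow> real" where
  "weak_norm q I F \<phi> = (SUP y\<in>unit_ball F. (\<Sum>\<^sub>\<infinity>i\<in>I. norm (\<phi> i y) powr q) powr (1 / q))"

text \<open>The last two conditions say that the supremum in \<open>weak_norm\<close>, taken in \<open>[0,\<infinity>]\<close>, is finite.\<close>

definition weak_ell ::
  "real \<Rightarrow> 'i set \<Rightarrow> ('k::real_normed_field, 'a) nspace \<Rightarrow> ('i \<Rightarrow> 'a \<Rightarrow> 'k) set" where
  "weak_ell q I F =
     {\<phi>. (\<forall>i\<in>I. \<phi> i \<in> dual F) \<and>
         (\<forall>y\<in>unit_ball F. (\<lambda>i. norm (\<phi> i y) powr q) summable_on I) \<and>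
         bdd_above ((\<lambda>y. (\<Sum>\<^sub>\<infinity>i\<in>I. norm (\<phi> i y) powr q) powr (1 / q)) ` unit_ball F)}"

definition cohen_summable ::
  "real \<Rightarrow> 'i set \<Rightarrow> ('k::real_normed_field, 'a) nspace \<Rightarrow> ('i \<Rightarrow> 'a) set" where
  "cohen_summable p I F =
     {y. (\<forall>i\<in>I. y i \<in> carrier F) \<and>
         (\<forall>\<phi>\<in>weak_ell (conj_exponent p) I F. (\<lambda>i. norm (\<phi> i (y i))) summable_on I)}"

section \<open>Multiple Cohen strongly summing operators\<close>

definition mCoh_ops ::
  "real \<Rightarrow> ('n::finite \<Rightarrow> ('k::real_normed_field, 'a) nspace) \<Rightarrow> ('k, 'b) nspace \<Rightarrow>
   (('n \<Rightarrow> 'a) \<Rightarrow> 'b) set" where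
  "mCoh_ops p E F =
     {T \<in> multilinear_ops E F.
        \<forall>x. (\<forall>i. x i \<in> ell_p p (E i)) \<longrightarrow>
            (\<lambda>j::'n \<Rightarrow> nat. T (\<lambda>i. x i (j i))) \<in> cohen_summable p UNIV F}"

text \<open>The constraint \<open>0 \<le> C\<close> matters only in degenerate cases (e.g. \<open>F = {0}\<close>), where the inequality
  holds for negative \<open>C\<close> as well.\<close>

definition mCoh_norm ::
  "real \<Rightarrow> ('n::finite \<Rightarrow> ('k::real_normed_field, 'a) nspace) \<Rightarrow> ('k, 'b) nspace \<Rightarrow>
   (('n \<Rightarrow> 'a) \<Rightarrow> 'b) \<Rightarrow> real" where
  "mCoh_norm p E F T =
     (LEAST C. 0 \<le> C \<and>
        (\<forall>(m::nat) x \<phi>.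
           (\<forall>i. \<forall>j<m. x i j \<in> carrier (E i)) \<and>
           (\<forall>j\<in>{j. \<forall>i. j i < m}. \<phi> j \<in> dual F) \<longrightarrow>
           (\<Sum>j\<in>{j::'n \<Rightarrow> nat. \<forall>i. j i < m}. norm (\<phi> j (T (\<lambda>i. x i (j i)))))
             \<le> C * (\<Prod>i\<in>UNIV. strong_norm p {..<m} (E i) (x i)) *
                weak_norm (conj_exponent p) {j. \<forall>i. j i < m} F \<phi>))"

definition mCoh_class :: "real \<Rightarrow> ('k::real_normed_field, 'n::finite, 'u) operator set" where
  "mCoh_class p =
     {(E, F, T). (\<forall>i. banach_space (E i)) \<and> banach_space F \<and> T \<in> mCoh_ops p E F}"

definition mCoh_class_norm :: "real \<Rightarrow> ('k::real_normed_field, 'n::finite, 'u) operator \<Rightarrow> real" where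
  "mCoh_class_norm p = (\<lambda>(E, F, T). mCoh_norm p E F T)"

end

theory Submission
  imports Defs
begin

text \<open>
  The definition of a multiple Cohen strongly \<open>p\<close>-summing operator is qualitative: certain infinite
  sums converge. The norm is quantitative: it is the least constant in an inequality between finite
  sums. The key step is that an operator has the property if and only if some finite constant
  exists. One direction is exhaustion of \<open>\<nat>\<^sup>n\<close> by finite boxes
  (\<open>mCoh_bound_imp_mCoh_ops\<close>). The other direction (\<open>mCoh_ops_imp_mCoh_bound\<close>) is a gliding hump: if no
  constant works, normalized finite families violating the inequality ever more strongly are scaled
  down geometrically and glued into single sequences for which the Cohen sum diverges. The least
  constant is attained because the admissible ones form a closed set (\<open>mCoh_bound_mCoh_norm\<close>).

  All parts of the ideal property then become estimates for finite sums. Constants add up under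
  sums of operators and scale under multiples. Products \<open>\<phi>\<^sub>1(x\<^sub>1) \<cdots> \<phi>\<^sub>n(x\<^sub>n) b\<close> satisfy the inequality with
  constant \<open>\<parallel>\<phi>\<^sub>1\<parallel> \<cdots> \<parallel>\<phi>\<^sub>n\<parallel> \<parallel>b\<parallel>\<close> by Hoelder's inequality (\<open>mCoh_bound_product\<close>), which covers the operators of finite type and
  the multiplication of scalars. In a composition, the outer operator is moved to the functionals and
  the inner ones to the sequences (\<open>mCoh_bound_compose\<close>).

  Definiteness and completeness of the norm rest on the fact that it dominates the operator norm.
  This is the inequality for one tuple \<open>x\<close> and one functional (\<open>mCoh_bound_functional\<close>), chosen by the Hahn-Banach
  theorem to attain the norm of \<open>T x\<close>. Hahn-Banach is proved for carrier-based spaces by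
  taking a minimal sublinear functional below the norm (\<open>real_norming_functional\<close>) and complexifying it
  (\<open>complex_norming_functional\<close>). A Cauchy sequence of operators therefore converges pointwise, and the
  inequality, being about finite sums, passes to the limit (\<open>banach_Z\<close>).

  Continuity of linear and multilinear operators is used only in the form of boundedness
  (\<open>linear_ops_iff\<close>, \<open>multilinear_ops_iff\<close>).
\<close>

section \<open>Arithmetic in carrier-based normed spaces\<close>

lemma scalar_ring_simps [simp]:
  "carrier scalar_ring = UNIV" "mult scalar_ring = (*)" "one scalar_ring = 1"
  "zero scalar_ring = 0" "add scalar_ring = (+)"
  by (simp_all add: scalar_ring_def)

lemma cring_scalar_ring: "cring (scalar_ring :: 'k::real_normed_field ring)"
proof (rule cringI)
  show "abelian_group (scalar_ring :: 'k ring)"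
    by (rule abelian_groupI)
      (auto simp: algebra_simps intro: exI[of _ "- x" for x] left_minus)
  show "Group.comm_monoid (scalar_ring :: 'k ring)"
    by (rule comm_monoidI) (auto simp: algebra_simps)
qed (auto simp: algebra_simps)

lemma normed_space_module: "normed_space E \<Longrightarrow> Module.module scalar_ring E"
  by (simp add: normed_space_def)

lemma normed_space_abelian_group: "normed_space E \<Longrightarrow> abelian_group E"
  using Module.module.axioms(2) normed_space_module by blast

lemma ns_closed [simp]:
  assumes "normed_space E"
  shows "\<zero>\<^bsub>E\<^esub> \<in> carrier E"
    and "x \<in> carrier E \<Longrightarrow> y \<in> carrier E \<Longrightarrow> x \<oplus>\<^bsub>E\<^esub> y \<in> carrier E"
    and "x \<in> carrier E \<Longrightarrow> c \<odot>\<^bsub>E\<^esub> x \<in> carrier E"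
    and "x \<in> carrier E \<Longrightarrow> y \<in> carrier E \<Longrightarrow> x \<ominus>\<^bsub>E\<^esub> y \<in> carrier E"
proof -
  interpret Module.module scalar_ring E by (rule normed_space_module[OF assms])
  show "\<zero>\<^bsub>E\<^esub> \<in> carrier E" by simp
  show "x \<in> carrier E \<Longrightarrow> y \<in> carrier E \<Longrightarrow> x \<oplus>\<^bsub>E\<^esub> y \<in> carrier E" by simp
  show "x \<in> carrier E \<Longrightarrow> c \<odot>\<^bsub>E\<^esub> x \<in> carrier E" by (rule smult_closed) auto
  show "x \<in> carrier E \<Longrightarrow> y \<in> carrier E \<Longrightarrow> x \<ominus>\<^bsub>E\<^esub> y \<in> carrier E" by simp
qed

lemma ns_smult [simp]:
  assumes "normed_space E" "x \<in> carrier E"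
  shows "1 \<odot>\<^bsub>E\<^esub> x = x" "0 \<odot>\<^bsub>E\<^esub> x = \<zero>\<^bsub>E\<^esub>"
    and "a \<odot>\<^bsub>E\<^esub> (b \<odot>\<^bsub>E\<^esub> x) = (a * b) \<odot>\<^bsub>E\<^esub> x"
proof -
  interpret Module.module scalar_ring E by (rule normed_space_module[OF assms(1)])
  show "1 \<odot>\<^bsub>E\<^esub> x = x" "0 \<odot>\<^bsub>E\<^esub> x = \<zero>\<^bsub>E\<^esub>"
    using smult_one[OF assms(2)] smult_l_null[OF assms(2)] by simp_all
  show "a \<odot>\<^bsub>E\<^esub> (b \<odot>\<^bsub>E\<^esub> x) = (a * b) \<odot>\<^bsub>E\<^esub> x"
    using smult_assoc1[OF _ _ assms(2), of a b] by simp
qed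

lemma ns_smult_zero [simp]: "normed_space E \<Longrightarrow> c \<odot>\<^bsub>E\<^esub> \<zero>\<^bsub>E\<^esub> = \<zero>\<^bsub>E\<^esub>"
  using Module.module.smult_r_null[OF normed_space_module, of E c] by simp

lemma ns_distrib:
  assumes "normed_space E" "x \<in> carrier E" 
  shows "(a + b) \<odot>\<^bsub>E\<^esub> x = a \<odot>\<^bsub>E\<^esub> x \<oplus>\<^bsub>E\<^esub> b \<odot>\<^bsub>E\<^esub> x"
    and "y \<in> carrier E \<Longrightarrow> a \<odot>\<^bsub>E\<^esub> (x \<oplus>\<^bsub>E\<^esub> y) = a \<odot>\<^bsub>E\<^esub> x \<oplus>\<^bsub>E\<^esub> a \<odot>\<^bsub>E\<^esub> y"
  using Module.module.smult_l_distr[OF normed_space_module[OF assms(1)] _ _ assms(2), of a b]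
    Module.module.smult_r_distr[OF normed_space_module[OF assms(1)] _ assms(2), of a y] by simp_all

lemma ns_add:
  assumes "normed_space E" "x \<in> carrier E" 
  shows "y \<in> carrier E \<Longrightarrow> x \<oplus>\<^bsub>E\<^esub> y = y \<oplus>\<^bsub>E\<^esub> x"
    and "y \<in> carrier E \<Longrightarrow> z \<in> carrier E \<Longrightarrow> (x \<oplus>\<^bsub>E\<^esub> y) \<oplus>\<^bsub>E\<^esub> z = x \<oplus>\<^bsub>E\<^esub> (y \<oplus>\<^bsub>E\<^esub> z)"
    and "y \<in> carrier E \<Longrightarrow> z \<in> carrier E \<Longrightarrow> x \<oplus>\<^bsub>E\<^esub> (y \<oplus>\<^bsub>E\<^esub> z) = y \<oplus>\<^bsub>E\<^esub> (x \<oplus>\<^bsub>E\<^esub> z)"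
proof -
  interpret abelian_group E by (rule normed_space_abelian_group[OF assms(1)])
  show "y \<in> carrier E \<Longrightarrow> x \<oplus>\<^bsub>E\<^esub> y = y \<oplus>\<^bsub>E\<^esub> x" using assms(2) by (simp add: a_ac)
  show "y \<in> carrier E \<Longrightarrow> z \<in> carrier E \<Longrightarrow> (x \<oplus>\<^bsub>E\<^esub> y) \<oplus>\<^bsub>E\<^esub> z = x \<oplus>\<^bsub>E\<^esub> (y \<oplus>\<^bsub>E\<^esub> z)"
    using assms(2) by (simp add: a_ac)
  show "y \<in> carrier E \<Longrightarrow> z \<in> carrier E \<Longrightarrow> x \<oplus>\<^bsub>E\<^esub> (y \<oplus>\<^bsub>E\<^esub> z) = y \<oplus>\<^bsub>E\<^esub> (x \<oplus>\<^bsub>E\<^esub> z)"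
    using assms(2) by (simp add: a_ac)
qed

lemma ns_add_zero [simp]:
  assumes "normed_space E" "x \<in> carrier E" 
  shows "x \<oplus>\<^bsub>E\<^esub> \<zero>\<^bsub>E\<^esub> = x" "\<zero>\<^bsub>E\<^esub> \<oplus>\<^bsub>E\<^esub> x = x"
  using abelian_monoid.r_zero abelian_monoid.l_zero assms
    normed_space_abelian_group[THEN abelian_group.axioms(1)] by metis+

text \<open>Sums and scalar multiples of operators are pointwise by definition, but the additive inverse in a
  space of operators is only characterized by a group equation. Writing it as a scalar multiple
  makes differences of operators pointwise, too.\<close>

lemma module_minus_eq:
  fixes M :: "('k::real_normed_field, 'a, 'm) module_scheme"
  assumes "Module.module scalar_ring M" "x \<in> carrier M" "y \<in> carrier M"
  shows "\<ominus>\<^bsub>M\<^esub> y = (- 1) \<odot>\<^bsub>M\<^esub> y" and "x \<ominus>\<^bsub>M\<^esub> y = x \<oplus>\<^bsub>M\<^esub> (- 1) \<odot>\<^bsub>M\<^esub> y"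
proof -
  interpret Module.module scalar_ring M by (rule assms(1))
  have "(- 1) \<odot>\<^bsub>M\<^esub> y \<oplus>\<^bsub>M\<^esub> y = (-1 + 1) \<odot>\<^bsub>M\<^esub> y"
    using smult_l_distr[of "-1" 1 y] smult_one[of y] assms(3) by simp
  also have "\<dots> = \<zero>\<^bsub>M\<^esub>" using smult_l_null[OF assms(3)] by simp
  finally have "(- 1) \<odot>\<^bsub>M\<^esub> y \<oplus>\<^bsub>M\<^esub> y = \<zero>\<^bsub>M\<^esub>" .
  moreover have "(- 1) \<odot>\<^bsub>M\<^esub> y \<in> carrier M" using assms(3) by (simp add: smult_closed)
  ultimately show "\<ominus>\<^bsub>M\<^esub> y = (- 1) \<odot>\<^bsub>M\<^esub> y" using assms(3) M.minus_equality by blast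
  then show "x \<ominus>\<^bsub>M\<^esub> y = x \<oplus>\<^bsub>M\<^esub> (- 1) \<odot>\<^bsub>M\<^esub> y" by (simp add: a_minus_def)
qed

lemma ns_diff_eq:
  "normed_space E \<Longrightarrow> x \<in> carrier E \<Longrightarrow> y \<in> carrier E \<Longrightarrow> x \<ominus>\<^bsub>E\<^esub> y = x \<oplus>\<^bsub>E\<^esub> (- 1) \<odot>\<^bsub>E\<^esub> y"
  by (rule module_minus_eq(2)[OF normed_space_module])

lemma ns_diff_cancel [simp]:
  assumes "normed_space E" "x \<in> carrier E"
  shows "x \<ominus>\<^bsub>E\<^esub> x = \<zero>\<^bsub>E\<^esub>" and "x \<ominus>\<^bsub>E\<^esub> \<zero>\<^bsub>E\<^esub> = x"
    and "y \<in> carrier E \<Longrightarrow> x \<oplus>\<^bsub>E\<^esub> (y \<ominus>\<^bsub>E\<^esub> x) = y"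
    and "y \<in> carrier E \<Longrightarrow> (y \<ominus>\<^bsub>E\<^esub> x) \<oplus>\<^bsub>E\<^esub> x = y"
    and "y \<in> carrier E \<Longrightarrow> (y \<oplus>\<^bsub>E\<^esub> x) \<ominus>\<^bsub>E\<^esub> x = y"
proof -
  interpret abelian_group E by (rule normed_space_abelian_group[OF assms(1)])
  show "x \<ominus>\<^bsub>E\<^esub> x = \<zero>\<^bsub>E\<^esub>" "x \<ominus>\<^bsub>E\<^esub> \<zero>\<^bsub>E\<^esub> = x"
    using assms by (simp_all add: a_minus_def r_neg)
  show "x \<oplus>\<^bsub>E\<^esub> (y \<ominus>\<^bsub>E\<^esub> x) = y" if "y \<in> carrier E"
    using assms that by (simp add: a_minus_def a_comm[of y] r_neg2)
  show "(y \<ominus>\<^bsub>E\<^esub> x) \<oplus>\<^bsub>E\<^esub> x = y" "(y \<oplus>\<^bsub>E\<^esub> x) \<ominus>\<^bsub>E\<^esub> x = y" if "y \<in> carrier E"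
    using assms that by (simp_all add: a_minus_def a_assoc l_neg r_neg)
qed

lemma ns_diff_trans:
  assumes "normed_space E" "x \<in> carrier E" "y \<in> carrier E" "z \<in> carrier E"
  shows "(x \<ominus>\<^bsub>E\<^esub> y) \<oplus>\<^bsub>E\<^esub> (y \<ominus>\<^bsub>E\<^esub> z) = x \<ominus>\<^bsub>E\<^esub> z"
proof -
  interpret abelian_group E by (rule normed_space_abelian_group[OF assms(1)])
  show ?thesis using assms by (simp add: a_minus_def a_assoc r_neg1)
qed

lemma ns_norm:
  assumes "normed_space E" "x \<in> carrier E"
  shows ns_norm_ge0: "0 \<le> vnorm E x"
    and ns_norm_eq0: "vnorm E x = 0 \<longleftrightarrow> x = \<zero>\<^bsub>E\<^esub>"
    and ns_norm_smult: "vnorm E (c \<odot>\<^bsub>E\<^esub> x) = norm c * vnorm E x"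
    and ns_norm_triangle: "y \<in> carrier E \<Longrightarrow> vnorm E (x \<oplus>\<^bsub>E\<^esub> y) \<le> vnorm E x + vnorm E y"
proof -
  have 1: "\<forall>x\<in>carrier E. 0 \<le> vnorm E x"
    and 2: "\<forall>x\<in>carrier E. vnorm E x = 0 \<longleftrightarrow> x = \<zero>\<^bsub>E\<^esub>"
    and 3: "\<forall>x\<in>carrier E. \<forall>y\<in>carrier E. vnorm E (x \<oplus>\<^bsub>E\<^esub> y) \<le> vnorm E x + vnorm E y"
    and 4: "\<forall>c. \<forall>x\<in>carrier E. vnorm E (c \<odot>\<^bsub>E\<^esub> x) = norm c * vnorm E x"
    using assms(1)[unfolded normed_space_def] by - (elim conjE, assumption)+
  show "0 \<le> vnorm E x" by (rule bspec[OF 1 assms(2)])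
  show "vnorm E x = 0 \<longleftrightarrow> x = \<zero>\<^bsub>E\<^esub>" by (rule bspec[OF 2 assms(2)])
  show "vnorm E (c \<odot>\<^bsub>E\<^esub> x) = norm c * vnorm E x" by (rule bspec[OF spec[OF 4] assms(2)])
  show "y \<in> carrier E \<Longrightarrow> vnorm E (x \<oplus>\<^bsub>E\<^esub> y) \<le> vnorm E x + vnorm E y"
    by (rule bspec[OF bspec[OF 3 assms(2)]])
qed

lemma ns_norm_zero [simp]: "normed_space E \<Longrightarrow> vnorm E \<zero>\<^bsub>E\<^esub> = 0"
  by (rule iffD2[OF ns_norm_eq0]) auto

lemma ns_norm_diff_commute:
  assumes "normed_space E" "x \<in> carrier E" "y \<in> carrier E"
  shows "vnorm E (x \<ominus>\<^bsub>E\<^esub> y) = vnorm E (y \<ominus>\<^bsub>E\<^esub> x)"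
proof -
  have "(-1) \<odot>\<^bsub>E\<^esub> (x \<ominus>\<^bsub>E\<^esub> y) = y \<ominus>\<^bsub>E\<^esub> x"
    using assms by (simp add: ns_diff_eq ns_distrib(2) ns_add(1))
  then show ?thesis
    using ns_norm_smult[OF assms(1), of "x \<ominus>\<^bsub>E\<^esub> y" "-1"] assms by simp
qed

lemma ns_norm_diff_triangle:
  assumes "normed_space E" "x \<in> carrier E" "y \<in> carrier E" "z \<in> carrier E"
  shows "vnorm E (x \<ominus>\<^bsub>E\<^esub> z) \<le> vnorm E (x \<ominus>\<^bsub>E\<^esub> y) + vnorm E (y \<ominus>\<^bsub>E\<^esub> z)"
  using ns_norm_triangle[of E "x \<ominus>\<^bsub>E\<^esub> y" "y \<ominus>\<^bsub>E\<^esub> z"] ns_diff_trans[OF assms] assms by simp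

lemma ns_norm_diff_eq0:
  assumes "normed_space E" "x \<in> carrier E" "y \<in> carrier E"
  shows "vnorm E (x \<ominus>\<^bsub>E\<^esub> y) = 0 \<longleftrightarrow> x = y"
  by (metis assms ns_diff_cancel(1,3) ns_norm_eq0 ns_closed(4) ns_add_zero(1))

lemma ns_norm_le_diff:
  assumes "normed_space E" "x \<in> carrier E" "y \<in> carrier E"
  shows "vnorm E x \<le> vnorm E (x \<ominus>\<^bsub>E\<^esub> y) + vnorm E y"
  using ns_norm_triangle[of E "x \<ominus>\<^bsub>E\<^esub> y" y] assms by simp

lemma ns_Metric_space:
  assumes "normed_space E" shows "Metric_space (carrier E) (ndist E)"
proof
  show "0 \<le> ndist E x y" for x y
    using assms by (simp add: ndist_def ns_norm_ge0)
  show "ndist E x y = ndist E y x" for x y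
    using assms by (auto simp: ndist_def ns_norm_diff_commute)
  show "ndist E x y = 0 \<longleftrightarrow> x = y" if "x \<in> carrier E" "y \<in> carrier E" for x y
    using assms that by (auto simp: ndist_def ns_norm_diff_eq0)
  show "ndist E x z \<le> ndist E x y + ndist E y z"
    if "x \<in> carrier E" "y \<in> carrier E" "z \<in> carrier E" for x y z
    using assms that by (auto simp: ndist_def ns_norm_diff_triangle)
qed

lemma topspace_ntopology [simp]: "normed_space E \<Longrightarrow> topspace (ntopology E) = carrier E"
  by (simp add: ntopology_def Metric_space.topspace_mtopology ns_Metric_space)

lemma openin_ntopology:
  assumes "normed_space E"
  shows "openin (ntopology E) U \<longleftrightarrow>
    U \<subseteq> carrier E \<and> (\<forall>x\<in>U. \<exists>r>0. \<forall>y\<in>carrier E. vnorm E (x \<ominus>\<^bsub>E\<^esub> y) < r \<longrightarrow> y \<in> U)"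
proof -
  interpret Metric_space "carrier E" "ndist E" by (rule ns_Metric_space[OF assms])
  have "mball x r \<subseteq> U \<longleftrightarrow> (\<forall>y\<in>carrier E. vnorm E (x \<ominus>\<^bsub>E\<^esub> y) < r \<longrightarrow> y \<in> U)"
    if "x \<in> carrier E" for x r
    using that by (auto simp: mball_def ndist_def)
  then show ?thesis
    unfolding ntopology_def openin_mtopology by (meson subsetD)
qed

text \<open>Completeness in terms of the norm only, for use in the codomain as well as in spaces of operators.\<close>

lemma banach_space_iff:
  "banach_space E \<longleftrightarrow> normed_space E \<and>
    (\<forall>\<sigma>. range \<sigma> \<subseteq> carrier E \<and>
         (\<forall>\<epsilon>>0. \<exists>N. \<forall>k\<ge>N. \<forall>l\<ge>N. vnorm E (\<sigma> k \<ominus>\<^bsub>E\<^esub> \<sigma> l) < \<epsilon>) \<longrightarrow>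
         (\<exists>x\<in>carrier E. (\<lambda>k. vnorm E (\<sigma> k \<ominus>\<^bsub>E\<^esub> x)) \<longlonglongrightarrow> 0))"
proof (cases "normed_space E")
  case True
  interpret Metric_space "carrier E" "ndist E" by (rule ns_Metric_space[OF True])
  have 1: "MCauchy \<sigma> \<longleftrightarrow> range \<sigma> \<subseteq> carrier E \<and>
         (\<forall>\<epsilon>>0. \<exists>N. \<forall>k\<ge>N. \<forall>l\<ge>N. vnorm E (\<sigma> k \<ominus>\<^bsub>E\<^esub> \<sigma> l) < \<epsilon>)" for \<sigma>
    unfolding MCauchy_def ndist_def by (auto simp: subset_iff)
  have 2: "limitin mtopology \<sigma> x sequentially \<longleftrightarrow>
      x \<in> carrier E \<and> (\<lambda>k. vnorm E (\<sigma> k \<ominus>\<^bsub>E\<^esub> x)) \<longlonglongrightarrow> 0"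
    if "range \<sigma> \<subseteq> carrier E" for \<sigma> x
  proof (cases "x \<in> carrier E")
    case x: True
    have "(\<lambda>k. ndist E (\<sigma> k) x) = (\<lambda>k. vnorm E (\<sigma> k \<ominus>\<^bsub>E\<^esub> x))"
      using that x by (intro ext) (auto simp: ndist_def)
    then show ?thesis using that x
      by (auto simp: limitin_metric_dist_null intro!: always_eventually)
  qed (auto simp: limitin_metric_dist_null)
  have "(MCauchy \<sigma> \<longrightarrow> (\<exists>x. limitin mtopology \<sigma> x sequentially)) \<longleftrightarrow>
      (range \<sigma> \<subseteq> carrier E \<and>
         (\<forall>\<epsilon>>0. \<exists>N. \<forall>k\<ge>N. \<forall>l\<ge>N. vnorm E (\<sigma> k \<ominus>\<^bsub>E\<^esub> \<sigma> l) < \<epsilon>) \<longrightarrow>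
         (\<exists>x\<in>carrier E. (\<lambda>k. vnorm E (\<sigma> k \<ominus>\<^bsub>E\<^esub> x)) \<longlonglongrightarrow> 0))" for \<sigma>
    using 2[of \<sigma>] unfolding 1 by auto
  then show ?thesis unfolding banach_space_def mcomplete_def using True by simp
qed (auto simp: banach_space_def)

section \<open>Continuity and boundedness\<close>

lemma ns_norm_zero_diff [simp]:
  "normed_space E \<Longrightarrow> x \<in> carrier E \<Longrightarrow> vnorm E (\<zero>\<^bsub>E\<^esub> \<ominus>\<^bsub>E\<^esub> x) = vnorm E x"
  by (simp add: ns_norm_diff_commute)

lemma openin_ntopology_ball:
  assumes "normed_space E" "a \<in> carrier E"
  shows "openin (ntopology E) {y \<in> carrier E. vnorm E (a \<ominus>\<^bsub>E\<^esub> y) < r}"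
  unfolding openin_ntopology[OF assms(1)]
proof safe
  fix x assume x: "x \<in> carrier E" "vnorm E (a \<ominus>\<^bsub>E\<^esub> x) < r"
  show "\<exists>s>0. \<forall>y\<in>carrier E. vnorm E (x \<ominus>\<^bsub>E\<^esub> y) < s \<longrightarrow> y \<in> {y \<in> carrier E. vnorm E (a \<ominus>\<^bsub>E\<^esub> y) < r}"
    using x assms ns_norm_diff_triangle[OF assms x(1)]
    by (intro exI[of _ "r - vnorm E (a \<ominus>\<^bsub>E\<^esub> x)"]) force
qed

text \<open>Continuity at \<open>0\<close> bounds \<open>t\<close> on a small ball, and homogeneity spreads the bound to all vectors.
  Conversely a bounded linear map is Lipschitz.\<close>

lemma linear_ops_iff:
  fixes E :: "('k::real_normed_field, 'a) nspace" and F :: "('k, 'b) nspace"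
  assumes E: "normed_space E" and F: "normed_space F"
  shows "t \<in> linear_ops E F \<longleftrightarrow>
     t \<in> carrier E \<rightarrow>\<^sub>E carrier F \<and>
     (\<forall>x\<in>carrier E. \<forall>y\<in>carrier E. t (x \<oplus>\<^bsub>E\<^esub> y) = t x \<oplus>\<^bsub>F\<^esub> t y) \<and>
     (\<forall>c. \<forall>x\<in>carrier E. t (c \<odot>\<^bsub>E\<^esub> x) = c \<odot>\<^bsub>F\<^esub> t x) \<and>
     (\<exists>B\<ge>0. \<forall>x\<in>carrier E. vnorm F (t x) \<le> B * vnorm E x)" (is "_ \<longleftrightarrow> ?t \<and> ?add \<and> ?smult \<and> ?bdd")
proof (cases "?t \<and> ?add \<and> ?smult")
  case True
  then have t: "\<And>x. x \<in> carrier E \<Longrightarrow> t x \<in> carrier F" and add: ?add and smult: ?smult by auto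
  have t0: "t \<zero>\<^bsub>E\<^esub> = \<zero>\<^bsub>F\<^esub>"
    using smult[rule_format, of "\<zero>\<^bsub>E\<^esub>" 0] E F t by simp
  have "continuous_map (ntopology E) (ntopology F) t \<longleftrightarrow> ?bdd"
  proof
    assume cont: "continuous_map (ntopology E) (ntopology F) t"
    have "openin (ntopology E)
        {x \<in> carrier E. t x \<in> {y \<in> carrier F. vnorm F (\<zero>\<^bsub>F\<^esub> \<ominus>\<^bsub>F\<^esub> y) < 1}}"
      using openin_continuous_map_preimage[OF cont openin_ntopology_ball[OF F, of "\<zero>\<^bsub>F\<^esub>" 1]] E F by simp
    moreover have "\<zero>\<^bsub>E\<^esub> \<in> {x \<in> carrier E. t x \<in> {y \<in> carrier F. vnorm F (\<zero>\<^bsub>F\<^esub> \<ominus>\<^bsub>F\<^esub> y) < 1}}"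
      using E F t0 by simp
    ultimately obtain r where r: "r > 0"
      "\<forall>y\<in>carrier E. vnorm E (\<zero>\<^bsub>E\<^esub> \<ominus>\<^bsub>E\<^esub> y) < r \<longrightarrow>
        y \<in> {x \<in> carrier E. t x \<in> {y \<in> carrier F. vnorm F (\<zero>\<^bsub>F\<^esub> \<ominus>\<^bsub>F\<^esub> y) < 1}}"
      unfolding openin_ntopology[OF E] by blast
    have "vnorm F (t x) \<le> 2 / r * vnorm E x" if x: "x \<in> carrier E" for x
    proof (cases "x = \<zero>\<^bsub>E\<^esub>")
      case False
      then have pos: "vnorm E x > 0" using ns_norm_eq0[OF E x] ns_norm_ge0[OF E x] by simp
      define c where "c = r / (2 * vnorm E x)"
      have c: "c > 0" using r pos by (simp add: c_def)
      have "vnorm E (of_real c \<odot>\<^bsub>E\<^esub> x) < r"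
        unfolding ns_norm_smult[OF E x] norm_of_real using c r(1) pos by (simp add: c_def)
      then have "vnorm F (t (of_real c \<odot>\<^bsub>E\<^esub> x)) < 1"
        using r(2)[rule_format, of "of_real c \<odot>\<^bsub>E\<^esub> x"] E F x t by simp
      then have "c * vnorm F (t x) < 1" using smult E F x t c by (simp add: ns_norm_smult)
      then show ?thesis using pos r(1) by (simp add: c_def field_simps)
    qed (use t0 E F in simp)
    then show ?bdd using r by (intro exI[of _ "2 / r"]) auto
  next
    assume ?bdd
    then obtain B where B: "B \<ge> 0" "\<And>x. x \<in> carrier E \<Longrightarrow> vnorm F (t x) \<le> B * vnorm E x" by blast
    have diff: "vnorm F (t x \<ominus>\<^bsub>F\<^esub> t y) \<le> B * vnorm E (x \<ominus>\<^bsub>E\<^esub> y)" if "x \<in> carrier E" "y \<in> carrier E" for x y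
      using B(2)[of "x \<ominus>\<^bsub>E\<^esub> y"] add smult that E F t by (simp add: ns_diff_eq)
    show "continuous_map (ntopology E) (ntopology F) t"
      unfolding continuous_map_def
    proof safe
      show "t x \<in> topspace (ntopology F)" if "x \<in> topspace (ntopology E)" for x
        using that E F t by simp
      fix U assume U: "openin (ntopology F) U"
      show "openin (ntopology E) {x \<in> topspace (ntopology E). t x \<in> U}"
        unfolding openin_ntopology[OF E]
      proof safe
        fix x assume x: "x \<in> topspace (ntopology E)" "t x \<in> U"
        then obtain r where r: "r > 0" "\<And>y. y \<in> carrier F \<Longrightarrow> vnorm F (t x \<ominus>\<^bsub>F\<^esub> y) < r \<Longrightarrow> y \<in> U"
          using U x(2) unfolding openin_ntopology[OF F] by meson
        have "t y \<in> U" if y: "y \<in> carrier E" "vnorm E (x \<ominus>\<^bsub>E\<^esub> y) < r / (B + 1)" for y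
        proof (rule r(2))
          have "vnorm F (t x \<ominus>\<^bsub>F\<^esub> t y) \<le> (B + 1) * vnorm E (x \<ominus>\<^bsub>E\<^esub> y)"
            using diff[of x y] x y E ns_norm_ge0[OF E, of "x \<ominus>\<^bsub>E\<^esub> y"] by (simp add: algebra_simps)
          also have "\<dots> < r" using y(2) B(1) by (simp add: field_simps)
          finally show "vnorm F (t x \<ominus>\<^bsub>F\<^esub> t y) < r" .
        qed (use y t in auto)
        then show "\<exists>r>0. \<forall>y\<in>carrier E. vnorm E (x \<ominus>\<^bsub>E\<^esub> y) < r \<longrightarrow> y \<in> {x \<in> topspace (ntopology E). t x \<in> U}"
          using r(1) B(1) E by (intro exI[of _ "r / (B + 1)"]) auto
      qed (use E in auto)
    qed
  qed
  then show ?thesis using True by (auto simp: linear_ops_def)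
qed (auto simp: linear_ops_def)

lemma prod_carrier_iff: "x \<in> prod_carrier E \<longleftrightarrow> (\<forall>i. x i \<in> carrier (E i))"
  by (auto simp: prod_carrier_def)

text \<open>The algebraic half of \<^const>\<open>multilinear_ops\<close>. Operators are constructed in two steps, first multilinearity
  and then a norm estimate, which gives continuity.\<close>

definition multilinear_map ::
  "('n::finite \<Rightarrow> ('k::real_normed_field, 'a) nspace) \<Rightarrow> ('k, 'b) nspace \<Rightarrow> (('n \<Rightarrow> 'a) \<Rightarrow> 'b) \<Rightarrow> bool"
  where
  "multilinear_map E F T \<longleftrightarrow>
     T \<in> prod_carrier E \<rightarrow>\<^sub>E carrier F \<and>
     (\<forall>x\<in>prod_carrier E. \<forall>i. \<forall>y\<in>carrier (E i). \<forall>z\<in>carrier (E i).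
        T (x(i := y \<oplus>\<^bsub>E i\<^esub> z)) = T (x(i := y)) \<oplus>\<^bsub>F\<^esub> T (x(i := z))) \<and>
     (\<forall>x\<in>prod_carrier E. \<forall>i. \<forall>c. \<forall>y\<in>carrier (E i).
        T (x(i := c \<odot>\<^bsub>E i\<^esub> y)) = c \<odot>\<^bsub>F\<^esub> T (x(i := y)))"

lemma multilinear_ops_imp_map: "T \<in> multilinear_ops E F \<Longrightarrow> multilinear_map E F T"
  by (simp add: multilinear_ops_def multilinear_map_def)

lemma multilinear_map_closed:
  "multilinear_map E F T \<Longrightarrow> x \<in> prod_carrier E \<Longrightarrow> T x \<in> carrier F"
  by (auto simp: multilinear_map_def)

lemma multilinear_map_zero:
  assumes "\<And>i. normed_space (E i)" "normed_space F" "multilinear_map E F T"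
    "x \<in> prod_carrier E" "x i = \<zero>\<^bsub>E i\<^esub>"
  shows "T x = \<zero>\<^bsub>F\<^esub>"
proof -
  have "T (x(i := 0 \<odot>\<^bsub>E i\<^esub> x i)) = 0 \<odot>\<^bsub>F\<^esub> T (x(i := x i))"
    using assms unfolding multilinear_map_def by (metis prod_carrier_iff)
  moreover have "x(i := 0 \<odot>\<^bsub>E i\<^esub> x i) = x" using assms(1)[of i] assms(5) by auto
  ultimately show ?thesis using multilinear_map_closed[OF assms(3,4)] assms(2) by simp
qed

lemma multilinear_map_scale:
  assumes E: "\<And>i. normed_space (E i)" and F: "normed_space F" and T: "multilinear_map E F T"
    and x: "x \<in> prod_carrier E"
  shows "T (\<lambda>i. c i \<odot>\<^bsub>E i\<^esub> x i) = (\<Prod>i\<in>UNIV. c i) \<odot>\<^bsub>F\<^esub> T x"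
proof -
  define y where "y A = (\<lambda>i. if i \<in> A then c i \<odot>\<^bsub>E i\<^esub> x i else x i)" for A
  have yc: "y A \<in> prod_carrier E" for A using E x by (simp add: prod_carrier_iff y_def)
  have "T (y A) = (\<Prod>i\<in>A. c i) \<odot>\<^bsub>F\<^esub> T x" if "finite A" for A
    using that
  proof induction
    case empty
    then show ?case using multilinear_map_closed[OF T x] F by (simp add: y_def)
  next
    case (insert k A)
    have "T (y (insert k A)) = T ((y A)(k := c k \<odot>\<^bsub>E k\<^esub> x k))"
      by (rule arg_cong[where f = T]) (auto simp: y_def)
    also have "\<dots> = c k \<odot>\<^bsub>F\<^esub> T ((y A)(k := x k))"
      using T yc[of A] x[unfolded prod_carrier_iff] unfolding multilinear_map_def by blast
    also have "(y A)(k := x k) = y A" using insert by (auto simp: y_def)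
    finally show ?case using insert F multilinear_map_closed[OF T x] by simp
  qed
  from this[of UNIV] show ?thesis by (simp add: y_def)
qed

text \<open>Pass from \<open>a\<close> to \<open>x\<close> by changing one coordinate at a time. By multilinearity each change is a value
  of \<open>T\<close> at a tuple with one entry of norm at most \<open>\<delta>\<close> and the other entries of norm at most \<open>M\<close>.\<close>

lemma multilinear_map_diff_bound:
  fixes E :: "'n::finite \<Rightarrow> ('k::real_normed_field, 'a) nspace" and M \<delta> :: real
  assumes E: "\<And>i. normed_space (E i)" and F: "normed_space F" and T: "multilinear_map E F T"
    and B: "B \<ge> 0" "\<And>x. x \<in> prod_carrier E \<Longrightarrow> vnorm F (T x) \<le> B * (\<Prod>i\<in>UNIV. vnorm (E i) (x i))"
    and x: "x \<in> prod_carrier E" and a: "a \<in> prod_carrier E"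
    and M: "\<And>i. vnorm (E i) (x i) \<le> M" "\<And>i. vnorm (E i) (a i) \<le> M"
    and d: "\<And>i. vnorm (E i) (x i \<ominus>\<^bsub>E i\<^esub> a i) \<le> \<delta>"
  shows "vnorm F (T x \<ominus>\<^bsub>F\<^esub> T a) \<le> CARD('n) * (B * \<delta> * M ^ (CARD('n) - 1))"
proof -
  define g where "g A = (\<lambda>i. if i \<in> A then x i else a i)" for A
  have gc: "g A \<in> prod_carrier E" for A using x a by (simp add: prod_carrier_iff g_def)
  have "vnorm F (T (g A) \<ominus>\<^bsub>F\<^esub> T a) \<le> card A * (B * \<delta> * M ^ (CARD('n) - 1))" if "finite A" for A
    using that
  proof induction
    case empty
    then show ?case using multilinear_map_closed[OF T a] F by (simp add: g_def)
  next
    case (insert k A)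
    let ?d = "(g A)(k := x k \<ominus>\<^bsub>E k\<^esub> a k)"
    have xk: "x k \<in> carrier (E k)" and ak: "a k \<in> carrier (E k)" using x a by (auto simp: prod_carrier_iff)
    have dc: "?d \<in> prod_carrier E" using gc[of A] xk ak E[of k] by (auto simp: prod_carrier_iff)
    have "T (g (insert k A)) = T ((g A)(k := (x k \<ominus>\<^bsub>E k\<^esub> a k) \<oplus>\<^bsub>E k\<^esub> a k))"
      using xk ak E[of k] by (intro arg_cong[where f = T]) (auto simp: g_def)
    also have "\<dots> = T ?d \<oplus>\<^bsub>F\<^esub> T ((g A)(k := a k))"
    proof -
      have "x k \<ominus>\<^bsub>E k\<^esub> a k \<in> carrier (E k)" using xk ak E[of k] by simp
      then show ?thesis using T gc[of A] ak unfolding multilinear_map_def by blast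
    qed
    also have "(g A)(k := a k) = g A" using insert by (auto simp: g_def)
    finally have eq: "T (g (insert k A)) = T ?d \<oplus>\<^bsub>F\<^esub> T (g A)" .
    have "T (g (insert k A)) \<ominus>\<^bsub>F\<^esub> T (g A) = T ?d"
      unfolding eq by (rule ns_diff_cancel(5)[OF F multilinear_map_closed[OF T gc] multilinear_map_closed[OF T dc]])
    then have "vnorm F (T (g (insert k A)) \<ominus>\<^bsub>F\<^esub> T a) \<le> vnorm F (T ?d) + vnorm F (T (g A) \<ominus>\<^bsub>F\<^esub> T a)"
      using ns_norm_diff_triangle[OF F, of "T (g (insert k A))" "T (g A)" "T a"]
        multilinear_map_closed[OF T] gc a by simp
    also have "vnorm F (T ?d) \<le> B * (\<delta> * M ^ (CARD('n) - 1))"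
    proof -
      have "(\<Prod>i\<in>UNIV. vnorm (E i) (?d i)) = vnorm (E k) (x k \<ominus>\<^bsub>E k\<^esub> a k) * (\<Prod>i\<in>UNIV-{k}. vnorm (E i) (g A i))"
        by (subst prod.remove[of _ k]) auto
      also have "\<dots> \<le> \<delta> * (\<Prod>i\<in>UNIV-{k}. M)"
      proof (intro mult_mono d prod_mono conjI prod_nonneg ballI)
        have "0 \<le> vnorm (E k) (x k \<ominus>\<^bsub>E k\<^esub> a k)" using E[of k] xk ak by (simp add: ns_norm_ge0)
        then show "0 \<le> \<delta>" using d[of k] by simp
        show "0 \<le> vnorm (E i) (g A i)" "0 \<le> vnorm (E i) (g A i)" for i
          using gc[of A] E[of i] by (simp_all add: prod_carrier_iff ns_norm_ge0)
        show "vnorm (E i) (g A i) \<le> M" for i using M by (simp add: g_def)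
      qed
      finally have "(\<Prod>i\<in>UNIV. vnorm (E i) (?d i)) \<le> \<delta> * M ^ (CARD('n) - 1)" by (simp add: card_Diff_singleton)
      then show ?thesis using B(1) B(2)[OF dc] by (meson mult_left_mono order_trans)
    qed
    finally show ?case using insert by (simp add: algebra_simps)
  qed
  from this[of UNIV] show ?thesis by (simp add: g_def)
qed

text \<open>As for linear operators: continuity at \<open>0\<close> gives a box on which \<open>T\<close> is bounded, and scaling the
  coordinates separately turns this into a bound by the product of the norms. Conversely, bounded
  multilinear maps are Lipschitz on bounded sets.\<close>

lemma multilinear_ops_iff:
  fixes E :: "'n::finite \<Rightarrow> ('k::real_normed_field, 'a) nspace" and F :: "('k, 'b) nspace"
  assumes E: "\<And>i. normed_space (E i)" and F: "normed_space F"
  shows "T \<in> multilinear_ops E F \<longleftrightarrow> multilinear_map E F T \<and>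
    (\<exists>B\<ge>0. \<forall>x\<in>prod_carrier E. vnorm F (T x) \<le> B * (\<Prod>i\<in>UNIV. vnorm (E i) (x i)))"
    (is "_ \<longleftrightarrow> _ \<and> ?bdd")
proof (cases "multilinear_map E F T")
  case T: True
  let ?X = "product_topology (\<lambda>i. ntopology (E i)) UNIV"
  have top: "topspace ?X = prod_carrier E" using E by (auto simp: prod_carrier_def)
  have nn: "vnorm (E i) (x i) \<ge> 0" if "x \<in> prod_carrier E" for x i
    using that E by (simp add: prod_carrier_iff ns_norm_ge0)
  have "continuous_map ?X (ntopology F) T \<longleftrightarrow> ?bdd"
  proof
    assume cont: "continuous_map ?X (ntopology F) T"
    have op: "openin ?X {x \<in> prod_carrier E. T x \<in> {y \<in> carrier F. vnorm F (\<zero>\<^bsub>F\<^esub> \<ominus>\<^bsub>F\<^esub> y) < 1}}"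
      using openin_continuous_map_preimage[OF cont openin_ntopology_ball[OF F, of "\<zero>\<^bsub>F\<^esub>" 1]] F
      unfolding top by simp
    have z: "(\<lambda>i. \<zero>\<^bsub>E i\<^esub>) \<in> prod_carrier E" using E by (simp add: prod_carrier_iff)
    have "T (\<lambda>i. \<zero>\<^bsub>E i\<^esub>) = \<zero>\<^bsub>F\<^esub>" using multilinear_map_zero[OF E F T z, of undefined] by simp
    then have "(\<lambda>i. \<zero>\<^bsub>E i\<^esub>) \<in> {x \<in> prod_carrier E. T x \<in> {y \<in> carrier F. vnorm F (\<zero>\<^bsub>F\<^esub> \<ominus>\<^bsub>F\<^esub> y) < 1}}"
      using z F by simp
    then obtain U where "\<forall>i\<in>UNIV. openin (ntopology (E i)) (U i)" "(\<lambda>i. \<zero>\<^bsub>E i\<^esub>) \<in> PiE UNIV U"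
      and U3: "PiE UNIV U \<subseteq> {x \<in> prod_carrier E. T x \<in> {y \<in> carrier F. vnorm F (\<zero>\<^bsub>F\<^esub> \<ominus>\<^bsub>F\<^esub> y) < 1}}"
      using op unfolding openin_product_topology_alt by blast
    then have U: "openin (ntopology (E i)) (U i)" "\<zero>\<^bsub>E i\<^esub> \<in> U i" for i by auto
    have "\<exists>r>0. \<forall>y\<in>carrier (E i). vnorm (E i) y < r \<longrightarrow> y \<in> U i" for i
    proof -
      obtain r where "r > 0" "\<forall>y\<in>carrier (E i). vnorm (E i) (\<zero>\<^bsub>E i\<^esub> \<ominus>\<^bsub>E i\<^esub> y) < r \<longrightarrow> y \<in> U i"
        using U[of i] unfolding openin_ntopology[OF E] by blast
      then show ?thesis using E[of i] by auto
    qed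
    then obtain \<rho> where \<rho>: "\<And>i. \<rho> i > 0" "\<And>i y. y \<in> carrier (E i) \<Longrightarrow> vnorm (E i) y < \<rho> i \<Longrightarrow> y \<in> U i"
      by metis
    define r where "r = Min (range \<rho>)"
    have r: "r > 0" "r \<le> \<rho> i" for i using \<rho>(1) by (auto simp: r_def)
    have small: "vnorm F (T x) < 1" if "x \<in> prod_carrier E" "\<And>i. vnorm (E i) (x i) < r" for x
    proof -
      have "x i \<in> U i" for i
        using \<rho>(2)[of "x i" i] that(1) less_le_trans[OF that(2) r(2)] by (auto simp: prod_carrier_iff)
      then have "x \<in> PiE UNIV U" by auto
      with U3 show ?thesis using F multilinear_map_closed[OF T that(1)] by auto
    qed
    have "vnorm F (T x) \<le> (2 / r) ^ CARD('n) * (\<Prod>i\<in>UNIV. vnorm (E i) (x i))" if x: "x \<in> prod_carrier E" for x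
    proof (cases "\<exists>i. x i = \<zero>\<^bsub>E i\<^esub>")
      case True
      then have "T x = \<zero>\<^bsub>F\<^esub>" using multilinear_map_zero[OF E F T x] by blast
      then show ?thesis using F r(1) nn[OF x] by (simp add: prod_nonneg)
    next
      case False
      have xc: "x i \<in> carrier (E i)" for i using x by (simp add: prod_carrier_iff)
      have pos: "vnorm (E i) (x i) > 0" for i
        using False ns_norm_eq0[OF E xc[of i]] nn[OF x, of i] by simp
      \<comment> \<open>Rescale every coordinate to norm \<open>r / 2\<close>, which is inside the box.\<close>
      define c where "c i = r / (2 * vnorm (E i) (x i))" for i
      have c: "c i > 0" for i using r(1) pos by (simp add: c_def)
      have "vnorm F (T (\<lambda>i. of_real (c i) \<odot>\<^bsub>E i\<^esub> x i)) < 1"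
      proof (rule small)
        show "(\<lambda>i. of_real (c i) \<odot>\<^bsub>E i\<^esub> x i) \<in> prod_carrier E" using E xc by (simp add: prod_carrier_iff)
        show "vnorm (E i) (of_real (c i) \<odot>\<^bsub>E i\<^esub> x i) < r" for i
          unfolding ns_norm_smult[OF E xc] norm_of_real using c[of i] pos[of i] r(1) by (simp add: c_def)
      qed
      then have "norm (\<Prod>i\<in>UNIV. of_real (c i) :: 'k) * vnorm F (T x) < 1"
        using multilinear_map_closed[OF T x] F
        by (simp add: multilinear_map_scale[OF E F T x] ns_norm_smult)
      moreover have "norm (\<Prod>i\<in>UNIV. of_real (c i) :: 'k) = (\<Prod>i\<in>UNIV. c i)"
        using c by (simp add: prod_norm[symmetric] less_imp_le)
      moreover have "(\<Prod>i\<in>UNIV. c i) * ((2 / r) ^ CARD('n) * (\<Prod>i\<in>UNIV. vnorm (E i) (x i))) = 1"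
      proof -
        have "(\<Prod>i\<in>UNIV. c i) * ((2 / r) ^ CARD('n) * (\<Prod>i\<in>UNIV. vnorm (E i) (x i)))
          = (\<Prod>i\<in>UNIV. c i * (2 / r * vnorm (E i) (x i)))" by (simp only: prod.distrib prod_constant)
        also have "\<dots> = 1" using pos r(1) by (intro prod.neutral) (simp add: c_def less_imp_neq[symmetric])
        finally show ?thesis .
      qed
      moreover have "(\<Prod>i\<in>UNIV. c i) > 0" using c by (simp add: prod_pos)
      ultimately have "(\<Prod>i\<in>UNIV. c i) * vnorm F (T x)
          < (\<Prod>i\<in>UNIV. c i) * ((2 / r) ^ CARD('n) * (\<Prod>i\<in>UNIV. vnorm (E i) (x i)))" by simp
      then show ?thesis using \<open>(\<Prod>i\<in>UNIV. c i) > 0\<close> by (simp only: mult_less_cancel_left_pos less_imp_le)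
    qed
    then show ?bdd using r(1) by (intro exI[of _ "(2 / r) ^ CARD('n)"]) auto
  next
    assume ?bdd
    then obtain B where B: "B \<ge> 0"
      "\<And>x. x \<in> prod_carrier E \<Longrightarrow> vnorm F (T x) \<le> B * (\<Prod>i\<in>UNIV. vnorm (E i) (x i))" by blast
    show "continuous_map ?X (ntopology F) T"
      unfolding continuous_map_def
    proof (intro conjI allI impI)
      show "T \<in> topspace ?X \<rightarrow> topspace (ntopology F)"
        unfolding top using F multilinear_map_closed[OF T] by auto
      fix V assume V: "openin (ntopology F) V"
      show "openin ?X {x \<in> topspace ?X. T x \<in> V}"
        unfolding openin_product_topology_alt
      proof
        fix a assume "a \<in> {x \<in> topspace ?X. T x \<in> V}"
        then have a: "a \<in> prod_carrier E" "T a \<in> V" unfolding top by auto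
        then obtain r where r: "r > 0" "\<And>y. y \<in> carrier F \<Longrightarrow> vnorm F (T a \<ominus>\<^bsub>F\<^esub> y) < r \<Longrightarrow> y \<in> V"
          using V a(2) unfolding openin_ntopology[OF F] by meson
        define M where "M = 1 + (\<Sum>i\<in>UNIV. vnorm (E i) (a i))"
        define K where "K = CARD('n) * (B * M ^ (CARD('n) - 1))"
        define \<delta> where "\<delta> = min 1 (r / (K + 1))"
        have aM: "vnorm (E i) (a i) + 1 \<le> M" for i
          using member_le_sum[of i UNIV "\<lambda>i. vnorm (E i) (a i)"] nn[OF a(1)] by (simp add: M_def)
        have "M \<ge> 0" using nn[OF a(1)] by (simp add: M_def sum_nonneg add_nonneg_nonneg)
        then have K: "K \<ge> 0" using B(1) by (simp add: K_def)
        have \<delta>: "\<delta> > 0" "\<delta> \<le> 1" "K * \<delta> < r"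
        proof -
          show "\<delta> > 0" "\<delta> \<le> 1" using K r by (auto simp: \<delta>_def)
          have "K * \<delta> \<le> K * (r / (K + 1))" using K by (intro mult_left_mono) (auto simp: \<delta>_def)
          also have "\<dots> < r" using K r by (simp add: field_simps)
          finally show "K * \<delta> < r" .
        qed
        define U where "U i = {y \<in> carrier (E i). vnorm (E i) (a i \<ominus>\<^bsub>E i\<^esub> y) < \<delta>}" for i
        have ac: "a i \<in> carrier (E i)" for i using a(1) by (simp add: prod_carrier_iff)
        have "T x \<in> V" if x: "x \<in> PiE UNIV U" for x
        proof (rule r(2))
          have xc: "x \<in> prod_carrier E" and xd: "vnorm (E i) (x i \<ominus>\<^bsub>E i\<^esub> a i) < \<delta>" for i
            using x E ac by (auto simp: U_def prod_carrier_iff ns_norm_diff_commute PiE_iff)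
          have xM: "vnorm (E i) (x i) \<le> M" for i
            using ns_norm_le_diff[OF E _ ac, of "x i" i] xc xd[of i] \<delta>(2) aM[of i]
            by (simp add: prod_carrier_iff)
          have aM': "vnorm (E i) (a i) \<le> M" for i using aM[of i] by simp
          have "vnorm F (T x \<ominus>\<^bsub>F\<^esub> T a) \<le> CARD('n) * (B * \<delta> * M ^ (CARD('n) - 1))"
            using xd by (intro multilinear_map_diff_bound[OF E F T B xc a(1) xM aM']) (auto intro: less_imp_le)
          also have "\<dots> = K * \<delta>" by (simp add: K_def)
          finally show "vnorm F (T a \<ominus>\<^bsub>F\<^esub> T x) < r"
            using \<delta>(3) F multilinear_map_closed[OF T] xc a(1) by (simp add: ns_norm_diff_commute)
          show "T x \<in> carrier F" using multilinear_map_closed[OF T xc] .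
        qed
        moreover have "PiE UNIV U \<subseteq> prod_carrier E" by (auto simp: U_def prod_carrier_def)
        moreover have "openin (ntopology (E i)) (U i)" for i
          unfolding U_def by (rule openin_ntopology_ball[OF E ac])
        moreover have "a \<in> PiE UNIV U" using E ac \<delta>(1) by (simp add: U_def PiE_iff)
        ultimately show "\<exists>U. finite {i \<in> UNIV. U i \<noteq> topspace (ntopology (E i))} \<and>
          (\<forall>i\<in>UNIV. openin (ntopology (E i)) (U i)) \<and> a \<in> PiE UNIV U \<and> PiE UNIV U \<subseteq> {x \<in> topspace ?X. T x \<in> V}"
          unfolding top by (intro exI[of _ U]) auto
      qed
    qed
  qed
  then show ?thesis using T by (auto simp: multilinear_ops_def multilinear_map_def)
qed (auto simp: multilinear_ops_def multilinear_map_def)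

lemma normed_space_scalar_copy:
  fixes \<iota> :: "'k::real_normed_field \<Rightarrow> 'a"
  assumes "inj \<iota>" shows "normed_space (scalar_copy \<iota>)"
proof -
  have inv: "the_inv \<iota> (\<iota> c) = c" for c using assms by (rule the_inv_f_f)
  have "abelian_group (scalar_copy \<iota>)"
  proof (rule abelian_groupI)
    fix x assume "x \<in> carrier (scalar_copy \<iota>)"
    then obtain c where "x = \<iota> c" by (auto simp: scalar_copy_def)
    then show "\<exists>y\<in>carrier (scalar_copy \<iota>). y \<oplus>\<^bsub>scalar_copy \<iota>\<^esub> x = \<zero>\<^bsub>scalar_copy \<iota>\<^esub>"
      by (intro bexI[of _ "\<iota> (- c)"]) (auto simp: scalar_copy_def inv)
  qed (auto simp: scalar_copy_def inv algebra_simps)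
  then have "Module.module scalar_ring (scalar_copy \<iota>)"
    by (intro moduleI[OF cring_scalar_ring]) (auto simp: scalar_copy_def inv algebra_simps)
  then show ?thesis
    using assms by (auto simp: normed_space_def scalar_copy_def inv norm_triangle_ineq norm_mult inj_eq)
qed

lemma dual_iff:
  fixes F :: "('k::real_normed_field, 'a) nspace"
  assumes F: "normed_space F"
  shows "\<phi> \<in> dual F \<longleftrightarrow> \<phi> \<in> extensional (carrier F) \<and>
     (\<forall>x\<in>carrier F. \<forall>y\<in>carrier F. \<phi> (x \<oplus>\<^bsub>F\<^esub> y) = \<phi> x + \<phi> y) \<and>
     (\<forall>c. \<forall>x\<in>carrier F. \<phi> (c \<odot>\<^bsub>F\<^esub> x) = c * \<phi> x) \<and>
     (\<exists>B\<ge>0. \<forall>x\<in>carrier F. norm (\<phi> x) \<le> B * vnorm F x)"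
proof -
  have "the_inv (\<lambda>c. c) = (\<lambda>c::'k. c)" by (rule ext, rule the_inv_f_f) auto
  then have "carrier (scalar_copy (\<lambda>c::'k. c)) = UNIV" "add (scalar_copy (\<lambda>c::'k. c)) = (+)"
    "smult (scalar_copy (\<lambda>c::'k. c)) = (*)" "vnorm (scalar_copy (\<lambda>c::'k. c)) = norm"
    by (auto simp: scalar_copy_def)
  then show ?thesis
    unfolding dual_def
    using linear_ops_iff[OF F normed_space_scalar_copy[of "\<lambda>c::'k. c"], of \<phi>]
    by (auto simp: PiE_def)
qed

lemma zero_in_unit_ball: "normed_space E \<Longrightarrow> \<zero>\<^bsub>E\<^esub> \<in> unit_ball E"
  by (simp add: unit_ball_def)

lemma normalize_in_unit_ball:
  assumes "normed_space E" "x \<in> carrier E" "x \<noteq> \<zero>\<^bsub>E\<^esub>"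
  shows "vnorm E x > 0" and "of_real (inverse (vnorm E x)) \<odot>\<^bsub>E\<^esub> x \<in> unit_ball E"
proof -
  show "vnorm E x > 0" using assms ns_norm_eq0 ns_norm_ge0 by fastforce
  then show "of_real (inverse (vnorm E x)) \<odot>\<^bsub>E\<^esub> x \<in> unit_ball E"
    using assms by (simp add: unit_ball_def ns_norm_smult del: of_real_inverse)
qed

lemma opnorm:
  assumes E: "normed_space E" and F: "normed_space F" and t: "t \<in> linear_ops E F"
  shows opnorm_nonneg: "opnorm E F t \<ge> 0"
    and opnorm_bound: "x \<in> carrier E \<Longrightarrow> vnorm F (t x) \<le> opnorm E F t * vnorm E x"
proof -
  obtain B where tc: "\<And>x. x \<in> carrier E \<Longrightarrow> t x \<in> carrier F"
    and smult: "\<And>c x. x \<in> carrier E \<Longrightarrow> t (c \<odot>\<^bsub>E\<^esub> x) = c \<odot>\<^bsub>F\<^esub> t x"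
    and B: "B \<ge> 0" "\<And>x. x \<in> carrier E \<Longrightarrow> vnorm F (t x) \<le> B * vnorm E x"
    using t unfolding linear_ops_iff[OF E F] by blast
  have bdd: "bdd_above ((\<lambda>x. vnorm F (t x)) ` unit_ball E)"
  proof (rule bdd_aboveI2)
    fix x assume "x \<in> unit_ball E"
    then show "vnorm F (t x) \<le> B"
      using B(2)[of x] mult_left_mono[OF _ B(1), of "vnorm E x" 1] by (simp add: unit_ball_def)
  qed
  have le: "vnorm F (t x) \<le> opnorm E F t" if "x \<in> unit_ball E" for x
    unfolding opnorm_def by (rule cSUP_upper[OF that bdd])
  show "opnorm E F t \<ge> 0"
    using le[OF zero_in_unit_ball[OF E]] ns_norm_ge0[OF F] tc E by (meson ns_closed(1) order_trans)
  show "vnorm F (t x) \<le> opnorm E F t * vnorm E x" if x: "x \<in> carrier E" for x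
  proof (cases "x = \<zero>\<^bsub>E\<^esub>")
    case True
    then have "vnorm F (t x) \<le> B * 0" using B(2)[OF x] E by simp
    then show ?thesis using True E by simp
  next
    case False
    note n = normalize_in_unit_ball[OF E x False]
    have "inverse (vnorm E x) * vnorm F (t x) \<le> opnorm E F t"
      using le[OF n(2)] smult[OF x] tc[OF x] n(1) F by (simp add: ns_norm_smult del: of_real_inverse)
    then show ?thesis using n(1) by (simp add: field_simps)
  qed
qed

section \<open>Norming functionals\<close>

definition sublinear_on :: "('k::real_normed_field, 'a) nspace \<Rightarrow> ('a \<Rightarrow> real) \<Rightarrow> bool" where
  "sublinear_on E q \<longleftrightarrow>
     (\<forall>x\<in>carrier E. \<forall>y\<in>carrier E. q (x \<oplus>\<^bsub>E\<^esub> y) \<le> q x + q y) \<and>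
     (\<forall>r>0. \<forall>x\<in>carrier E. q (of_real r \<odot>\<^bsub>E\<^esub> x) \<le> r * q x)"

lemma sublinear_on_scale:
  assumes "normed_space E" "sublinear_on E q" "0 < r" "x \<in> carrier E"
  shows "q (of_real r \<odot>\<^bsub>E\<^esub> x) = r * q x"
proof (rule antisym)
  show "q (of_real r \<odot>\<^bsub>E\<^esub> x) \<le> r * q x" using assms by (simp add: sublinear_on_def)
  have "q (of_real (1 / r) \<odot>\<^bsub>E\<^esub> (of_real r \<odot>\<^bsub>E\<^esub> x)) \<le> (1 / r) * q (of_real r \<odot>\<^bsub>E\<^esub> x)"
    using assms(2-4) ns_closed(3)[OF assms(1,4)] unfolding sublinear_on_def
    by (metis zero_less_divide_1_iff)
  moreover have "of_real (1 / r) \<odot>\<^bsub>E\<^esub> (of_real r \<odot>\<^bsub>E\<^esub> x) = x"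
    using assms by (simp add: ns_smult(3) flip: of_real_mult)
  ultimately show "r * q x \<le> q (of_real r \<odot>\<^bsub>E\<^esub> x)" using assms(3) by (simp add: field_simps)
qed

lemma sublinear_on_zero:
  assumes "normed_space E" "sublinear_on E q" shows "q \<zero>\<^bsub>E\<^esub> = 0"
  using sublinear_on_scale[OF assms, of 2 "\<zero>\<^bsub>E\<^esub>"] assms(1) by simp

lemma sublinear_on_neg:
  assumes "normed_space E" "sublinear_on E q" "x \<in> carrier E"
  shows "- q ((- 1) \<odot>\<^bsub>E\<^esub> x) \<le> q x"
proof -
  have "q (x \<oplus>\<^bsub>E\<^esub> (- 1) \<odot>\<^bsub>E\<^esub> x) \<le> q x + q ((- 1) \<odot>\<^bsub>E\<^esub> x)"
    using assms by (simp add: sublinear_on_def)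
  moreover have "x \<oplus>\<^bsub>E\<^esub> (- 1) \<odot>\<^bsub>E\<^esub> x = \<zero>\<^bsub>E\<^esub>" using assms by (simp flip: ns_diff_eq)
  ultimately show ?thesis using sublinear_on_zero[OF assms(1,2)] by simp
qed

lemma le_INF_add_INF:
  fixes g :: "'i \<Rightarrow> real" and h :: "'j \<Rightarrow> real"
  assumes "A \<noteq> {}" "B \<noteq> {}" "\<And>s t. s \<in> A \<Longrightarrow> t \<in> B \<Longrightarrow> L \<le> g s + h t"
  shows "L \<le> (INF s\<in>A. g s) + (INF t\<in>B. h t)"
proof -
  have "L - g s \<le> (INF t\<in>B. h t)" if "s \<in> A" for s
    using assms that by (intro cINF_greatest) (auto simp: algebra_simps)
  then have "L - (INF t\<in>B. h t) \<le> (INF s\<in>A. g s)"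
    using assms(1) by (intro cINF_greatest) (auto simp: algebra_simps)
  then show ?thesis by simp
qed

text \<open>The functional is \<open>g x = inf {q (x + t a) - t q a | t \<ge> 0}\<close>. It is smaller than \<open>q\<close> unless
  \<open>q x + q a \<le> q (x + a)\<close> for all \<open>x\<close>, so a minimal sublinear functional is additive. Starting
  with the norm and \<open>a = z\<close>, one gets \<open>g (- z) \<le> - \<parallel>z\<parallel>\<close>, and every linear functional below
  \<open>g\<close> takes the value \<open>\<parallel>z\<parallel>\<close> at \<open>z\<close>.\<close>

lemma sublinear_on_ray:
  fixes E :: "('k::real_normed_field, 'a) nspace"
  assumes N: "normed_space E" and q: "sublinear_on E q" and a: "a \<in> carrier E"
  obtains g where "sublinear_on E g" "\<And>x. x \<in> carrier E \<Longrightarrow> g x \<le> q x"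
    "\<And>x. x \<in> carrier E \<Longrightarrow> g x \<le> q (x \<oplus>\<^bsub>E\<^esub> a) - q a" "\<And>x. x \<notin> carrier E \<Longrightarrow> g x = 0"
proof
  define h where "h x t = q (x \<oplus>\<^bsub>E\<^esub> of_real t \<odot>\<^bsub>E\<^esub> a) - t * q a" for x t
  define g where "g x = (if x \<in> carrier E then INF t\<in>{0..}. h x t else 0)" for x
  have lower: "- q ((- 1) \<odot>\<^bsub>E\<^esub> x) \<le> h x t" if x: "x \<in> carrier E" and t: "0 \<le> t" for x t
  proof -
    have "t * q a = q (of_real t \<odot>\<^bsub>E\<^esub> a)"
      using t sublinear_on_scale[OF N q, of t a] sublinear_on_zero[OF N q] N a
      by (cases "t = 0") auto
    also have "of_real t \<odot>\<^bsub>E\<^esub> a = (x \<oplus>\<^bsub>E\<^esub> of_real t \<odot>\<^bsub>E\<^esub> a) \<oplus>\<^bsub>E\<^esub> (- 1) \<odot>\<^bsub>E\<^esub> x"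
      using N x a ns_diff_cancel(3)[of E x "of_real t \<odot>\<^bsub>E\<^esub> a"] by (simp add: ns_diff_eq ns_add)
    also have "q \<dots> \<le> q (x \<oplus>\<^bsub>E\<^esub> of_real t \<odot>\<^bsub>E\<^esub> a) + q ((- 1) \<odot>\<^bsub>E\<^esub> x)"
      using q N x a by (simp add: sublinear_on_def)
    finally show ?thesis by (simp add: h_def)
  qed
  have bdd: "bdd_below (h x ` {0..})" if "x \<in> carrier E" for x
    using lower[OF that] by (intro bdd_belowI2[where m = "- q ((- 1) \<odot>\<^bsub>E\<^esub> x)"]) auto
  have g_le: "g x \<le> h x t" if "x \<in> carrier E" "0 \<le> t" for x t
    using that bdd by (auto simp: g_def intro!: cINF_lower)
  show "g x \<le> q x" if "x \<in> carrier E" for x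
    using g_le[OF that, of 0] N a that by (simp add: h_def)
  show "g x \<le> q (x \<oplus>\<^bsub>E\<^esub> a) - q a" if "x \<in> carrier E" for x
    using g_le[OF that, of 1] N a that by (simp add: h_def)
  show "g x = 0" if "x \<notin> carrier E" for x using that by (simp add: g_def)
  show "sublinear_on E g"
    unfolding sublinear_on_def
  proof safe
    fix x y assume x: "x \<in> carrier E" and y: "y \<in> carrier E"
    have "g (x \<oplus>\<^bsub>E\<^esub> y) \<le> h x s + h y t" if st: "s \<ge> 0" "t \<ge> 0" for s t
    proof -
      have "(x \<oplus>\<^bsub>E\<^esub> y) \<oplus>\<^bsub>E\<^esub> of_real (s + t) \<odot>\<^bsub>E\<^esub> a
          = (x \<oplus>\<^bsub>E\<^esub> of_real s \<odot>\<^bsub>E\<^esub> a) \<oplus>\<^bsub>E\<^esub> (y \<oplus>\<^bsub>E\<^esub> of_real t \<odot>\<^bsub>E\<^esub> a)"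
        using N x y a by (simp add: ns_distrib(1) ns_add)
      then have "h (x \<oplus>\<^bsub>E\<^esub> y) (s + t) \<le> h x s + h y t"
        using q N x y a by (simp add: h_def sublinear_on_def algebra_simps)
      then show ?thesis using g_le[of "x \<oplus>\<^bsub>E\<^esub> y" "s + t"] N x y st by force
    qed
    then show "g (x \<oplus>\<^bsub>E\<^esub> y) \<le> g x + g y"
      using le_INF_add_INF[of "{0..}" "{0..}" "g (x \<oplus>\<^bsub>E\<^esub> y)" "h x" "h y"] x y
      by (simp add: g_def[of x] g_def[of y])
  next
    fix r :: real and x assume r: "0 < r" and x: "x \<in> carrier E"
    have "g (of_real r \<odot>\<^bsub>E\<^esub> x) / r \<le> h x t" if t: "t \<ge> 0" for t
    proof -
      have "of_real r \<odot>\<^bsub>E\<^esub> x \<oplus>\<^bsub>E\<^esub> of_real (r * t) \<odot>\<^bsub>E\<^esub> a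
          = of_real r \<odot>\<^bsub>E\<^esub> (x \<oplus>\<^bsub>E\<^esub> of_real t \<odot>\<^bsub>E\<^esub> a)"
        using N x a by (simp add: ns_distrib(2))
      then have "h (of_real r \<odot>\<^bsub>E\<^esub> x) (r * t) = r * h x t"
        using sublinear_on_scale[OF N q r, of "x \<oplus>\<^bsub>E\<^esub> of_real t \<odot>\<^bsub>E\<^esub> a"] N x a
        by (simp add: h_def algebra_simps)
      then show ?thesis using g_le[of "of_real r \<odot>\<^bsub>E\<^esub> x" "r * t"] N x r t by (simp add: field_simps)
    qed
    then have "g (of_real r \<odot>\<^bsub>E\<^esub> x) / r \<le> g x"
      using x by (simp add: g_def[of x]) (rule cINF_greatest, auto)
    then show "g (of_real r \<odot>\<^bsub>E\<^esub> x) \<le> r * g x" using r by (simp add: field_simps)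
  qed
qed

text \<open>By Zorn's lemma for the pointwise order. The pointwise infimum of a chain exists because
  \<open>q \<le> s\<close> forces \<open>q x \<ge> - s (- x)\<close>. All functionals live on the whole space, so there are no
  extensions of partial functionals to deal with; the value \<open>0\<close> off the carrier makes the order
  antisymmetric.\<close>

lemma minimal_sublinear_on:
  fixes E :: "('k::real_normed_field, 'a) nspace"
  assumes N: "normed_space E" and s: "sublinear_on E s"
  obtains q where "sublinear_on E q" "\<And>x. x \<in> carrier E \<Longrightarrow> q x \<le> s x"
    "\<forall>g. sublinear_on E g \<longrightarrow> (\<forall>x\<in>carrier E. g x \<le> q x) \<longrightarrow> (\<forall>x\<in>carrier E. g x = q x)"
proof -
  define S where "S = {q. sublinear_on E q \<and> (\<forall>x\<in>carrier E. q x \<le> s x) \<and> (\<forall>x. x \<notin> carrier E \<longrightarrow> q x = 0)}"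
  define P where "P f g \<longleftrightarrow> g \<le> f" for f g :: "'a \<Rightarrow> real"
  have po: "partial_order_on S (relation_of P S)"
    by (rule partial_order_on_relation_ofI) (auto simp: P_def)
  have chain: "\<exists>u\<in>S. \<forall>q\<in>C. P q u" if C: "C \<in> Chains (relation_of P S)" for C
  proof (cases "C = {}")
    case True
    have "(\<lambda>x. if x \<in> carrier E then s x else 0) \<in> S"
      using s N by (auto simp: S_def sublinear_on_def)
    with True show ?thesis by blast
  next
    case False
    have CS: "C \<subseteq> S" and tot: "\<And>f g. f \<in> C \<Longrightarrow> g \<in> C \<Longrightarrow> f \<le> g \<or> g \<le> f"
      using C unfolding Chains_def relation_of_def P_def by auto
    define u where "u x = (INF q\<in>C. q x)" for x
    have lower: "- s ((- 1) \<odot>\<^bsub>E\<^esub> x) \<le> q x" if "q \<in> C" "x \<in> carrier E" for q x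
      using sublinear_on_neg[OF N, of q x] that CS N
      by (force simp: S_def dest!: bspec[where x = "(- 1) \<odot>\<^bsub>E\<^esub> x"])
    have u_le: "u x \<le> q x" if "q \<in> C" for q x
    proof (cases "x \<in> carrier E")
      case True
      then have "bdd_below ((\<lambda>q. q x) ` C)"
        using lower by (intro bdd_belowI2[where m = "- s ((- 1) \<odot>\<^bsub>E\<^esub> x)"]) auto
      then show ?thesis using that by (auto simp: u_def intro: cINF_lower)
    next
      case out: False
      then have "(\<lambda>q. q x) ` C = (\<lambda>q. 0) ` C" using CS by (intro image_cong) (auto simp: S_def)
      then have "(\<lambda>q. q x) ` C = {0}" using \<open>C \<noteq> {}\<close> by auto
      then show ?thesis using out that CS by (auto simp: u_def S_def)
    qed
    have "u \<in> S"
      unfolding S_def sublinear_on_def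
    proof safe
      fix x y assume x: "x \<in> carrier E" and y: "y \<in> carrier E"
      have "u (x \<oplus>\<^bsub>E\<^esub> y) \<le> f x + g y" if f: "f \<in> C" and g: "g \<in> C" for f g
      proof -
        obtain k where k: "k \<in> C" "k \<le> f" "k \<le> g" using tot[OF f g] f g by blast
        have "u (x \<oplus>\<^bsub>E\<^esub> y) \<le> k (x \<oplus>\<^bsub>E\<^esub> y)" by (rule u_le[OF k(1)])
        also have "\<dots> \<le> k x + k y" using k(1) CS x y by (auto simp: S_def sublinear_on_def)
        also have "\<dots> \<le> f x + g y" using k by (auto simp: le_fun_def intro: add_mono)
        finally show ?thesis .
      qed
      then show "u (x \<oplus>\<^bsub>E\<^esub> y) \<le> u x + u y"
        using le_INF_add_INF[OF False False] by (auto simp: u_def)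
    next
      fix r :: real and x assume r: "0 < r" and x: "x \<in> carrier E"
      have "u (of_real r \<odot>\<^bsub>E\<^esub> x) / r \<le> q x" if "q \<in> C" for q
      proof -
        have "q (of_real r \<odot>\<^bsub>E\<^esub> x) \<le> r * q x"
          using that CS x r by (auto simp: S_def sublinear_on_def)
        then show ?thesis using u_le[OF that, of "of_real r \<odot>\<^bsub>E\<^esub> x"] r by (simp add: field_simps)
      qed
      then have "u (of_real r \<odot>\<^bsub>E\<^esub> x) / r \<le> u x"
        unfolding u_def[of x] using False by (intro cINF_greatest) auto
      then show "u (of_real r \<odot>\<^bsub>E\<^esub> x) \<le> r * u x" using r by (simp add: field_simps)
    next
      fix x assume "x \<in> carrier E"
      obtain q where "q \<in> C" using False by blast
      then show "u x \<le> s x" using u_le[of q x] CS \<open>x \<in> carrier E\<close> by (force simp: S_def)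
    next
      fix x assume "x \<notin> carrier E"
      then have "(\<lambda>q. q x) ` C = (\<lambda>q. 0) ` C" using CS by (intro image_cong) (auto simp: S_def)
      then have "(\<lambda>q. q x) ` C = {0}" using False by auto
      then show "u x = 0" by (simp add: u_def)
    qed
    then show ?thesis using u_le by (auto simp: P_def le_fun_def)
  qed
  obtain q where q: "q \<in> S" and min: "\<And>g. g \<in> S \<Longrightarrow> P q g \<Longrightarrow> g = q"
    using predicate_Zorn[OF po chain] by blast
  show ?thesis
  proof
    show "sublinear_on E q" "\<And>x. x \<in> carrier E \<Longrightarrow> q x \<le> s x" using q by (auto simp: S_def)
    have "g x = q x" if g: "sublinear_on E g" "\<forall>x\<in>carrier E. g x \<le> q x" and x: "x \<in> carrier E" for g x
    proof -
    define g' where "g' x = (if x \<in> carrier E then g x else 0)" for x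
    have "sublinear_on E g'" using g(1) N by (auto simp: sublinear_on_def g'_def)
    moreover have "g' y \<le> s y" if "y \<in> carrier E" for y
      using bspec[OF g(2) that] q that by (force simp: S_def g'_def)
    ultimately have "g' \<in> S" by (auto simp: S_def g'_def)
    moreover have "P q g'" using g(2) q by (auto simp: P_def le_fun_def g'_def S_def)
    ultimately have "g' = q" by (rule min)
    then show "g x = q x" using x by (metis g'_def)
    qed
    then show "\<forall>g. sublinear_on E g \<longrightarrow> (\<forall>x\<in>carrier E. g x \<le> q x) \<longrightarrow> (\<forall>x\<in>carrier E. g x = q x)"
      by blast
  qed
qed

text \<open>Hahn-Banach for the underlying real vector space. The functional is a minimal sublinear functional
  below the norm tilted in the direction of \<open>z\<close>.\<close>

lemma real_norming_functional:
  fixes E :: "('k::real_normed_field, 'a) nspace"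
  assumes N: "normed_space E" and z: "z \<in> carrier E"
  obtains f :: "'a \<Rightarrow> real" where
    "\<And>x y. x \<in> carrier E \<Longrightarrow> y \<in> carrier E \<Longrightarrow> f (x \<oplus>\<^bsub>E\<^esub> y) = f x + f y"
    "\<And>r x. x \<in> carrier E \<Longrightarrow> f (of_real r \<odot>\<^bsub>E\<^esub> x) = r * f x"
    "\<And>x. x \<in> carrier E \<Longrightarrow> f x \<le> vnorm E x" "f z = vnorm E z"
proof -
  have nrm: "sublinear_on E (vnorm E)"
    using N by (auto simp: sublinear_on_def ns_norm_triangle ns_norm_smult)
  obtain s where s: "sublinear_on E s" "\<And>x. x \<in> carrier E \<Longrightarrow> s x \<le> vnorm E x"
    "\<And>x. x \<in> carrier E \<Longrightarrow> s x \<le> vnorm E (x \<oplus>\<^bsub>E\<^esub> z) - vnorm E z"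
    using sublinear_on_ray[OF N nrm z] by metis
  obtain q where q: "sublinear_on E q" "\<And>x. x \<in> carrier E \<Longrightarrow> q x \<le> s x"
    and min: "\<forall>g. sublinear_on E g \<longrightarrow> (\<forall>x\<in>carrier E. g x \<le> q x) \<longrightarrow> (\<forall>x\<in>carrier E. g x = q x)"
    using minimal_sublinear_on[OF N s(1)] by blast
  have add: "q (x \<oplus>\<^bsub>E\<^esub> y) = q x + q y" if x: "x \<in> carrier E" and y: "y \<in> carrier E" for x y
  proof (rule antisym)
    show "q (x \<oplus>\<^bsub>E\<^esub> y) \<le> q x + q y" using q(1) x y by (simp add: sublinear_on_def)
    obtain g where g: "sublinear_on E g" "\<And>x. x \<in> carrier E \<Longrightarrow> g x \<le> q x"
      "\<And>x. x \<in> carrier E \<Longrightarrow> g x \<le> q (x \<oplus>\<^bsub>E\<^esub> y) - q y"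
      using sublinear_on_ray[OF N q(1) y] by metis
    have "q x = g x" using min g(1,2) x by simp
    then show "q x + q y \<le> q (x \<oplus>\<^bsub>E\<^esub> y)" using g(3)[OF x] by simp
  qed
  have neg: "q ((- 1) \<odot>\<^bsub>E\<^esub> x) = - q x" if "x \<in> carrier E" for x
    using add[OF that, of "(- 1) \<odot>\<^bsub>E\<^esub> x"] that N sublinear_on_zero[OF N q(1)]
    by (simp flip: ns_diff_eq)
  have scale: "q (of_real r \<odot>\<^bsub>E\<^esub> x) = r * q x" if x: "x \<in> carrier E" for r x
  proof (rule linorder_cases[of r 0])
    assume "r < 0"
    then have "q (of_real (- r) \<odot>\<^bsub>E\<^esub> x) = (- r) * q x" using sublinear_on_scale[OF N q(1), of "- r" x] x by simp
    then show ?thesis using neg[of "of_real r \<odot>\<^bsub>E\<^esub> x"] N x by simp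
  qed (use sublinear_on_scale[OF N q(1)] sublinear_on_zero[OF N q(1)] N x in auto)
  have le: "q x \<le> vnorm E x" if "x \<in> carrier E" for x
    using q(2)[OF that] s(2)[OF that] by simp
  have "- q z = q ((- 1) \<odot>\<^bsub>E\<^esub> z)" using neg[OF z] by simp
  also have "\<dots> \<le> s ((- 1) \<odot>\<^bsub>E\<^esub> z)" using q(2) N z by simp
  also have "\<dots> \<le> vnorm E ((- 1) \<odot>\<^bsub>E\<^esub> z \<oplus>\<^bsub>E\<^esub> z) - vnorm E z" using s(3) N z by simp
  also have "(- 1) \<odot>\<^bsub>E\<^esub> z \<oplus>\<^bsub>E\<^esub> z = \<zero>\<^bsub>E\<^esub>"
    using N z by (simp add: ns_add(1) flip: ns_diff_eq)
  finally have "q z = vnorm E z" using le[OF z] N by simp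
  with add scale le show ?thesis by (rule that)
qed

text \<open>A complex linear functional is determined by its real part \<open>f\<close>, as \<open>f x - i f (i x)\<close>.\<close>

lemma complex_norming_functional:
  fixes E :: "(complex, 'a) nspace"
  assumes N: "normed_space E" and z: "z \<in> carrier E"
  obtains \<phi> where
    "\<And>x y. x \<in> carrier E \<Longrightarrow> y \<in> carrier E \<Longrightarrow> \<phi> (x \<oplus>\<^bsub>E\<^esub> y) = \<phi> x + \<phi> y"
    "\<And>c x. x \<in> carrier E \<Longrightarrow> \<phi> (c \<odot>\<^bsub>E\<^esub> x) = c * \<phi> x"
    "\<And>x. x \<in> carrier E \<Longrightarrow> norm (\<phi> x) \<le> vnorm E x" "norm (\<phi> z) = vnorm E z"
proof -
  obtain f :: "'a \<Rightarrow> real" where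
    add: "\<And>x y. x \<in> carrier E \<Longrightarrow> y \<in> carrier E \<Longrightarrow> f (x \<oplus>\<^bsub>E\<^esub> y) = f x + f y" and
    scale: "\<And>r x. x \<in> carrier E \<Longrightarrow> f (of_real r \<odot>\<^bsub>E\<^esub> x) = r * f x" and
    le: "\<And>x. x \<in> carrier E \<Longrightarrow> f x \<le> vnorm E x" and fz: "f z = vnorm E z"
    using real_norming_functional[OF N z] by metis
  define \<phi> where "\<phi> x = Complex (f x) (- f (\<i> \<odot>\<^bsub>E\<^esub> x))" for x
  have \<phi>_add: "\<phi> (x \<oplus>\<^bsub>E\<^esub> y) = \<phi> x + \<phi> y" if "x \<in> carrier E" "y \<in> carrier E" for x y
    using that N by (simp add: \<phi>_def add ns_distrib(2) complex_eq_iff)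
  have \<phi>_scale: "\<phi> (c \<odot>\<^bsub>E\<^esub> x) = c * \<phi> x" if x: "x \<in> carrier E" for c x
  proof -
    have c: "c \<odot>\<^bsub>E\<^esub> x = of_real (Re c) \<odot>\<^bsub>E\<^esub> x \<oplus>\<^bsub>E\<^esub> of_real (Im c) \<odot>\<^bsub>E\<^esub> (\<i> \<odot>\<^bsub>E\<^esub> x)"
      using N x by (simp flip: ns_distrib(1))
        (rule arg_cong[where f = "\<lambda>c. c \<odot>\<^bsub>E\<^esub> x"], simp add: complex_eq_iff)
    have ic: "\<i> \<odot>\<^bsub>E\<^esub> (c \<odot>\<^bsub>E\<^esub> x) = of_real (Re c) \<odot>\<^bsub>E\<^esub> (\<i> \<odot>\<^bsub>E\<^esub> x) \<oplus>\<^bsub>E\<^esub> of_real (- Im c) \<odot>\<^bsub>E\<^esub> x"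
      using N x by (simp flip: ns_distrib(1))
        (rule arg_cong[where f = "\<lambda>c. c \<odot>\<^bsub>E\<^esub> x"], simp add: complex_eq_iff)
    have "f (c \<odot>\<^bsub>E\<^esub> x) = Re c * f x + Im c * f (\<i> \<odot>\<^bsub>E\<^esub> x)"
      unfolding c using N x by (simp add: add scale del: ns_smult(3))
    moreover have "f (\<i> \<odot>\<^bsub>E\<^esub> (c \<odot>\<^bsub>E\<^esub> x)) = Re c * f (\<i> \<odot>\<^bsub>E\<^esub> x) - Im c * f x"
      unfolding ic using N x add[of "of_real (Re c) \<odot>\<^bsub>E\<^esub> (\<i> \<odot>\<^bsub>E\<^esub> x)" "of_real (- Im c) \<odot>\<^bsub>E\<^esub> x"]
        scale[of "\<i> \<odot>\<^bsub>E\<^esub> x" "Re c"] scale[of x "- Im c"] by (simp del: ns_smult(3) of_real_minus)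
    ultimately show ?thesis by (simp add: \<phi>_def complex_eq_iff del: ns_smult(3))
  qed
  have \<phi>_le: "norm (\<phi> x) \<le> vnorm E x" if x: "x \<in> carrier E" for x
  proof (cases "\<phi> x = 0")
    case False
    \<comment> \<open>Rotate \<open>x\<close> so that \<open>\<phi>\<close> takes a positive real value, which is then a value of \<open>f\<close>.\<close>
    define c where "c = cnj (\<phi> x) / norm (\<phi> x)"
    have c: "norm c = 1" using False by (simp add: c_def norm_divide)
    have "c * \<phi> x = norm (\<phi> x)"
      using False by (simp add: c_def complex_norm_square[symmetric] power2_eq_square mult.commute)
    then have "norm (\<phi> x) = Re (\<phi> (c \<odot>\<^bsub>E\<^esub> x))" using \<phi>_scale[OF x, of c] by simp
    also have "\<dots> \<le> vnorm E (c \<odot>\<^bsub>E\<^esub> x)" using le N x by (simp add: \<phi>_def)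
    also have "\<dots> = vnorm E x" using N x c by (simp add: ns_norm_smult)
    finally show ?thesis .
  qed (use N x in \<open>simp add: ns_norm_ge0\<close>)
  have "vnorm E z \<le> norm (\<phi> z)"
    using complex_Re_le_cmod[of "\<phi> z"] by (simp add: \<phi>_def fz)
  with \<phi>_le[OF z] have "norm (\<phi> z) = vnorm E z" by simp
  with \<phi>_add \<phi>_scale \<phi>_le show ?thesis by (rule that)
qed

text \<open>The Hahn-Banach theorem in the form in which it is applied. Real and complex spaces have this property
  for different reasons, and everything after that treats both together.\<close>

definition norming :: "('k::real_normed_field, 'a) nspace \<Rightarrow> bool" where
  "norming F \<longleftrightarrow> (\<forall>z\<in>carrier F. \<exists>\<phi>\<in>dual F. (\<forall>y\<in>carrier F. norm (\<phi> y) \<le> vnorm F y) \<and> norm (\<phi> z) = vnorm F z)"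

lemma norming_real:
  fixes F :: "(real, 'a) nspace" assumes F: "normed_space F" shows "norming F"
  unfolding norming_def
proof
  fix z assume z: "z \<in> carrier F"
  obtain f :: "'a \<Rightarrow> real" where
    f: "\<And>x y. x \<in> carrier F \<Longrightarrow> y \<in> carrier F \<Longrightarrow> f (x \<oplus>\<^bsub>F\<^esub> y) = f x + f y"
    "\<And>r x. x \<in> carrier F \<Longrightarrow> f (of_real r \<odot>\<^bsub>F\<^esub> x) = r * f x"
    "\<And>x. x \<in> carrier F \<Longrightarrow> f x \<le> vnorm F x" "f z = vnorm F z"
    using real_norming_functional[OF F z] by metis
  have le: "\<bar>f x\<bar> \<le> vnorm F x" if "x \<in> carrier F" for x
    using f(3)[OF that] f(3)[of "(- 1) \<odot>\<^bsub>F\<^esub> x"] f(2)[OF that, of "-1"] ns_norm_smult[OF F that, of "-1"] F that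
    by simp
  show "\<exists>\<phi>\<in>dual F. (\<forall>y\<in>carrier F. norm (\<phi> y) \<le> vnorm F y) \<and> norm (\<phi> z) = vnorm F z"
  proof (rule bexI[of _ "restrict f (carrier F)"])
    show "restrict f (carrier F) \<in> dual F"
      unfolding dual_iff[OF F] using f le F by (auto intro!: exI[of _ 1])
  qed (use z f(4) le ns_norm_ge0[OF F z] in auto)
qed

lemma norming_complex:
  fixes F :: "(complex, 'a) nspace" assumes F: "normed_space F" shows "norming F"
  unfolding norming_def
proof
  fix z assume z: "z \<in> carrier F"
  obtain f where
    f: "\<And>x y. x \<in> carrier F \<Longrightarrow> y \<in> carrier F \<Longrightarrow> f (x \<oplus>\<^bsub>F\<^esub> y) = f x + f y"
    "\<And>c x. x \<in> carrier F \<Longrightarrow> f (c \<odot>\<^bsub>F\<^esub> x) = c * f x"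
    "\<And>x. x \<in> carrier F \<Longrightarrow> norm (f x) \<le> vnorm F x" "norm (f z) = vnorm F z"
    using complex_norming_functional[OF F z] by metis
  show "\<exists>\<phi>\<in>dual F. (\<forall>y\<in>carrier F. norm (\<phi> y) \<le> vnorm F y) \<and> norm (\<phi> z) = vnorm F z"
  proof (rule bexI[of _ "restrict f (carrier F)"])
    show "restrict f (carrier F) \<in> dual F"
      unfolding dual_iff[OF F] using f F by (auto intro!: exI[of _ 1])
  qed (use z f in auto)
qed

section \<open>Hoelder's inequality\<close>

definition lp_norm :: "real \<Rightarrow> 'i set \<Rightarrow> ('i \<Rightarrow> real) \<Rightarrow> real" where
  "lp_norm p I a = (\<Sum>i\<in>I. a i powr p) powr (1 / p)"

lemma lp_norm_nonneg [simp]: "0 \<le> lp_norm p I a"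
  by (simp add: lp_norm_def)

lemma lp_norm_mono:
  assumes "p > 0" "\<And>i. i \<in> I \<Longrightarrow> 0 \<le> a i" "\<And>i. i \<in> I \<Longrightarrow> a i \<le> b i"
  shows "lp_norm p I a \<le> lp_norm p I b"
  unfolding lp_norm_def using assms by (intro powr_mono2 sum_mono sum_nonneg) auto

lemma lp_norm_scale:
  assumes "p > 0" "c \<ge> 0" "\<And>i. i \<in> I \<Longrightarrow> 0 \<le> a i"
  shows "lp_norm p I (\<lambda>i. c * a i) = c * lp_norm p I a"
proof -
  have "(\<Sum>i\<in>I. (c * a i) powr p) = c powr p * (\<Sum>i\<in>I. a i powr p)"
    using assms by (simp add: powr_mult sum_distrib_left cong: sum.cong)
  then show ?thesis using assms by (simp add: lp_norm_def powr_mult powr_powr sum_nonneg)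
qed

lemma lp_norm_pos:
  assumes "finite I" "p > 0" "i \<in> I" "a i > 0"
  shows "lp_norm p I a > 0"
proof -
  have "a i powr p \<le> (\<Sum>i\<in>I. a i powr p)" using assms by (intro member_le_sum) auto
  moreover have "a i powr p > 0" using assms by simp
  ultimately have "(\<Sum>i\<in>I. a i powr p) > 0" by linarith
  then show ?thesis by (simp add: lp_norm_def)
qed

lemma lp_norm_eq_0D:
  assumes "finite I" "p > 0" "lp_norm p I a = 0" "i \<in> I" shows "a i \<le> 0"
  using lp_norm_pos[OF assms(1,2,4), of a] assms(3) by linarith

lemma lp_norm_powr: "p > 0 \<Longrightarrow> (\<And>i. i \<in> I \<Longrightarrow> 0 \<le> a i) \<Longrightarrow> lp_norm p I a powr p = (\<Sum>i\<in>I. a i powr p)"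
  by (simp add: lp_norm_def powr_powr sum_nonneg)

lemma conj_exponent:
  assumes "1 < p"
  shows "conj_exponent p > 1" "1 / p + 1 / conj_exponent p = 1"
  using assms by (simp_all add: conj_exponent_def field_simps)

text \<open>Young's inequality, applied to the families divided by their norms.\<close>

lemma Hoelder_sum:
  assumes p: "1 < p" and I: "finite I" and a: "\<And>i. i \<in> I \<Longrightarrow> 0 \<le> a i" and b: "\<And>i. i \<in> I \<Longrightarrow> 0 \<le> b i"
  shows "(\<Sum>i\<in>I. a i * b i) \<le> lp_norm p I a * lp_norm (conj_exponent p) I b"
proof -
  define q where "q = conj_exponent p"
  have q: "1 < q" "1 / p + 1 / q = 1" using conj_exponent[OF p] by (auto simp: q_def)
  let ?A = "lp_norm p I a" and ?B = "lp_norm q I b"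
  show ?thesis
  proof (cases "?A = 0 \<or> ?B = 0")
    case True
    then have "a i * b i = 0" if "i \<in> I" for i
      using lp_norm_eq_0D[OF I, of p a i] lp_norm_eq_0D[OF I, of q b i] p q a[OF that] b[OF that] that by force
    then have "(\<Sum>i\<in>I. a i * b i) = 0" by (rule sum.neutral[OF ballI])
    then show ?thesis using mult_nonneg_nonneg[OF lp_norm_nonneg lp_norm_nonneg] by simp
  next
    case False
    then have pos: "?A > 0" "?B > 0" by (simp_all add: less_le)
    have "a i / ?A * (b i / ?B) \<le> (a i / ?A) powr p / p + (b i / ?B) powr q / q" if "i \<in> I" for i
      using Youngs_inequality[of p q "a i / ?A" "b i / ?B"] p q a[OF that] b[OF that] pos by simp
    then have "(\<Sum>i\<in>I. a i / ?A * (b i / ?B)) \<le> (\<Sum>i\<in>I. (a i / ?A) powr p / p + (b i / ?B) powr q / q)"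
      by (rule sum_mono)
    also have "\<dots> = (\<Sum>i\<in>I. (a i / ?A) powr p) / p + (\<Sum>i\<in>I. (b i / ?B) powr q) / q"
      by (simp add: sum.distrib sum_divide_distrib)
    also have "(\<Sum>i\<in>I. (a i / ?A) powr p) = (\<Sum>i\<in>I. a i powr p) / ?A powr p"
      using a pos by (simp add: powr_divide sum_divide_distrib)
    also have "\<dots> = 1" using lp_norm_powr[of p I a] p a pos by (metis divide_self less_trans order_less_irrefl powr_gt_zero zero_less_one)
    also have "(\<Sum>i\<in>I. (b i / ?B) powr q) = (\<Sum>i\<in>I. b i powr q) / ?B powr q"
      using b pos by (simp add: powr_divide sum_divide_distrib)
    also have "\<dots> = 1" using lp_norm_powr[of q I b] q b pos by (metis divide_self less_trans order_less_irrefl powr_gt_zero zero_less_one)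
    finally have "(\<Sum>i\<in>I. a i / ?A * (b i / ?B)) \<le> 1" using q(2) by simp
    moreover have "(\<Sum>i\<in>I. a i / ?A * (b i / ?B)) = (\<Sum>i\<in>I. a i * b i) / (?A * ?B)"
      by (simp add: sum_divide_distrib)
    ultimately show ?thesis using pos by (simp add: q_def)
  qed
qed

lemma strong_norm_finite: "finite I \<Longrightarrow> strong_norm p I E x = lp_norm p I (\<lambda>i. vnorm E (x i))"
  by (simp add: strong_norm_def lp_norm_def)

lemma weak_norm_finite:
  "finite I \<Longrightarrow> weak_norm q I F \<phi> = (SUP y\<in>unit_ball F. lp_norm q I (\<lambda>i. norm (\<phi> i y)))"
  by (simp add: weak_norm_def lp_norm_def)

section \<open>Weak norms of finite families\<close>

lemma dual_apply:
  assumes "normed_space F" "\<phi> \<in> dual F"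
  shows "x \<in> carrier F \<Longrightarrow> y \<in> carrier F \<Longrightarrow> \<phi> (x \<oplus>\<^bsub>F\<^esub> y) = \<phi> x + \<phi> y"
    and "x \<in> carrier F \<Longrightarrow> \<phi> (c \<odot>\<^bsub>F\<^esub> x) = c * \<phi> x"
    and "\<phi> \<zero>\<^bsub>F\<^esub> = 0"
    and "x \<in> carrier F \<Longrightarrow> y \<in> carrier F \<Longrightarrow> \<phi> (x \<ominus>\<^bsub>F\<^esub> y) = \<phi> x - \<phi> y"
proof -
  note d = assms(2)[unfolded dual_iff[OF assms(1)]]
  show add: "\<phi> (x \<oplus>\<^bsub>F\<^esub> y) = \<phi> x + \<phi> y" if "x \<in> carrier F" "y \<in> carrier F" for x y using d that by blast
  show smult: "\<phi> (c \<odot>\<^bsub>F\<^esub> x) = c * \<phi> x" if "x \<in> carrier F" for c x using d that by blast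
  show "\<phi> \<zero>\<^bsub>F\<^esub> = 0" using smult[of "\<zero>\<^bsub>F\<^esub>" 0] assms(1) by simp
  show "\<phi> (x \<ominus>\<^bsub>F\<^esub> y) = \<phi> x - \<phi> y" if "x \<in> carrier F" "y \<in> carrier F"
    using that assms(1) by (simp add: ns_diff_eq add smult)
qed

lemma dual_bound:
  assumes "normed_space F" "\<phi> \<in> dual F"
  obtains B where "B \<ge> 0" "\<And>x. x \<in> carrier F \<Longrightarrow> norm (\<phi> x) \<le> B * vnorm F x"
  using assms(2)[unfolded dual_iff[OF assms(1)]] by blast

lemma dual_zero: "normed_space F \<Longrightarrow> (\<lambda>y\<in>carrier F. 0) \<in> dual F"
  by (auto simp: dual_iff ns_norm_ge0 intro!: exI[of _ 0])

lemma dual_smult: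
  assumes "normed_space F" "\<phi> \<in> dual F"
  shows "(\<lambda>y\<in>carrier F. c * \<phi> y) \<in> dual F"
proof -
  obtain B where B: "B \<ge> 0" "\<And>x. x \<in> carrier F \<Longrightarrow> norm (\<phi> x) \<le> B * vnorm F x"
    using dual_bound[OF assms] by blast
  have "norm (c * \<phi> y) \<le> (norm c * B) * vnorm F y" if "y \<in> carrier F" for y
    using mult_left_mono[OF B(2)[OF that], of "norm c"] by (simp add: norm_mult algebra_simps)
  then show ?thesis
    unfolding dual_iff[OF assms(1)] using B(1) assms
    by (intro conjI exI[of _ "norm c * B"]) (simp_all add: dual_apply algebra_simps)
qed

lemma weak_norm_bdd:
  assumes F: "normed_space F" and I: "finite I" and q: "q > 0" and \<phi>: "\<And>i. i \<in> I \<Longrightarrow> \<phi> i \<in> dual F"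
  shows "bdd_above ((\<lambda>y. lp_norm q I (\<lambda>i. norm (\<phi> i y))) ` unit_ball F)"
proof -
  have "\<forall>i\<in>I. \<exists>B\<ge>0. \<forall>x\<in>carrier F. norm (\<phi> i x) \<le> B * vnorm F x"
    using \<phi> dual_bound[OF F] by metis
  then obtain B where B: "\<And>i. i \<in> I \<Longrightarrow> B i \<ge> 0"
    "\<And>i x. i \<in> I \<Longrightarrow> x \<in> carrier F \<Longrightarrow> norm (\<phi> i x) \<le> B i * vnorm F x" by metis
  have "norm (\<phi> i y) \<le> B i" if "i \<in> I" "y \<in> unit_ball F" for i y
    using B(2)[of i y] mult_left_mono[OF _ B(1), of "vnorm F y" 1 i] that by (simp add: unit_ball_def)
  then have "lp_norm q I (\<lambda>i. norm (\<phi> i y)) \<le> lp_norm q I B" if "y \<in> unit_ball F" for y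
    using q that by (intro lp_norm_mono) auto
  then show ?thesis by (rule bdd_aboveI2)
qed

lemma weak_norm_finite_nonneg:
  assumes F: "normed_space F" and I: "finite I" and q: "q > 0" and \<phi>: "\<And>i. i \<in> I \<Longrightarrow> \<phi> i \<in> dual F"
  shows "0 \<le> weak_norm q I F \<phi>"
  unfolding weak_norm_finite[OF I]
  by (rule cSUP_upper2[OF weak_norm_bdd[OF assms] zero_in_unit_ball[OF F]]) (simp_all add: \<phi>)

lemma weak_norm_finite_bound:
  assumes F: "normed_space F" and I: "finite I" and q: "q > 0" and \<phi>: "\<And>i. i \<in> I \<Longrightarrow> \<phi> i \<in> dual F"
    and y: "y \<in> carrier F"
  shows "lp_norm q I (\<lambda>i. norm (\<phi> i y)) \<le> weak_norm q I F \<phi> * vnorm F y"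
proof (cases "y = \<zero>\<^bsub>F\<^esub>")
  case True
  have "lp_norm q I (\<lambda>i. norm (\<phi> i y)) = lp_norm q I (\<lambda>i. 0 * 0)"
    unfolding lp_norm_def True using dual_apply(3)[OF F \<phi>] by simp
  also have "\<dots> = 0" by (simp add: lp_norm_def)
  finally show ?thesis using F True by simp
next
  case False
  note n = normalize_in_unit_ball[OF F y False]
  let ?c = "inverse (vnorm F y)"
  have "?c * lp_norm q I (\<lambda>i. norm (\<phi> i y)) = lp_norm q I (\<lambda>i. ?c * norm (\<phi> i y))"
    using n(1) q by (simp add: lp_norm_scale)
  also have "\<dots> = lp_norm q I (\<lambda>i. norm (\<phi> i (of_real ?c \<odot>\<^bsub>F\<^esub> y)))"
    unfolding lp_norm_def using dual_apply(2)[OF F \<phi> y, of _ "of_real ?c"] n(1)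
    by (simp add: norm_mult norm_inverse del: of_real_inverse)
  also have "\<dots> \<le> weak_norm q I F \<phi>"
    unfolding weak_norm_finite[OF I] by (rule cSUP_upper[OF n(2) weak_norm_bdd[OF F I q \<phi>]])
  finally show ?thesis using n(1) by (simp add: field_simps)
qed

lemma weak_norm_finite_le:
  assumes F: "normed_space F" and I: "finite I"
    and "\<And>y. y \<in> unit_ball F \<Longrightarrow> lp_norm q I (\<lambda>i. norm (\<phi> i y)) \<le> c"
  shows "weak_norm q I F \<phi> \<le> c"
  unfolding weak_norm_finite[OF I] using assms(3) zero_in_unit_ball[OF F] by (intro cSUP_least) auto

section \<open>The least constant\<close>

abbreviation index_box :: "nat \<Rightarrow> ('n \<Rightarrow> nat) set" where
  "index_box m \<equiv> {j. \<forall>i. j i < m}"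

lemma index_box_PiE: "index_box m = PiE UNIV (\<lambda>_. {..<m})"
  by (auto simp: PiE_def)

lemma finite_index_box [simp]: "finite (index_box m :: ('n::finite \<Rightarrow> nat) set)"
  unfolding index_box_PiE by (rule finite_PiE) auto

text \<open>The constants of which \<^const>\<open>mCoh_norm\<close> is the least.\<close>

definition mCoh_bound ::
  "real \<Rightarrow> ('n::finite \<Rightarrow> ('k::real_normed_field, 'a) nspace) \<Rightarrow> ('k, 'b) nspace \<Rightarrow>
   (('n \<Rightarrow> 'a) \<Rightarrow> 'b) \<Rightarrow> real \<Rightarrow> bool" where
  "mCoh_bound p E F T C \<longleftrightarrow> 0 \<le> C \<and>
        (\<forall>(m::nat) x \<phi>.
           (\<forall>i. \<forall>j<m. x i j \<in> carrier (E i)) \<and> (\<forall>j\<in>index_box m. \<phi> j \<in> dual F) \<longrightarrow>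
           (\<Sum>j\<in>index_box m. norm (\<phi> j (T (\<lambda>i. x i (j i)))))
             \<le> C * (\<Prod>i\<in>UNIV. strong_norm p {..<m} (E i) (x i)) *
                weak_norm (conj_exponent p) (index_box m) F \<phi>)"

lemma mCoh_boundD:
  assumes "mCoh_bound p E F T C" "\<And>i j. j < m \<Longrightarrow> x i j \<in> carrier (E i)" "\<And>j. j \<in> index_box m \<Longrightarrow> \<phi> j \<in> dual F"
  shows "(\<Sum>j\<in>index_box m. norm (\<phi> j (T (\<lambda>i. x i (j i))))) \<le> C * (\<Prod>i\<in>UNIV. strong_norm p {..<m} (E i) (x i)) *
                weak_norm (conj_exponent p) (index_box m) F \<phi>"
  using assms unfolding mCoh_bound_def by blast

lemma mCoh_boundI:
  assumes "0 \<le> C"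
    "\<And>m x \<phi>. (\<And>i j. j < m \<Longrightarrow> x i j \<in> carrier (E i)) \<Longrightarrow> (\<And>j. j \<in> index_box m \<Longrightarrow> \<phi> j \<in> dual F) \<Longrightarrow>
      (\<Sum>j\<in>index_box m. norm (\<phi> j (T (\<lambda>i. x i (j i))))) \<le> C * (\<Prod>i\<in>UNIV. strong_norm p {..<m} (E i) (x i)) *
                weak_norm (conj_exponent p) (index_box m) F \<phi>"
  shows "mCoh_bound p E F T C"
  using assms unfolding mCoh_bound_def by blast

lemma prod_strong_norm_nonneg: "0 \<le> (\<Prod>i\<in>I. strong_norm p J (E i) (x i))"
  by (intro prod_nonneg) (simp add: strong_norm_def)

text \<open>The admissible constants form a closed set, because the factor next to \<open>C\<close> in the inequality is
  nonnegative. Their infimum is therefore admissible, and it is the least one.\<close>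

lemma mCoh_norm:
  fixes E :: "'n::finite \<Rightarrow> ('k::real_normed_field, 'a) nspace" and F :: "('k, 'b) nspace"
  assumes p: "1 < p" and F: "normed_space F" and T: "\<exists>C. mCoh_bound p E F T C"
  shows mCoh_bound_mCoh_norm: "mCoh_bound p E F T (mCoh_norm p E F T)"
    and mCoh_norm_le: "mCoh_bound p E F T C \<Longrightarrow> mCoh_norm p E F T \<le> C"
proof -
  let ?S = "{C. mCoh_bound p E F T C}"
  have ge: "0 \<le> C" if "C \<in> ?S" for C using that by (simp add: mCoh_bound_def)
  have le: "Inf ?S \<le> C" if "mCoh_bound p E F T C" for C
    using that ge by (intro cInf_lower bdd_belowI[where m = 0]) auto
  have "mCoh_bound p E F T (Inf ?S)"
  proof (rule mCoh_boundI)
    show "0 \<le> Inf ?S" using T ge by (intro cInf_greatest) auto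
    fix m x and \<phi> :: "('n \<Rightarrow> nat) \<Rightarrow> 'b \<Rightarrow> 'k"
    assume x: "\<And>i j. j < m \<Longrightarrow> x i j \<in> carrier (E i)" and \<phi>: "\<And>j. j \<in> index_box m \<Longrightarrow> \<phi> j \<in> dual F"
    let ?L = "\<Sum>j\<in>index_box m. norm (\<phi> j (T (\<lambda>i. x i (j i))))"
    define K where "K = (\<Prod>i\<in>UNIV. strong_norm p {..<m} (E i) (x i)) * weak_norm (conj_exponent p) (index_box m) F \<phi>"
    have L: "?L \<le> C * K" if "C \<in> ?S" for C
      using mCoh_boundD[OF _ x \<phi>, where p = p and T = T and C = C] that by (simp add: K_def mult.assoc)
    have "0 \<le> weak_norm (conj_exponent p) (index_box m) F \<phi>"
      using weak_norm_finite_nonneg[where I = "index_box m" and \<phi> = \<phi>, OF F finite_index_box _ \<phi>] conj_exponent(1)[OF p] by simp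
    then have "K \<ge> 0" unfolding K_def by (intro mult_nonneg_nonneg prod_strong_norm_nonneg)
    then consider "K = 0" | "K > 0" by linarith
    then have "?L \<le> Inf ?S * K"
    proof cases
      case 1
      then show ?thesis using L T by force
    next
      case 2
      have "?L / K \<le> Inf ?S"
        using T L 2 by (intro cInf_greatest) (auto simp: field_simps)
      then show ?thesis using 2 by (simp add: field_simps)
    qed
    then show "?L \<le> Inf ?S * (\<Prod>i\<in>UNIV. strong_norm p {..<m} (E i) (x i)) * weak_norm (conj_exponent p) (index_box m) F \<phi>"
      by (simp add: K_def mult.assoc)
  qed
  then have "mCoh_norm p E F T = Inf ?S"
    unfolding mCoh_norm_def mCoh_bound_def[symmetric] using le by (intro Least_equality) auto
  with le \<open>mCoh_bound p E F T (Inf ?S)\<close>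
  show "mCoh_bound p E F T (mCoh_norm p E F T)" "mCoh_bound p E F T C \<Longrightarrow> mCoh_norm p E F T \<le> C" by simp_all
qed

lemma mCoh_norm_nonneg:
  "1 < p \<Longrightarrow> normed_space F \<Longrightarrow> \<exists>C. mCoh_bound p E F T C \<Longrightarrow> 0 \<le> mCoh_norm p E F T"
  using mCoh_bound_mCoh_norm unfolding mCoh_bound_def by blast

section \<open>Summability and finite constants\<close>

lemma finite_subset_box:
  fixes J :: "('n::finite \<Rightarrow> nat) set"
  assumes "finite J" obtains m where "J \<subseteq> index_box m"
proof
  show "J \<subseteq> index_box (Suc (\<Sum>j\<in>J. \<Sum>i\<in>UNIV. j i))"
  proof safe
    fix j i assume "j \<in> J"
    have "j i \<le> (\<Sum>i\<in>UNIV. j i)" by (rule member_le_sum) auto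
    also have "\<dots> \<le> (\<Sum>j\<in>J. \<Sum>i\<in>UNIV. j i)" using \<open>j \<in> J\<close> assms by (intro member_le_sum) auto
    finally show "j i < Suc (\<Sum>j\<in>J. \<Sum>i\<in>UNIV. j i)" by simp
  qed
qed

lemma strong_norm_initial_le:
  assumes E: "normed_space E" and p: "p > 0" and x: "x \<in> ell_p p E"
  shows "strong_norm p {..<m} E x \<le> strong_norm p UNIV E x"
proof -
  have "(\<Sum>j<m. vnorm E (x j) powr p) \<le> (\<Sum>\<^sub>\<infinity>j. vnorm E (x j) powr p)"
    using x by (intro finite_sum_le_infsum) (auto simp: ell_p_def)
  then show ?thesis using p by (simp add: strong_norm_def powr_mono2 sum_nonneg)
qed

lemma weak_norm_subset_le:
  assumes F: "normed_space F" and q: "q > 0" and I: "finite I" and \<phi>: "\<phi> \<in> weak_ell q UNIV F"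
  shows "weak_norm q I F \<phi> \<le> weak_norm q UNIV F \<phi>"
proof (rule weak_norm_finite_le[OF F I])
  fix y assume y: "y \<in> unit_ball F"
  have "(\<Sum>i\<in>I. norm (\<phi> i y) powr q) \<le> (\<Sum>\<^sub>\<infinity>i. norm (\<phi> i y) powr q)"
    using \<phi> y I by (intro finite_sum_le_infsum) (auto simp: weak_ell_def)
  then have "lp_norm q I (\<lambda>i. norm (\<phi> i y)) \<le> (\<Sum>\<^sub>\<infinity>i. norm (\<phi> i y) powr q) powr (1 / q)"
    using q by (simp add: lp_norm_def powr_mono2 sum_nonneg)
  also have "\<dots> \<le> weak_norm q UNIV F \<phi>"
    unfolding weak_norm_def using \<phi> y by (intro cSUP_upper) (auto simp: weak_ell_def)
  finally show "lp_norm q I (\<lambda>i. norm (\<phi> i y)) \<le> weak_norm q UNIV F \<phi>" .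
qed

text \<open>A finite set of multi-indices lies in a box, so the inequality bounds all finite partial sums of
  the Cohen sum at once.\<close>

lemma mCoh_bound_imp_mCoh_ops:
  fixes E :: "'n::finite \<Rightarrow> ('k::real_normed_field, 'a) nspace" and F :: "('k, 'b) nspace"
  assumes p: "1 < p" and E: "\<And>i. normed_space (E i)" and F: "normed_space F"
    and T: "T \<in> multilinear_ops E F" and C: "mCoh_bound p E F T C"
  shows "T \<in> mCoh_ops p E F"
proof -
  note q = conj_exponent[OF p]
  have Tc: "T x \<in> carrier F" if "\<And>i. x i \<in> carrier (E i)" for x
    by (rule multilinear_map_closed[OF multilinear_ops_imp_map[OF T]]) (simp add: prod_carrier_iff that)
  have "(\<lambda>j. norm (\<phi> j (T (\<lambda>i. x i (j i))))) summable_on UNIV"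
    if x: "\<And>i. x i \<in> ell_p p (E i)" and \<phi>: "\<phi> \<in> weak_ell (conj_exponent p) UNIV F" for x \<phi>
  proof (rule nonneg_bdd_above_summable_on, simp, rule bdd_aboveI2)
    fix J :: "('n \<Rightarrow> nat) set" assume "J \<in> {J. J \<subseteq> UNIV \<and> finite J}"
    then obtain m where m: "J \<subseteq> index_box m" using finite_subset_box by blast
    have xc: "x i j \<in> carrier (E i)" for i j using x[of i] by (auto simp: ell_p_def)
    have \<phi>d: "\<phi> j \<in> dual F" for j using \<phi> by (auto simp: weak_ell_def)
    have "(\<Sum>j\<in>J. norm (\<phi> j (T (\<lambda>i. x i (j i))))) \<le> (\<Sum>j\<in>index_box m. norm (\<phi> j (T (\<lambda>i. x i (j i)))))"
      using m by (intro sum_mono2) auto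
    also have "\<dots> \<le> C * (\<Prod>i\<in>UNIV. strong_norm p {..<m} (E i) (x i)) * weak_norm (conj_exponent p) (index_box m) F \<phi>"
      by (rule mCoh_boundD[OF C xc \<phi>d])
    also have "\<dots> \<le> C * (\<Prod>i\<in>UNIV. strong_norm p UNIV (E i) (x i)) * weak_norm (conj_exponent p) UNIV F \<phi>"
    proof (intro mult_mono prod_mono conjI strong_norm_initial_le[OF E _ x] weak_norm_subset_le[OF F _ _ \<phi>])
      show "0 \<le> C" using C by (simp add: mCoh_bound_def)
      then show "0 \<le> C * (\<Prod>i\<in>UNIV. strong_norm p UNIV (E i) (x i))"
        by (intro mult_nonneg_nonneg prod_strong_norm_nonneg)
      show "0 \<le> weak_norm (conj_exponent p) (index_box m) F \<phi>"
        using weak_norm_finite_nonneg[where I = "index_box m" and \<phi> = \<phi>, OF F finite_index_box _ \<phi>d] q(1) by simp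
    qed (use p q in \<open>simp_all add: prod_strong_norm_nonneg, simp add: strong_norm_def\<close>)
    finally show "(\<Sum>j\<in>J. norm (\<phi> j (T (\<lambda>i. x i (j i))))) \<le>
      C * (\<Prod>i\<in>UNIV. strong_norm p UNIV (E i) (x i)) * weak_norm (conj_exponent p) UNIV F \<phi>" .
  qed
  moreover have "T (\<lambda>i. x i (j i)) \<in> carrier F" if "\<And>i. x i \<in> ell_p p (E i)" for x j
    using that by (intro Tc) (auto simp: ell_p_def)
  ultimately show ?thesis using T by (auto simp: mCoh_ops_def cohen_summable_def)
qed

text \<open>If the inequality fails for a constant \<open>D\<close>, dividing by the norms gives a violation by vectors and
  functionals in the unit balls. None of the norms is zero, because otherwise the left-hand side
  would vanish.\<close>

lemma mCoh_bound_violation: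
  fixes E :: "'n::finite \<Rightarrow> ('k::real_normed_field, 'a) nspace" and F :: "('k, 'b) nspace"
  assumes p: "1 < p" and E: "\<And>i. normed_space (E i)" and F: "normed_space F"
    and T: "multilinear_map E F T" and D: "0 \<le> D" "\<not> mCoh_bound p E F T D"
  obtains m x \<phi> where "\<And>i j. j < m \<Longrightarrow> x i j \<in> carrier (E i)" "\<And>j. j \<in> index_box m \<Longrightarrow> \<phi> j \<in> dual F"
    "\<And>i. strong_norm p {..<m} (E i) (x i) \<le> 1" "weak_norm (conj_exponent p) (index_box m) F \<phi> \<le> 1"
    "D \<le> (\<Sum>j\<in>index_box m. norm (\<phi> j (T (\<lambda>i. x i (j i)))))"
proof -
  define q where "q = conj_exponent p"
  have q: "q > 1" using conj_exponent[OF p] by (simp add: q_def)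
  obtain m x \<phi> where x: "\<And>i j. j < m \<Longrightarrow> x i j \<in> carrier (E i)" and \<phi>: "\<And>j. j \<in> index_box m \<Longrightarrow> \<phi> j \<in> dual F"
    and big: "D * (\<Prod>i\<in>UNIV. strong_norm p {..<m} (E i) (x i)) * weak_norm q (index_box m) F \<phi>
       < (\<Sum>j\<in>index_box m. norm (\<phi> j (T (\<lambda>i. x i (j i)))))"
    using D unfolding mCoh_bound_def q_def by (auto simp: not_le)
  define A where "A i = strong_norm p {..<m} (E i) (x i)" for i
  define W where "W = weak_norm q (index_box m) F \<phi>"
  let ?L = "\<Sum>j\<in>index_box m. norm (\<phi> j (T (\<lambda>i. x i (j i))))"
  have A0: "A i \<ge> 0" for i by (simp add: A_def strong_norm_def)
  have W0: "W \<ge> 0" using weak_norm_finite_nonneg[where I = "index_box m" and \<phi> = \<phi>, OF F finite_index_box _ \<phi>] q by (simp add: W_def)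
  have "0 \<le> D * (\<Prod>i\<in>UNIV. A i) * W" using A0 W0 D(1) by (simp add: prod_nonneg)
  then have L: "?L > 0" using big by (simp add: A_def W_def)
  have xc: "(\<lambda>i. x i (j i)) \<in> prod_carrier E" if "j \<in> index_box m" for j
    using that x by (simp add: prod_carrier_iff)
  have "A i \<noteq> 0" for i
  proof
    assume "A i = 0"
    have "x i l = \<zero>\<^bsub>E i\<^esub>" if "l < m" for l
    proof -
      have "vnorm (E i) (x i l) \<le> 0"
        using lp_norm_eq_0D[of "{..<m}" p "\<lambda>l. vnorm (E i) (x i l)" l] \<open>A i = 0\<close> p that
        by (simp add: A_def strong_norm_finite)
      then have "vnorm (E i) (x i l) = 0"
        using ns_norm_ge0[OF E x[OF that]] by (rule antisym)
      then show ?thesis by (rule iffD1[OF ns_norm_eq0[OF E x[OF that]]])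
    qed
    then have "T (\<lambda>i. x i (j i)) = \<zero>\<^bsub>F\<^esub>" if "j \<in> index_box m" for j
      using multilinear_map_zero[OF E F T xc[OF that], of i] that by simp
    then have "?L = 0" using dual_apply(3)[OF F \<phi>] by simp
    with L show False by simp
  qed
  then have A: "A i > 0" for i using A0[of i] by (simp add: less_le)
  have "W \<noteq> 0"
  proof
    assume "W = 0"
    have "\<phi> j (T (\<lambda>i. x i (j i))) = 0" if j: "j \<in> index_box m" for j
    proof -
      have "lp_norm q (index_box m) (\<lambda>l. norm (\<phi> l (T (\<lambda>i. x i (j i))))) \<le> 0"
        using weak_norm_finite_bound[where I = "index_box m" and \<phi> = \<phi>, OF F finite_index_box _ \<phi> multilinear_map_closed[OF T xc[OF j]], of q] q \<open>W = 0\<close>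
        by (simp add: W_def)
      then have "lp_norm q (index_box m) (\<lambda>l. norm (\<phi> l (T (\<lambda>i. x i (j i))))) = 0" by (intro antisym) auto
      then show ?thesis using lp_norm_eq_0D[where p = q and i = j, OF finite_index_box] q j by force
    qed
    then have "?L = 0" by simp
    with L show False by simp
  qed
  then have W: "W > 0" using W0 by simp
  define y where "y i l = of_real (inverse (A i)) \<odot>\<^bsub>E i\<^esub> x i l" for i l
  define \<psi> where "\<psi> j = (\<lambda>v\<in>carrier F. of_real (inverse W) * \<phi> j v)" for j
  have ne: "norm (of_real (inverse r) :: 'k) = inverse r" if "r > 0" for r
    using that by (simp del: of_real_inverse)
  show ?thesis
  proof (rule that[of m y \<psi>])
    show "y i j \<in> carrier (E i)" if "j < m" for i j using x[OF that] E[of i] by (simp add: y_def)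
    show "\<psi> j \<in> dual F" if "j \<in> index_box m" for j unfolding \<psi>_def by (rule dual_smult[OF F \<phi>[OF that]])
    show "strong_norm p {..<m} (E i) (y i) \<le> 1" for i
    proof -
      have "strong_norm p {..<m} (E i) (y i) = lp_norm p {..<m} (\<lambda>l. inverse (A i) * vnorm (E i) (x i l))"
        unfolding strong_norm_finite[OF finite_lessThan] lp_norm_def y_def
        using ns_norm_smult[OF E x] ne[OF A] by simp
      also have "\<dots> = inverse (A i) * A i"
        using x A[of i] E p by (subst lp_norm_scale) (auto simp: A_def strong_norm_finite ns_norm_ge0)
      finally show ?thesis using A[of i] by simp
    qed
    show "weak_norm (conj_exponent p) (index_box m) F \<psi> \<le> 1"
      unfolding q_def[symmetric]
    proof (rule weak_norm_finite_le[OF F finite_index_box])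
      fix v assume v: "v \<in> unit_ball F"
      have "lp_norm q (index_box m) (\<lambda>j. norm (\<psi> j v)) = lp_norm q (index_box m) (\<lambda>j. inverse W * norm (\<phi> j v))"
        unfolding \<psi>_def using v ne[OF W] by (simp add: unit_ball_def norm_mult)
      also have "\<dots> = inverse W * lp_norm q (index_box m) (\<lambda>j. norm (\<phi> j v))"
        using W q by (intro lp_norm_scale) auto
      also have "\<dots> \<le> inverse W * (W * vnorm F v)"
        using v W q weak_norm_finite_bound[where I = "index_box m" and \<phi> = \<phi>, OF F finite_index_box _ \<phi>, of q v]
        by (intro mult_left_mono) (auto simp: W_def unit_ball_def)
      also have "\<dots> = vnorm F v" using W by (simp flip: mult.assoc)
      also have "\<dots> \<le> 1" using v by (simp add: unit_ball_def)
      finally show "lp_norm q (index_box m) (\<lambda>j. norm (\<psi> j v)) \<le> 1" .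
    qed
    have "norm (\<psi> j (T (\<lambda>i. y i (j i)))) = inverse W * (\<Prod>i\<in>UNIV. inverse (A i)) * norm (\<phi> j (T (\<lambda>i. x i (j i))))"
      if j: "j \<in> index_box m" for j
    proof -
      have "T (\<lambda>i. y i (j i)) = (\<Prod>i\<in>UNIV. of_real (inverse (A i))) \<odot>\<^bsub>F\<^esub> T (\<lambda>i. x i (j i))"
        unfolding y_def by (rule multilinear_map_scale[OF E F T xc[OF j]])
      moreover have "norm (\<Prod>i\<in>UNIV. of_real (inverse (A i)) :: 'k) = (\<Prod>i\<in>UNIV. inverse (A i))"
        unfolding prod_norm[symmetric] ne[OF A] ..
      ultimately show ?thesis
        using multilinear_map_closed[OF T xc[OF j]] F dual_apply(2)[OF F \<phi>[OF j]] ne[OF W]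
        by (simp add: \<psi>_def norm_mult del: of_real_inverse)
    qed
    then have "(\<Sum>j\<in>index_box m. norm (\<psi> j (T (\<lambda>i. y i (j i))))) = inverse W * (\<Prod>i\<in>UNIV. inverse (A i)) * ?L"
      by (simp add: sum_distrib_left)
    also have "\<dots> = ?L / ((\<Prod>i\<in>UNIV. A i) * W)" 
      using prod_inversef[of A UNIV] by (simp add: o_def divide_inverse mult_ac)
    also have "\<dots> \<ge> D"
      using big A W by (simp add: pos_le_divide_eq prod_pos A_def[symmetric] W_def[symmetric] mult.assoc)
    finally show "D \<le> (\<Sum>j\<in>index_box m. norm (\<psi> j (T (\<lambda>i. y i (j i)))))" .
  qed
qed

text \<open>Comparison with the geometric series: a finite sum of nonzero terms meets finitely many blocks.\<close>

lemma block_summable: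
  fixes f :: "'i \<Rightarrow> real"
  assumes f: "\<And>i. 0 \<le> f i" and B: "\<And>k. finite (B k)" "\<And>i. f i \<noteq> 0 \<Longrightarrow> \<exists>k::nat. i \<in> B k"
    and s: "\<And>k. sum f (B k) \<le> (1/2) ^ k"
  shows "f summable_on UNIV" and "(\<Sum>\<^sub>\<infinity>i. f i) \<le> 2"
proof -
  have union: "sum f (\<Union>k\<in>K. B k) \<le> (\<Sum>k\<in>K. sum f (B k))" if "finite K" for K
    using that
  proof induction
    case (insert k K)
    have "sum f (B k \<union> (\<Union>k\<in>K. B k)) \<le> sum f (B k) + sum f (\<Union>k\<in>K. B k)"
      using f B(1) insert.hyps by (simp add: sum_Un sum_nonneg)
    then show ?case using insert by simp
  qed simp
  have fin: "sum f J \<le> 2" if J: "finite J" for J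
  proof -
    have "\<forall>i. \<exists>k. f i \<noteq> 0 \<longrightarrow> i \<in> B k" using B(2) by blast
    then obtain \<kappa> where \<kappa>: "\<And>i. f i \<noteq> 0 \<Longrightarrow> i \<in> B (\<kappa> i)" by metis
    have "sum f J = sum f {i\<in>J. f i \<noteq> 0}" using J by (intro sum.mono_neutral_right) auto
    also have "\<dots> \<le> sum f (\<Union>k\<in>\<kappa> ` J. B k)"
      using J f B(1) \<kappa> by (intro sum_mono2) auto
    also have "\<dots> \<le> (\<Sum>k\<in>\<kappa> ` J. sum f (B k))" using J by (intro union) auto
    also have "\<dots> \<le> (\<Sum>k\<in>\<kappa> ` J. (1/2) ^ k)" by (rule sum_mono[OF s])
    also have "\<dots> \<le> (\<Sum>k. (1/2::real) ^ k)"
      using J by (intro sum_le_suminf) (auto simp: summable_geometric)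
    also have "\<dots> = 2" by (simp add: suminf_geometric)
    finally show ?thesis .
  qed
  show sum: "f summable_on UNIV"
    using fin f by (intro nonneg_bdd_above_summable_on bdd_aboveI2[where M = 2]) auto
  show "(\<Sum>\<^sub>\<infinity>i. f i) \<le> 2"
    using fin by (intro infsum_le_finite_sums[OF sum]) auto
qed

lemma half_power_powr_le: "1 \<le> q \<Longrightarrow> ((1/2::real) ^ k) powr q \<le> (1/2) ^ k"
  using powr_mono'[of 1 q "(1/2::real) ^ k"] by (simp add: power_le_one)

text \<open>A gliding hump. If no constant works, the inequality is violated with faster and faster growing
  constants by families of norm at most \<open>1\<close>. Scale the \<open>k\<close>-th violation by \<open>(1/2) ^ k\<close> and place it in the
  \<open>k\<close>-th of infinitely many disjoint blocks of \<open>\<nat>\<close>, the rows of \<open>prod_encode\<close>, with zero functionals off the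
  diagonal blocks of \<open>\<nat>\<^sup>n\<close>. The resulting sequences are strongly, and the functionals weakly, summable,
  but the \<open>k\<close>-th block contributes at least \<open>k\<close> to the Cohen sum.\<close>

lemma mCoh_ops_imp_mCoh_bound:
  fixes E :: "'n::finite \<Rightarrow> ('k::real_normed_field, 'a) nspace" and F :: "('k, 'b) nspace"
  assumes p: "1 < p" and E: "\<And>i. normed_space (E i)" and F: "normed_space F"
    and T: "T \<in> mCoh_ops p E F"
  shows "\<exists>C. mCoh_bound p E F T C"
proof (rule ccontr)
  assume none: "\<nexists>C. mCoh_bound p E F T C"
  have Tm: "multilinear_map E F T" using T by (simp add: mCoh_ops_def multilinear_ops_imp_map)
  define q where "q = conj_exponent p"
  have q: "q > 1" using conj_exponent[OF p] by (simp add: q_def)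
  define c where "c k = (of_real ((1/2) ^ k) :: 'k)" for k
  have nc: "norm (c k) = (1/2) ^ k" for k unfolding c_def norm_of_real by simp
  \<comment> \<open>The factor \<open>2 ^ (k * (n + 1))\<close> undoes the scaling of the \<open>n\<close> vectors and of the functional.\<close>
  define D where "D k = real k * 2 ^ (k * (CARD('n) + 1))" for k
  define violates where "violates k m x \<phi> \<longleftrightarrow>
     (\<forall>i. \<forall>j<m. x i j \<in> carrier (E i)) \<and> (\<forall>j\<in>index_box m. \<phi> j \<in> dual F) \<and>
     (\<forall>i. strong_norm p {..<m} (E i) (x i) \<le> 1) \<and> weak_norm q (index_box m) F \<phi> \<le> 1 \<and>
     D k \<le> (\<Sum>j\<in>index_box m. norm (\<phi> j (T (\<lambda>i. x i (j i)))))" for k m x \<phi>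
  have "\<exists>m x \<phi>. violates k m x \<phi>" for k
    by (rule mCoh_bound_violation[OF p E F Tm, of "D k"])
      (use none in \<open>auto simp: D_def q_def violates_def\<close>)
  then obtain m x \<phi> where v: "\<And>k. violates k (m k) (x k) (\<phi> k)" by metis
  have x: "x k i j \<in> carrier (E i)" if "j < m k" for k i j
    using v[of k] that by (simp add: violates_def)
  have \<phi>: "\<phi> k j \<in> dual F" if "j \<in> index_box (m k)" for k j
    using v[of k] that by (simp add: violates_def)
  have x1: "strong_norm p {..<m k} (E i) (x k i) \<le> 1"
    and \<phi>1: "weak_norm q (index_box (m k)) F (\<phi> k) \<le> 1"
    and big: "D k \<le> (\<Sum>j\<in>index_box (m k). norm (\<phi> k j (T (\<lambda>i. x k i (j i)))))" for k i
    using v[of k] by (simp_all add: violates_def)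
  define X where "X i r = (case prod_decode r of (k, l) \<Rightarrow>
      if l < m k then c k \<odot>\<^bsub>E i\<^esub> x k i l else \<zero>\<^bsub>E i\<^esub>)" for i r
  have X_enc: "X i (prod_encode (k, l)) = (if l < m k then c k \<odot>\<^bsub>E i\<^esub> x k i l else \<zero>\<^bsub>E i\<^esub>)" for i k l
    by (simp add: X_def)
  have Xc: "X i r \<in> carrier (E i)" for i r
    using x E by (auto simp: X_def split: prod.split)
  have X: "X i \<in> ell_p p (E i)" for i
  proof -
    let ?B = "\<lambda>k. (\<lambda>l. prod_encode (k, l)) ` {..<m k}"
    have "(\<lambda>r. vnorm (E i) (X i r) powr p) summable_on UNIV"
    proof (rule block_summable(1)[where B = ?B])
      fix r assume r: "vnorm (E i) (X i r) powr p \<noteq> 0"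
      obtain k l where kl: "r = prod_encode (k, l)" by (metis prod_decode_inverse surj_pair)
      have "l < m k" using r E[of i] by (auto simp: kl X_enc split: if_splits)
      then show "\<exists>k. r \<in> ?B k" by (auto simp: kl)
    next
      fix k
      have a: "vnorm (E i) (x k i l) \<ge> 0" if "l < m k" for l using ns_norm_ge0[OF E x[OF that]] .
      have "(\<Sum>r\<in>?B k. vnorm (E i) (X i r) powr p) = (\<Sum>l<m k. ((1/2) ^ k * vnorm (E i) (x k i l)) powr p)"
        by (subst sum.reindex) (auto simp: inj_on_def X_enc ns_norm_smult[OF E x] nc)
      also have "\<dots> = ((1/2) ^ k) powr p * lp_norm p {..<m k} (\<lambda>l. vnorm (E i) (x k i l)) powr p"
        using a p lp_norm_powr[of p "{..<m k}" "\<lambda>l. vnorm (E i) (x k i l)"]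
        by (simp add: powr_mult sum_distrib_left)
      also have "\<dots> \<le> (1/2) ^ k * 1"
      proof (rule mult_mono)
        show "((1/2::real) ^ k) powr p \<le> (1/2) ^ k" using p by (intro half_power_powr_le) simp
        show "lp_norm p {..<m k} (\<lambda>l. vnorm (E i) (x k i l)) powr p \<le> 1"
          using x1[of k i] p powr_mono2[of p _ 1] by (simp add: strong_norm_finite)
      qed auto
      finally show "(\<Sum>r\<in>?B k. vnorm (E i) (X i r) powr p) \<le> (1/2) ^ k" by simp
    qed auto
    then show ?thesis using Xc by (auto simp: ell_p_def)
  qed
  \<comment> \<open>The diagonal blocks of multi-indices. Off them the functional is zero.\<close>
  define enc where "enc k l = (\<lambda>i::'n. prod_encode (k, l i))" for k l
  define diag where "diag k = enc k ` index_box (m k)" for k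
  have inj: "inj_on (enc k) A" for k A by (auto simp: inj_on_def enc_def fun_eq_iff)
  have enc_eq: "k = k'" "l = l'" if "enc k l = enc k' l'" for k k' l l'
    using that by (auto simp: enc_def fun_eq_iff)
  define \<Phi> where "\<Phi> j = (if \<exists>k. j \<in> diag k
      then (let (k, l) = (SOME (k, l). j = enc k l \<and> l \<in> index_box (m k)) in (\<lambda>v\<in>carrier F. c k * \<phi> k l v))
      else (\<lambda>v\<in>carrier F. 0))" for j
  have \<Phi>_enc: "\<Phi> (enc k l) = (\<lambda>v\<in>carrier F. c k * \<phi> k l v)" if "l \<in> index_box (m k)" for k l
  proof -
    have "(SOME (k', l'). enc k l = enc k' l' \<and> l' \<in> index_box (m k')) = (k, l)"
    proof (rule some_equality)
      show "case (k, l) of (k', l') \<Rightarrow> enc k l = enc k' l' \<and> l' \<in> index_box (m k')" using that by simp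
      fix z assume z: "case z of (k', l') \<Rightarrow> enc k l = enc k' l' \<and> l' \<in> index_box (m k')"
      obtain k' l' where z': "z = (k', l')" by (cases z)
      then have "enc k l = enc k' l'" using z by simp
      from enc_eq[OF this] show "z = (k, l)" by (simp add: z')
    qed
    moreover have "enc k l \<in> diag k" using that by (auto simp: diag_def)
    ultimately show ?thesis unfolding \<Phi>_def by auto
  qed
  have \<Phi>_off: "\<Phi> j = (\<lambda>v\<in>carrier F. 0)" if "\<And>k. j \<notin> diag k" for j
    using that by (simp add: \<Phi>_def)
  have \<Phi>d: "\<Phi> j \<in> dual F" for j
  proof (cases "\<exists>k. j \<in> diag k")
    case True
    then obtain k l where l: "l \<in> index_box (m k)" "j = enc k l" by (auto simp: diag_def)
    show ?thesis unfolding l(2) \<Phi>_enc[OF l(1)] by (rule dual_smult[OF F \<phi>[OF l(1)]])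
  qed (simp add: \<Phi>_off dual_zero F)
  have sum_\<Phi>: "(\<lambda>j. norm (\<Phi> j v) powr q) summable_on UNIV" "(\<Sum>\<^sub>\<infinity>j. norm (\<Phi> j v) powr q) \<le> 2"
    if v: "v \<in> unit_ball F" for v
  proof -
    have vc: "v \<in> carrier F" using v by (simp add: unit_ball_def)
    have off: "\<exists>k. j \<in> diag k" if "norm (\<Phi> j v) powr q \<noteq> 0" for j
    proof (rule ccontr)
      assume "\<nexists>k. j \<in> diag k"
      then have "\<Phi> j v = 0" using \<Phi>_off[of j] vc by simp
      with that show False by simp
    qed
    have le: "(\<Sum>j\<in>diag k. norm (\<Phi> j v) powr q) \<le> (1/2) ^ k" for k
    proof -
      have "(\<Sum>j\<in>diag k. norm (\<Phi> j v) powr q) = (\<Sum>l\<in>index_box (m k). ((1/2) ^ k * norm (\<phi> k l v)) powr q)"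
        unfolding diag_def by (subst sum.reindex[OF inj]) (simp add: \<Phi>_enc vc norm_mult nc)
      also have "\<dots> = ((1/2) ^ k) powr q * lp_norm q (index_box (m k)) (\<lambda>l. norm (\<phi> k l v)) powr q"
        using q by (simp add: lp_norm_powr powr_mult sum_distrib_left)
      also have "\<dots> \<le> (1/2) ^ k * 1"
      proof (rule mult_mono)
        show "((1/2::real) ^ k) powr q \<le> (1/2) ^ k" using q by (intro half_power_powr_le) simp
        have "lp_norm q (index_box (m k)) (\<lambda>l. norm (\<phi> k l v)) \<le> weak_norm q (index_box (m k)) F (\<phi> k) * vnorm F v"
          using q by (intro weak_norm_finite_bound[OF F finite_index_box _ \<phi> vc]) auto
        also have "\<dots> \<le> 1 * 1"
          using \<phi>1[of k] v ns_norm_ge0[OF F vc] by (intro mult_mono) (auto simp: unit_ball_def)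
        finally show "lp_norm q (index_box (m k)) (\<lambda>l. norm (\<phi> k l v)) powr q \<le> 1"
          using q powr_mono2[of q _ 1] by simp
      qed auto
      finally show ?thesis by simp
    qed
    show "(\<lambda>j. norm (\<Phi> j v) powr q) summable_on UNIV"
      by (rule block_summable(1)[where B = diag]) (use off le in \<open>auto simp: diag_def\<close>)
    show "(\<Sum>\<^sub>\<infinity>j. norm (\<Phi> j v) powr q) \<le> 2"
      by (rule block_summable(2)[where B = diag]) (use off le in \<open>auto simp: diag_def\<close>)
  qed
  have "(\<Sum>\<^sub>\<infinity>j. norm (\<Phi> j v) powr q) powr (1 / q) \<le> 2 powr (1 / q)" if "v \<in> unit_ball F" for v
    using sum_\<Phi>(2)[OF that] q by (intro powr_mono2 infsum_nonneg) auto
  then have "\<Phi> \<in> weak_ell q UNIV F"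
    using \<Phi>d sum_\<Phi>(1) by (auto simp: weak_ell_def intro!: bdd_aboveI2)
  then have S: "(\<lambda>j. norm (\<Phi> j (T (\<lambda>i. X i (j i))))) summable_on UNIV"
    using T X by (auto simp: mCoh_ops_def cohen_summable_def q_def)
  have "real k \<le> (\<Sum>\<^sub>\<infinity>j. norm (\<Phi> j (T (\<lambda>i. X i (j i)))))" for k
  proof -
    have summand: "norm (\<Phi> (enc k l) (T (\<lambda>i. X i (enc k l i))))
        = (1/2) ^ (k * (CARD('n) + 1)) * norm (\<phi> k l (T (\<lambda>i. x k i (l i))))"
      if l: "l \<in> index_box (m k)" for l
    proof -
      have xl: "(\<lambda>i. x k i (l i)) \<in> prod_carrier E" using l x by (simp add: prod_carrier_iff)
      have "T (\<lambda>i. X i (enc k l i)) = T (\<lambda>i. c k \<odot>\<^bsub>E i\<^esub> x k i (l i))"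
        using l by (simp add: enc_def X_enc)
      also have "\<dots> = c k ^ CARD('n) \<odot>\<^bsub>F\<^esub> T (\<lambda>i. x k i (l i))"
        using multilinear_map_scale[OF E F Tm xl, of "\<lambda>_. c k"] by simp
      finally have "T (\<lambda>i. X i (enc k l i)) = c k ^ CARD('n) \<odot>\<^bsub>F\<^esub> T (\<lambda>i. x k i (l i))" .
      then show ?thesis
        using multilinear_map_closed[OF Tm xl] F dual_apply(2)[OF F \<phi>[OF l]]
        by (simp add: \<Phi>_enc[OF l] norm_mult norm_power nc power_add power_mult mult.commute)
    qed
    have "real k = (1/2) ^ (k * (CARD('n) + 1)) * D k"
      by (simp add: D_def power_divide)
    also have "\<dots> \<le> (1/2) ^ (k * (CARD('n) + 1)) * (\<Sum>l\<in>index_box (m k). norm (\<phi> k l (T (\<lambda>i. x k i (l i)))))"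
      by (intro mult_left_mono big) simp
    also have "\<dots> = (\<Sum>j\<in>diag k. norm (\<Phi> j (T (\<lambda>i. X i (j i)))))"
      unfolding diag_def by (subst sum.reindex[OF inj]) (simp add: summand sum_distrib_left)
    also have "\<dots> \<le> (\<Sum>\<^sub>\<infinity>j. norm (\<Phi> j (T (\<lambda>i. X i (j i)))))"
      by (intro finite_sum_le_infsum[OF S]) (auto simp: diag_def)
    finally show ?thesis .
  qed
  then show False using reals_Archimedean2 not_le by blast
qed

section \<open>Vector spaces of operators\<close>

lemma multilinear_module_simps [simp]:
  "carrier (multilinear_module E F) = multilinear_ops E F"
  "zero (multilinear_module E F) = (\<lambda>x\<in>prod_carrier E. \<zero>\<^bsub>F\<^esub>)"
  "add (multilinear_module E F) = (\<lambda>S T. \<lambda>x\<in>prod_carrier E. S x \<oplus>\<^bsub>F\<^esub> T x)"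
  "smult (multilinear_module E F) = (\<lambda>c T. \<lambda>x\<in>prod_carrier E. c \<odot>\<^bsub>F\<^esub> T x)"
  by (simp_all add: multilinear_module_def)

lemma component_space_simps [simp]:
  "carrier (component_space M \<nu> E F) = component M E F"
  "zero (component_space M \<nu> E F) = (\<lambda>x\<in>prod_carrier E. \<zero>\<^bsub>F\<^esub>)"
  "add (component_space M \<nu> E F) = (\<lambda>S T. \<lambda>x\<in>prod_carrier E. S x \<oplus>\<^bsub>F\<^esub> T x)"
  "smult (component_space M \<nu> E F) = (\<lambda>c T. \<lambda>x\<in>prod_carrier E. c \<odot>\<^bsub>F\<^esub> T x)"
  "vnorm (component_space M \<nu> E F) T = \<nu> (E, F, T)"
  by (simp_all add: component_space_def)

lemma fun_upd_prod_carrier: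
  "x \<in> prod_carrier E \<Longrightarrow> y \<in> carrier (E i) \<Longrightarrow> x(i := y) \<in> prod_carrier E"
  by (simp add: prod_carrier_iff)

lemma multilinear_mapD:
  assumes "multilinear_map E F T" "x \<in> prod_carrier E" "y \<in> carrier (E i)"
  shows "z \<in> carrier (E i) \<Longrightarrow> T (x(i := y \<oplus>\<^bsub>E i\<^esub> z)) = T (x(i := y)) \<oplus>\<^bsub>F\<^esub> T (x(i := z))"
    and "T (x(i := c \<odot>\<^bsub>E i\<^esub> y)) = c \<odot>\<^bsub>F\<^esub> T (x(i := y))"
  using assms unfolding multilinear_map_def by blast+

lemma multilinear_mapI:
  assumes "\<And>x. x \<in> prod_carrier E \<Longrightarrow> T x \<in> carrier F" "T \<in> extensional (prod_carrier E)"
    "\<And>x i y z. x \<in> prod_carrier E \<Longrightarrow> y \<in> carrier (E i) \<Longrightarrow> z \<in> carrier (E i) \<Longrightarrow>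
        T (x(i := y \<oplus>\<^bsub>E i\<^esub> z)) = T (x(i := y)) \<oplus>\<^bsub>F\<^esub> T (x(i := z))"
    "\<And>x i c y. x \<in> prod_carrier E \<Longrightarrow> y \<in> carrier (E i) \<Longrightarrow>
        T (x(i := c \<odot>\<^bsub>E i\<^esub> y)) = c \<odot>\<^bsub>F\<^esub> T (x(i := y))"
  shows "multilinear_map E F T"
  using assms unfolding multilinear_map_def by (auto simp: PiE_def)

lemma multilinear_map_add:
  assumes E: "\<And>i. normed_space (E i)" and F: "normed_space F"
    and S: "multilinear_map E F S" and T: "multilinear_map E F T"
  shows "multilinear_map E F (\<lambda>x\<in>prod_carrier E. S x \<oplus>\<^bsub>F\<^esub> T x)"
proof (rule multilinear_mapI)
  fix x i y z assume xyz: "x \<in> prod_carrier E" "y \<in> carrier (E i)" "z \<in> carrier (E i)"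
  note c = fun_upd_prod_carrier[OF xyz(1)]
  note m = c[OF xyz(2)] c[OF xyz(3)] c[OF ns_closed(2)[OF E xyz(2,3)]]
  show "(\<lambda>x\<in>prod_carrier E. S x \<oplus>\<^bsub>F\<^esub> T x) (x(i := y \<oplus>\<^bsub>E i\<^esub> z)) =
    (\<lambda>x\<in>prod_carrier E. S x \<oplus>\<^bsub>F\<^esub> T x) (x(i := y)) \<oplus>\<^bsub>F\<^esub> (\<lambda>x\<in>prod_carrier E. S x \<oplus>\<^bsub>F\<^esub> T x) (x(i := z))"
    using m multilinear_mapD(1)[OF S xyz] multilinear_mapD(1)[OF T xyz] F
      multilinear_map_closed[OF S m(1)] multilinear_map_closed[OF S m(2)]
      multilinear_map_closed[OF T m(1)] multilinear_map_closed[OF T m(2)]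
    by (simp del: fun_upd_apply add: ns_add)
next
  fix x i c y assume xy: "x \<in> prod_carrier E" "y \<in> carrier (E i)"
  note m = fun_upd_prod_carrier[OF xy] fun_upd_prod_carrier[OF xy(1) ns_closed(3)[OF E xy(2), of c]]
  show "(\<lambda>x\<in>prod_carrier E. S x \<oplus>\<^bsub>F\<^esub> T x) (x(i := c \<odot>\<^bsub>E i\<^esub> y)) =
    c \<odot>\<^bsub>F\<^esub> (\<lambda>x\<in>prod_carrier E. S x \<oplus>\<^bsub>F\<^esub> T x) (x(i := y))"
    using m multilinear_mapD(2)[OF S xy] multilinear_mapD(2)[OF T xy] F
      multilinear_map_closed[OF S m(1)] multilinear_map_closed[OF T m(1)]
    by (simp del: fun_upd_apply add: ns_distrib(2))
qed (use F in \<open>simp_all add: multilinear_map_closed[OF S] multilinear_map_closed[OF T]\<close>)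

lemma multilinear_map_smult:
  assumes E: "\<And>i. normed_space (E i)" and F: "normed_space F" and T: "multilinear_map E F T"
  shows "multilinear_map E F (\<lambda>x\<in>prod_carrier E. c \<odot>\<^bsub>F\<^esub> T x)"
proof (rule multilinear_mapI)
  fix x i y z assume xyz: "x \<in> prod_carrier E" "y \<in> carrier (E i)" "z \<in> carrier (E i)"
  note d = fun_upd_prod_carrier[OF xyz(1)]
  note m = d[OF xyz(2)] d[OF xyz(3)] d[OF ns_closed(2)[OF E xyz(2,3)]]
  show "(\<lambda>x\<in>prod_carrier E. c \<odot>\<^bsub>F\<^esub> T x) (x(i := y \<oplus>\<^bsub>E i\<^esub> z)) =
    (\<lambda>x\<in>prod_carrier E. c \<odot>\<^bsub>F\<^esub> T x) (x(i := y)) \<oplus>\<^bsub>F\<^esub> (\<lambda>x\<in>prod_carrier E. c \<odot>\<^bsub>F\<^esub> T x) (x(i := z))"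
    using m multilinear_mapD(1)[OF T xyz] F
      multilinear_map_closed[OF T m(1)] multilinear_map_closed[OF T m(2)]
    by (simp del: fun_upd_apply add: ns_distrib(2))
next
  fix x i a y assume xy: "x \<in> prod_carrier E" "y \<in> carrier (E i)"
  note m = fun_upd_prod_carrier[OF xy] fun_upd_prod_carrier[OF xy(1) ns_closed(3)[OF E xy(2), of a]]
  show "(\<lambda>x\<in>prod_carrier E. c \<odot>\<^bsub>F\<^esub> T x) (x(i := a \<odot>\<^bsub>E i\<^esub> y)) =
    a \<odot>\<^bsub>F\<^esub> (\<lambda>x\<in>prod_carrier E. c \<odot>\<^bsub>F\<^esub> T x) (x(i := y))"
    using m multilinear_mapD(2)[OF T xy] F multilinear_map_closed[OF T m(1)]
    by (simp del: fun_upd_apply add: mult.commute)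
qed (use F in \<open>simp_all add: multilinear_map_closed[OF T]\<close>)

lemma multilinear_map_zero_fun:
  assumes "\<And>i. normed_space (E i)" "normed_space F"
  shows "multilinear_map E F (\<lambda>x\<in>prod_carrier E. \<zero>\<^bsub>F\<^esub>)"
  by (rule multilinear_mapI) (use assms in \<open>simp_all add: fun_upd_prod_carrier del: fun_upd_apply\<close>)

lemma multilinear_ops_closed:
  assumes E: "\<And>i. normed_space (E i)" and F: "normed_space F"
  shows "(\<lambda>x\<in>prod_carrier E. \<zero>\<^bsub>F\<^esub>) \<in> multilinear_ops E F"
    and "S \<in> multilinear_ops E F \<Longrightarrow> T \<in> multilinear_ops E F \<Longrightarrow>
      (\<lambda>x\<in>prod_carrier E. S x \<oplus>\<^bsub>F\<^esub> T x) \<in> multilinear_ops E F"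
    and "T \<in> multilinear_ops E F \<Longrightarrow> (\<lambda>x\<in>prod_carrier E. c \<odot>\<^bsub>F\<^esub> T x) \<in> multilinear_ops E F"
proof -
  note iff = multilinear_ops_iff[where E = E and F = F, OF E F]
  show "(\<lambda>x\<in>prod_carrier E. \<zero>\<^bsub>F\<^esub>) \<in> multilinear_ops E F"
    unfolding iff using multilinear_map_zero_fun[of E F] E F by (auto intro!: exI[of _ 0])
  show "(\<lambda>x\<in>prod_carrier E. S x \<oplus>\<^bsub>F\<^esub> T x) \<in> multilinear_ops E F"
    if ST: "S \<in> multilinear_ops E F" "T \<in> multilinear_ops E F"
  proof -
    obtain A where A: "A \<ge> 0" "\<And>x. x \<in> prod_carrier E \<Longrightarrow> vnorm F (S x) \<le> A * (\<Prod>i\<in>UNIV. vnorm (E i) (x i))"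
      using ST(1) unfolding iff by blast
    obtain B where B: "B \<ge> 0" "\<And>x. x \<in> prod_carrier E \<Longrightarrow> vnorm F (T x) \<le> B * (\<Prod>i\<in>UNIV. vnorm (E i) (x i))"
      using ST(2) unfolding iff by blast
    have "vnorm F (S x \<oplus>\<^bsub>F\<^esub> T x) \<le> (A + B) * (\<Prod>i\<in>UNIV. vnorm (E i) (x i))" if x: "x \<in> prod_carrier E" for x
      using ns_norm_triangle[OF F multilinear_map_closed[OF multilinear_ops_imp_map[OF ST(1)] x]
          multilinear_map_closed[OF multilinear_ops_imp_map[OF ST(2)] x]] A(2)[OF x] B(2)[OF x]
      by (simp add: distrib_right)
    then show ?thesis
      unfolding iff using multilinear_map_add[OF E F ST[THEN multilinear_ops_imp_map]] A(1) B(1)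
      by (auto intro!: exI[of _ "A + B"])
  qed
  show "(\<lambda>x\<in>prod_carrier E. c \<odot>\<^bsub>F\<^esub> T x) \<in> multilinear_ops E F" if T: "T \<in> multilinear_ops E F"
  proof -
    obtain B where B: "B \<ge> 0" "\<And>x. x \<in> prod_carrier E \<Longrightarrow> vnorm F (T x) \<le> B * (\<Prod>i\<in>UNIV. vnorm (E i) (x i))"
      using T unfolding iff by blast
    have "vnorm F (c \<odot>\<^bsub>F\<^esub> T x) \<le> (norm c * B) * (\<Prod>i\<in>UNIV. vnorm (E i) (x i))" if x: "x \<in> prod_carrier E" for x
      using ns_norm_smult[OF F multilinear_map_closed[OF multilinear_ops_imp_map[OF T] x], of c]
        mult_left_mono[OF B(2)[OF x], of "norm c"] by (simp add: mult.assoc)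
    then show ?thesis
      unfolding iff using multilinear_map_smult[OF E F multilinear_ops_imp_map[OF T]] B(1)
      by (auto intro!: exI[of _ "norm c * B"])
  qed
qed

text \<open>Stated for an arbitrary record of operators with pointwise operations: it serves both
  \<^const>\<open>multilinear_module\<close> and \<^const>\<open>component_space\<close>.\<close>

lemma module_of_operators:
  fixes E :: "'n::finite \<Rightarrow> ('k::real_normed_field, 'a) nspace" and F :: "('k, 'b) nspace"
    and M :: "('k, ('n \<Rightarrow> 'a) \<Rightarrow> 'b, 'm) module_scheme"
  assumes F: "normed_space F"
    and carr: "carrier M \<subseteq> multilinear_ops E F"
    and ops: "zero M = (\<lambda>x\<in>prod_carrier E. \<zero>\<^bsub>F\<^esub>)" "add M = (\<lambda>S T. \<lambda>x\<in>prod_carrier E. S x \<oplus>\<^bsub>F\<^esub> T x)"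
      "smult M = (\<lambda>c T. \<lambda>x\<in>prod_carrier E. c \<odot>\<^bsub>F\<^esub> T x)"
    and closed: "zero M \<in> carrier M" "\<And>S T. S \<in> carrier M \<Longrightarrow> T \<in> carrier M \<Longrightarrow> add M S T \<in> carrier M"
      "\<And>c T. T \<in> carrier M \<Longrightarrow> smult M c T \<in> carrier M"
  shows "Module.module scalar_ring M"
proof -
  have c: "T x \<in> carrier F" if "T \<in> carrier M" "x \<in> prod_carrier E" for T x
    by (rule multilinear_map_closed[OF multilinear_ops_imp_map[OF subsetD[OF carr that(1)]] that(2)])
  have ext: "T \<in> extensional (prod_carrier E)" if "T \<in> carrier M" for T
    using that carr by (auto simp: multilinear_ops_def PiE_def)
  have eqI: "S = T" if "S \<in> carrier M" "T \<in> carrier M" "\<And>x. x \<in> prod_carrier E \<Longrightarrow> S x = T x" for S T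
    by (rule extensionalityI[OF ext[OF that(1)] ext[OF that(2)] that(3)])
  have "abelian_group M"
  proof (rule abelian_groupI)
    show "\<exists>S\<in>carrier M. S \<oplus>\<^bsub>M\<^esub> T = \<zero>\<^bsub>M\<^esub>" if T: "T \<in> carrier M" for T
    proof
      have "(- 1) \<odot>\<^bsub>F\<^esub> y \<oplus>\<^bsub>F\<^esub> y = \<zero>\<^bsub>F\<^esub>" if "y \<in> carrier F" for y
        using that F ns_distrib(1)[of F y "-1" 1] by simp
      then show "smult M (- 1) T \<oplus>\<^bsub>M\<^esub> T = \<zero>\<^bsub>M\<^esub>"
        by (intro eqI closed T) (simp add: ops c[OF T])
    qed (rule closed(3)[OF T])
    show "R \<oplus>\<^bsub>M\<^esub> S \<oplus>\<^bsub>M\<^esub> T = R \<oplus>\<^bsub>M\<^esub> (S \<oplus>\<^bsub>M\<^esub> T)" if "R \<in> carrier M" "S \<in> carrier M" "T \<in> carrier M" for R S T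
      by (intro eqI closed that) (simp add: ops c F ns_add that)
    show "S \<oplus>\<^bsub>M\<^esub> T = T \<oplus>\<^bsub>M\<^esub> S" if "S \<in> carrier M" "T \<in> carrier M" for S T
      by (intro eqI closed that) (simp add: ops c F ns_add(1) that)
    show "\<zero>\<^bsub>M\<^esub> \<oplus>\<^bsub>M\<^esub> T = T" if "T \<in> carrier M" for T
      by (intro eqI closed that) (simp add: ops c F that)
  qed (rule closed; assumption)+
  then show ?thesis
  proof (rule moduleI[OF cring_scalar_ring])
    show "a \<odot>\<^bsub>M\<^esub> T \<in> carrier M" if "T \<in> carrier M" for a :: 'k and T by (rule closed(3)[OF that])
    show "(a \<oplus>\<^bsub>scalar_ring\<^esub> b) \<odot>\<^bsub>M\<^esub> T = a \<odot>\<^bsub>M\<^esub> T \<oplus>\<^bsub>M\<^esub> b \<odot>\<^bsub>M\<^esub> T" if "T \<in> carrier M" for a b T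
      by (intro eqI closed that) (simp add: ops c F ns_distrib(1) that)
    show "a \<odot>\<^bsub>M\<^esub> (S \<oplus>\<^bsub>M\<^esub> T) = a \<odot>\<^bsub>M\<^esub> S \<oplus>\<^bsub>M\<^esub> a \<odot>\<^bsub>M\<^esub> T" if "S \<in> carrier M" "T \<in> carrier M" for a S T
      by (intro eqI closed that) (simp add: ops c F ns_distrib(2) that)
    show "(a \<otimes>\<^bsub>scalar_ring\<^esub> b) \<odot>\<^bsub>M\<^esub> T = a \<odot>\<^bsub>M\<^esub> (b \<odot>\<^bsub>M\<^esub> T)" if "T \<in> carrier M" for a b T
      by (intro eqI closed that) (simp add: ops c F that)
    show "\<one>\<^bsub>scalar_ring\<^esub> \<odot>\<^bsub>M\<^esub> T = T" if "T \<in> carrier M" for T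
      by (intro eqI closed that) (simp add: ops c F that)
  qed
qed

section \<open>Estimates for sums, products and compositions\<close>

lemma index_tuple_closed:
  "(\<And>i l. l < m \<Longrightarrow> x i l \<in> carrier (E i)) \<Longrightarrow> j \<in> index_box m \<Longrightarrow> (\<lambda>i. x i (j i)) \<in> prod_carrier E"
  by (simp add: prod_carrier_iff)

lemma mCoh_bound_zero:
  fixes E :: "'n::finite \<Rightarrow> ('k::real_normed_field, 'a) nspace" and F :: "('k, 'b) nspace"
  assumes "normed_space F" shows "mCoh_bound p E F (\<lambda>x\<in>prod_carrier E. \<zero>\<^bsub>F\<^esub>) 0"
proof (rule mCoh_boundI)
  fix m x and \<phi> :: "('n \<Rightarrow> nat) \<Rightarrow> 'b \<Rightarrow> 'k"
  assume x: "\<And>i j. j < m \<Longrightarrow> x i j \<in> carrier (E i)" and \<phi>: "\<And>j. j \<in> index_box m \<Longrightarrow> \<phi> j \<in> dual F"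
  have "\<phi> j ((\<lambda>x\<in>prod_carrier E. \<zero>\<^bsub>F\<^esub>) (\<lambda>i. x i (j i))) = 0" if j: "j \<in> index_box m" for j
    using index_tuple_closed[where E = E and x = x, OF x j] dual_apply(3)[OF assms \<phi>[OF j]] by simp
  then show "(\<Sum>j\<in>index_box m. norm (\<phi> j ((\<lambda>x\<in>prod_carrier E. \<zero>\<^bsub>F\<^esub>) (\<lambda>i. x i (j i)))))
      \<le> 0 * (\<Prod>i\<in>UNIV. strong_norm p {..<m} (E i) (x i)) * weak_norm (conj_exponent p) (index_box m) F \<phi>"
    by simp
qed simp

lemma mCoh_bound_add:
  fixes E :: "'n::finite \<Rightarrow> ('k::real_normed_field, 'a) nspace" and F :: "('k, 'b) nspace"
  assumes F: "normed_space F" and S: "multilinear_map E F S" and T: "multilinear_map E F T"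
    and bS: "mCoh_bound p E F S C" and bT: "mCoh_bound p E F T D"
  shows "mCoh_bound p E F (\<lambda>x\<in>prod_carrier E. S x \<oplus>\<^bsub>F\<^esub> T x) (C + D)"
proof (rule mCoh_boundI)
  show "0 \<le> C + D" using bS bT by (simp add: mCoh_bound_def)
  fix m x and \<phi> :: "('n \<Rightarrow> nat) \<Rightarrow> 'b \<Rightarrow> 'k"
  assume x: "\<And>i j. j < m \<Longrightarrow> x i j \<in> carrier (E i)" and \<phi>: "\<And>j. j \<in> index_box m \<Longrightarrow> \<phi> j \<in> dual F"
  let ?P = "\<Prod>i\<in>UNIV. strong_norm p {..<m} (E i) (x i)" and ?W = "weak_norm (conj_exponent p) (index_box m) F \<phi>"
  have "(\<Sum>j\<in>index_box m. norm (\<phi> j ((\<lambda>x\<in>prod_carrier E. S x \<oplus>\<^bsub>F\<^esub> T x) (\<lambda>i. x i (j i)))))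
      \<le> (\<Sum>j\<in>index_box m. norm (\<phi> j (S (\<lambda>i. x i (j i)))) + norm (\<phi> j (T (\<lambda>i. x i (j i)))))"
  proof (rule sum_mono)
    fix j :: "'n \<Rightarrow> nat" assume j: "j \<in> index_box m"
    note z = index_tuple_closed[where E = E and x = x, OF x j]
    show "norm (\<phi> j ((\<lambda>x\<in>prod_carrier E. S x \<oplus>\<^bsub>F\<^esub> T x) (\<lambda>i. x i (j i))))
      \<le> norm (\<phi> j (S (\<lambda>i. x i (j i)))) + norm (\<phi> j (T (\<lambda>i. x i (j i))))"
      using z dual_apply(1)[OF F \<phi>[OF j] multilinear_map_closed[OF S z] multilinear_map_closed[OF T z]]
      by (simp add: norm_triangle_ineq)
  qed
  also have "\<dots> \<le> C * ?P * ?W + D * ?P * ?W"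
    unfolding sum.distrib by (intro add_mono mCoh_boundD[OF bS x \<phi>] mCoh_boundD[OF bT x \<phi>])
  finally show "(\<Sum>j\<in>index_box m. norm (\<phi> j ((\<lambda>x\<in>prod_carrier E. S x \<oplus>\<^bsub>F\<^esub> T x) (\<lambda>i. x i (j i)))))
      \<le> (C + D) * ?P * ?W" by (simp add: algebra_simps)
qed

lemma mCoh_bound_smult:
  fixes E :: "'n::finite \<Rightarrow> ('k::real_normed_field, 'a) nspace" and F :: "('k, 'b) nspace"
  assumes F: "normed_space F" and T: "multilinear_map E F T" and bT: "mCoh_bound p E F T C"
  shows "mCoh_bound p E F (\<lambda>x\<in>prod_carrier E. c \<odot>\<^bsub>F\<^esub> T x) (norm c * C)"
proof (rule mCoh_boundI)
  show "0 \<le> norm c * C" using bT by (simp add: mCoh_bound_def)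
  fix m x and \<phi> :: "('n \<Rightarrow> nat) \<Rightarrow> 'b \<Rightarrow> 'k"
  assume x: "\<And>i j. j < m \<Longrightarrow> x i j \<in> carrier (E i)" and \<phi>: "\<And>j. j \<in> index_box m \<Longrightarrow> \<phi> j \<in> dual F"
  have "norm (\<phi> j ((\<lambda>x\<in>prod_carrier E. c \<odot>\<^bsub>F\<^esub> T x) (\<lambda>i. x i (j i)))) = norm c * norm (\<phi> j (T (\<lambda>i. x i (j i))))"
    if j: "j \<in> index_box m" for j
  proof -
    note z = index_tuple_closed[where E = E and x = x, OF x j]
    show ?thesis
      using z dual_apply(2)[OF F \<phi>[OF j] multilinear_map_closed[OF T z]] by (simp add: norm_mult)
  qed
  then have "(\<Sum>j\<in>index_box m. norm (\<phi> j ((\<lambda>x\<in>prod_carrier E. c \<odot>\<^bsub>F\<^esub> T x) (\<lambda>i. x i (j i)))))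
      = norm c * (\<Sum>j\<in>index_box m. norm (\<phi> j (T (\<lambda>i. x i (j i)))))"
    by (simp add: sum_distrib_left)
  also have "\<dots> \<le> norm c * (C * (\<Prod>i\<in>UNIV. strong_norm p {..<m} (E i) (x i)) *
      weak_norm (conj_exponent p) (index_box m) F \<phi>)"
    by (intro mult_left_mono mCoh_boundD[OF bT x \<phi>]) auto
  finally show "(\<Sum>j\<in>index_box m. norm (\<phi> j ((\<lambda>x\<in>prod_carrier E. c \<odot>\<^bsub>F\<^esub> T x) (\<lambda>i. x i (j i)))))
      \<le> norm c * C * (\<Prod>i\<in>UNIV. strong_norm p {..<m} (E i) (x i)) *
        weak_norm (conj_exponent p) (index_box m) F \<phi>" by (simp add: mult.assoc)
qed

lemma lp_norm_singleton: "0 \<le> a i \<Longrightarrow> p > 0 \<Longrightarrow> lp_norm p {i} a = a i"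
  by (simp add: lp_norm_def powr_powr)

text \<open>The case of sequences of length one. With a norming functional for \<open>T x\<close> it shows that the
  constant also bounds the operator norm of \<open>T\<close>.\<close>

lemma mCoh_bound_functional:
  fixes E :: "'n::finite \<Rightarrow> ('k::real_normed_field, 'a) nspace"
  assumes p: "1 < p" and E: "\<And>i. normed_space (E i)" and F: "normed_space F"
    and T: "mCoh_bound p E F T C" and x: "x \<in> prod_carrier E"
    and \<phi>: "\<phi> \<in> dual F" "\<And>y. y \<in> carrier F \<Longrightarrow> norm (\<phi> y) \<le> vnorm F y"
  shows "norm (\<phi> (T x)) \<le> C * (\<Prod>i\<in>UNIV. vnorm (E i) (x i))"
proof -
  have box1: "index_box 1 = {\<lambda>_::'n. 0}" by auto
  have one: "{..<1} = {0::nat}" by auto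
  have xc: "x i \<in> carrier (E i)" for i using x by (simp add: prod_carrier_iff)
  have s: "strong_norm p {..<1::nat} (E i) (\<lambda>_. x i) = vnorm (E i) (x i)" for i
    using p ns_norm_ge0[OF E xc] unfolding one by (simp add: strong_norm_finite lp_norm_singleton)
  have w: "weak_norm (conj_exponent p) (index_box 1) F (\<lambda>_::'n \<Rightarrow> nat. \<phi>) \<le> 1"
  proof (rule weak_norm_finite_le[OF F finite_index_box])
    fix y assume "y \<in> unit_ball F"
    then have "norm (\<phi> y) \<le> 1" using \<phi>(2)[of y] by (simp add: unit_ball_def)
    then show "lp_norm (conj_exponent p) (index_box 1) (\<lambda>_::'n \<Rightarrow> nat. norm (\<phi> y)) \<le> 1"
      using conj_exponent(1)[OF p] unfolding box1 by (simp add: lp_norm_singleton)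
  qed
  have "norm (\<phi> (T x)) = (\<Sum>j\<in>(index_box 1 :: ('n \<Rightarrow> nat) set). norm (\<phi> (T (\<lambda>i. x i))))" unfolding box1 by simp
  also have "\<dots> \<le> C * (\<Prod>i\<in>UNIV. strong_norm p {..<1::nat} (E i) (\<lambda>_. x i)) *
      weak_norm (conj_exponent p) (index_box 1) F (\<lambda>_::'n \<Rightarrow> nat. \<phi>)"
    by (rule mCoh_boundD[OF T, where x = "\<lambda>i _. x i" and \<phi> = "\<lambda>_. \<phi>"]) (use xc \<phi> in auto)
  also have "\<dots> \<le> C * (\<Prod>i\<in>UNIV. vnorm (E i) (x i)) * 1"
    unfolding s using w T ns_norm_ge0[OF E xc]
    by (intro mult_left_mono mult_nonneg_nonneg prod_nonneg) (auto simp: mCoh_bound_def)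
  finally show ?thesis by simp
qed

lemma lp_norm_prod:
  fixes a :: "'n::finite \<Rightarrow> nat \<Rightarrow> real"
  assumes "p > 0" "\<And>i l. l < m \<Longrightarrow> 0 \<le> a i l"
  shows "lp_norm p (index_box m) (\<lambda>j. \<Prod>i\<in>UNIV. a i (j i)) = (\<Prod>i\<in>UNIV. lp_norm p {..<m} (a i))"
proof -
  have "(\<Prod>i\<in>UNIV. a i (j i)) powr p = (\<Prod>i\<in>UNIV. a i (j i) powr p)" if "j \<in> index_box m" for j
    by (rule prod_powr_distrib)
  then have "(\<Sum>j\<in>index_box m. (\<Prod>i\<in>UNIV. a i (j i)) powr p) = (\<Prod>i\<in>UNIV. \<Sum>l<m. a i l powr p)"
    unfolding index_box_PiE by (subst prod_sum_PiE) (auto simp: PiE_iff intro!: sum.cong)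
  then show ?thesis
    unfolding lp_norm_def by (simp add: prod_powr_distrib sum_nonneg)
qed

text \<open>By Hoelder's inequality on the index set, where the \<open>p\<close>-norm of a tensor product of sequences is the
  product of their \<open>p\<close>-norms.\<close>

lemma mCoh_bound_product:
  fixes E :: "'n::finite \<Rightarrow> ('k::real_normed_field, 'a) nspace" and F :: "('k, 'b) nspace"
  assumes p: "1 < p" and E: "\<And>i. normed_space (E i)" and F: "normed_space F"
    and B: "\<And>i. 0 \<le> B i" "\<And>i y. y \<in> carrier (E i) \<Longrightarrow> norm (f i y) \<le> B i * vnorm (E i) y"
    and b: "b \<in> carrier F"
  shows "mCoh_bound p E F (\<lambda>x\<in>prod_carrier E. (\<Prod>i\<in>UNIV. f i (x i)) \<odot>\<^bsub>F\<^esub> b) ((\<Prod>i\<in>UNIV. B i) * vnorm F b)"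
proof (rule mCoh_boundI)
  let ?q = "conj_exponent p"
  show "0 \<le> (\<Prod>i\<in>UNIV. B i) * vnorm F b"
    using B(1) ns_norm_ge0[OF F b] by (simp add: prod_nonneg)
  fix m x and \<phi> :: "('n \<Rightarrow> nat) \<Rightarrow> 'b \<Rightarrow> 'k"
  assume x: "\<And>i j. j < m \<Longrightarrow> x i j \<in> carrier (E i)" and \<phi>: "\<And>j. j \<in> index_box m \<Longrightarrow> \<phi> j \<in> dual F"
  have "norm (\<phi> j ((\<lambda>x\<in>prod_carrier E. (\<Prod>i\<in>UNIV. f i (x i)) \<odot>\<^bsub>F\<^esub> b) (\<lambda>i. x i (j i))))
      = (\<Prod>i\<in>UNIV. norm (f i (x i (j i)))) * norm (\<phi> j b)" if j: "j \<in> index_box m" for j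
    using index_tuple_closed[where E = E and x = x, OF x j] dual_apply(2)[OF F \<phi>[OF j] b]
    by (simp add: norm_mult prod_norm)
  then have "(\<Sum>j\<in>index_box m. norm (\<phi> j ((\<lambda>x\<in>prod_carrier E. (\<Prod>i\<in>UNIV. f i (x i)) \<odot>\<^bsub>F\<^esub> b) (\<lambda>i. x i (j i)))))
      = (\<Sum>j\<in>index_box m. (\<Prod>i\<in>UNIV. norm (f i (x i (j i)))) * norm (\<phi> j b))"
    by simp
  also have "\<dots> \<le> lp_norm p (index_box m) (\<lambda>j. \<Prod>i\<in>UNIV. norm (f i (x i (j i)))) * lp_norm ?q (index_box m) (\<lambda>j. norm (\<phi> j b))"
    by (rule Hoelder_sum[OF p finite_index_box]) (auto simp: prod_nonneg)
  also have "\<dots> = (\<Prod>i\<in>UNIV. lp_norm p {..<m} (\<lambda>l. norm (f i (x i l)))) * lp_norm ?q (index_box m) (\<lambda>j. norm (\<phi> j b))"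
    using p by (subst lp_norm_prod) auto
  also have "\<dots> \<le> (\<Prod>i\<in>UNIV. B i * strong_norm p {..<m} (E i) (x i)) * (weak_norm ?q (index_box m) F \<phi> * vnorm F b)"
  proof (intro mult_mono prod_mono conjI)
    fix i
    have "lp_norm p {..<m} (\<lambda>l. norm (f i (x i l))) \<le> lp_norm p {..<m} (\<lambda>l. B i * vnorm (E i) (x i l))"
      using p B(2) x by (intro lp_norm_mono) auto
    also have "\<dots> = B i * strong_norm p {..<m} (E i) (x i)"
      unfolding strong_norm_finite[OF finite_lessThan]
      using p B(1) ns_norm_ge0[OF E x] by (intro lp_norm_scale) auto
    finally show "lp_norm p {..<m} (\<lambda>l. norm (f i (x i l))) \<le> B i * strong_norm p {..<m} (E i) (x i)" .
    show "lp_norm ?q (index_box m) (\<lambda>j. norm (\<phi> j b)) \<le> weak_norm ?q (index_box m) F \<phi> * vnorm F b"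
      using conj_exponent(1)[OF p] by (intro weak_norm_finite_bound[OF F finite_index_box _ \<phi> b]) auto
    show "0 \<le> (\<Prod>i\<in>UNIV. B i * strong_norm p {..<m} (E i) (x i))"
      using B(1) by (intro prod_nonneg) (simp add: strong_norm_def)
  qed auto
  finally show "(\<Sum>j\<in>index_box m. norm (\<phi> j ((\<lambda>x\<in>prod_carrier E. (\<Prod>i\<in>UNIV. f i (x i)) \<odot>\<^bsub>F\<^esub> b) (\<lambda>i. x i (j i)))))
      \<le> (\<Prod>i\<in>UNIV. B i) * vnorm F b * (\<Prod>i\<in>UNIV. strong_norm p {..<m} (E i) (x i)) * weak_norm ?q (index_box m) F \<phi>"
    by (simp add: prod.distrib mult_ac)
qed

text \<open>Move \<open>t\<close> to the functionals, whose weak norm it multiplies by at most \<open>\<parallel>t\<parallel>\<close>, and \<open>u i\<close> to the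
  sequences, whose strong norms it multiplies by at most \<open>\<parallel>u i\<parallel>\<close>.\<close>

lemma mCoh_bound_compose:
  fixes E G :: "'n::finite \<Rightarrow> ('k::real_normed_field, 'a) nspace" and F H :: "('k, 'b) nspace"
  assumes p: "1 < p" and E: "\<And>i. normed_space (E i)" and F: "normed_space F"
    and G: "\<And>i. normed_space (G i)" and H: "normed_space H"
    and T: "multilinear_map E F T" and bT: "mCoh_bound p E F T C"
    and u: "\<And>i. u i \<in> linear_ops (G i) (E i)" and t: "t \<in> linear_ops F H"
  shows "mCoh_bound p G H (\<lambda>x\<in>prod_carrier G. t (T (\<lambda>i. u i (x i))))
    (opnorm F H t * C * (\<Prod>i\<in>UNIV. opnorm (G i) (E i) (u i)))"
proof (rule mCoh_boundI)
  let ?q = "conj_exponent p"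
  have q: "?q > 0" using conj_exponent(1)[OF p] by simp
  have C: "C \<ge> 0" using bT by (simp add: mCoh_bound_def)
  note U0 = opnorm_nonneg[OF G E u] and t0 = opnorm_nonneg[OF F H t]
  have uc: "u i y \<in> carrier (E i)" if "y \<in> carrier (G i)" for i y
    using u[of i] that unfolding linear_ops_def by auto
  have tc: "t y \<in> carrier H" if "y \<in> carrier F" for y using t that unfolding linear_ops_def by auto
  show "0 \<le> opnorm F H t * C * (\<Prod>i\<in>UNIV. opnorm (G i) (E i) (u i))"
    using C U0 t0 by (simp add: prod_nonneg)
  fix m x and \<phi> :: "('n \<Rightarrow> nat) \<Rightarrow> 'b \<Rightarrow> 'k"
  assume x: "\<And>i j. j < m \<Longrightarrow> x i j \<in> carrier (G i)" and \<phi>: "\<And>j. j \<in> index_box m \<Longrightarrow> \<phi> j \<in> dual H"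
  define y where "y i l = u i (x i l)" for i l
  define \<psi> where "\<psi> j = (\<lambda>v\<in>carrier F. \<phi> j (t v))" for j
  have y: "y i l \<in> carrier (E i)" if "l < m" for i l unfolding y_def by (rule uc[OF x[OF that]])
  have \<psi>: "\<psi> j \<in> dual F" if j: "j \<in> index_box m" for j
  proof -
    obtain B where B: "B \<ge> 0" "\<And>v. v \<in> carrier H \<Longrightarrow> norm (\<phi> j v) \<le> B * vnorm H v"
      using dual_bound[OF H \<phi>[OF j]] by blast
    have "norm (\<phi> j (t v)) \<le> (B * opnorm F H t) * vnorm F v" if "v \<in> carrier F" for v
      using B(2)[OF tc[OF that]] mult_left_mono[OF opnorm_bound[OF F H t that] B(1)] by simp
    then have "\<exists>B\<ge>0. \<forall>v\<in>carrier F. norm (\<psi> j v) \<le> B * vnorm F v"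
      using B(1) t0 by (intro exI[of _ "B * opnorm F H t"]) (simp add: \<psi>_def)
    moreover have "\<psi> j (v \<oplus>\<^bsub>F\<^esub> w) = \<psi> j v + \<psi> j w" if "v \<in> carrier F" "w \<in> carrier F" for v w
      using that t F tc dual_apply(1)[OF H \<phi>[OF j]] by (simp add: \<psi>_def linear_ops_def)
    moreover have "\<psi> j (c \<odot>\<^bsub>F\<^esub> v) = c * \<psi> j v" if "v \<in> carrier F" for c v
      using that t F tc dual_apply(2)[OF H \<phi>[OF j]] by (simp add: \<psi>_def linear_ops_def)
    ultimately show ?thesis unfolding dual_iff[OF F] by (simp add: \<psi>_def)
  qed
  have "norm (\<phi> j ((\<lambda>x\<in>prod_carrier G. t (T (\<lambda>i. u i (x i)))) (\<lambda>i. x i (j i)))) = norm (\<psi> j (T (\<lambda>i. y i (j i))))"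
    if j: "j \<in> index_box m" for j
    using index_tuple_closed[where E = G and x = x, OF x j]
      multilinear_map_closed[OF T index_tuple_closed[where E = E and x = y, OF y j]]
    by (simp add: \<psi>_def y_def)
  then have "(\<Sum>j\<in>index_box m. norm (\<phi> j ((\<lambda>x\<in>prod_carrier G. t (T (\<lambda>i. u i (x i)))) (\<lambda>i. x i (j i)))))
      = (\<Sum>j\<in>index_box m. norm (\<psi> j (T (\<lambda>i. y i (j i)))))" by simp
  also have "\<dots> \<le> C * (\<Prod>i\<in>UNIV. strong_norm p {..<m} (E i) (y i)) * weak_norm ?q (index_box m) F \<psi>"
    by (rule mCoh_boundD[OF bT y \<psi>])
  also have "\<dots> \<le> C * (\<Prod>i\<in>UNIV. opnorm (G i) (E i) (u i) * strong_norm p {..<m} (G i) (x i)) *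
      (opnorm F H t * weak_norm ?q (index_box m) H \<phi>)"
  proof (intro mult_mono prod_mono conjI order_refl C)
    fix i
    have "strong_norm p {..<m} (E i) (y i) \<le> lp_norm p {..<m} (\<lambda>l. opnorm (G i) (E i) (u i) * vnorm (G i) (x i l))"
      unfolding strong_norm_finite[OF finite_lessThan]
    proof (rule lp_norm_mono)
      show "0 \<le> vnorm (E i) (y i l)" if "l \<in> {..<m}" for l using ns_norm_ge0[OF E y] that by simp
      show "vnorm (E i) (y i l) \<le> opnorm (G i) (E i) (u i) * vnorm (G i) (x i l)" if "l \<in> {..<m}" for l
        unfolding y_def using that by (intro opnorm_bound[OF G E u] x) auto
    qed (use p in simp)
    also have "\<dots> = opnorm (G i) (E i) (u i) * strong_norm p {..<m} (G i) (x i)"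
      unfolding strong_norm_finite[OF finite_lessThan]
      using p U0 ns_norm_ge0[OF G x] by (intro lp_norm_scale) auto
    finally show "strong_norm p {..<m} (E i) (y i) \<le> opnorm (G i) (E i) (u i) * strong_norm p {..<m} (G i) (x i)" .
    show "weak_norm ?q (index_box m) F \<psi> \<le> opnorm F H t * weak_norm ?q (index_box m) H \<phi>"
    proof (rule weak_norm_finite_le[OF F finite_index_box])
      fix v assume v: "v \<in> unit_ball F"
      then have vc: "v \<in> carrier F" "vnorm F v \<le> 1" by (auto simp: unit_ball_def)
      have "lp_norm ?q (index_box m) (\<lambda>j. norm (\<psi> j v)) = lp_norm ?q (index_box m) (\<lambda>j. norm (\<phi> j (t v)))"
        using vc by (simp add: \<psi>_def)
      also have "\<dots> \<le> weak_norm ?q (index_box m) H \<phi> * vnorm H (t v)"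
        by (rule weak_norm_finite_bound[OF H finite_index_box q \<phi> tc[OF vc(1)]])
      also have "\<dots> \<le> weak_norm ?q (index_box m) H \<phi> * opnorm F H t"
      proof (rule mult_left_mono)
        show "vnorm H (t v) \<le> opnorm F H t"
          using opnorm_bound[OF F H t vc(1)] mult_left_mono[OF vc(2) t0] by simp
        show "0 \<le> weak_norm ?q (index_box m) H \<phi>" by (rule weak_norm_finite_nonneg[OF H finite_index_box q \<phi>])
      qed
      finally show "lp_norm ?q (index_box m) (\<lambda>j. norm (\<psi> j v)) \<le> opnorm F H t * weak_norm ?q (index_box m) H \<phi>"
        by (simp add: mult.commute)
    qed
    show "0 \<le> weak_norm ?q (index_box m) F \<psi>" by (rule weak_norm_finite_nonneg[OF F finite_index_box q \<psi>])
    show "0 \<le> C * (\<Prod>i\<in>UNIV. opnorm (G i) (E i) (u i) * strong_norm p {..<m} (G i) (x i))"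
      using C U0 by (intro mult_nonneg_nonneg prod_nonneg) (auto simp: strong_norm_def)
  qed (auto simp: prod_strong_norm_nonneg, simp add: strong_norm_def)
  finally show "(\<Sum>j\<in>index_box m. norm (\<phi> j ((\<lambda>x\<in>prod_carrier G. t (T (\<lambda>i. u i (x i)))) (\<lambda>i. x i (j i)))))
      \<le> opnorm F H t * C * (\<Prod>i\<in>UNIV. opnorm (G i) (E i) (u i)) *
        (\<Prod>i\<in>UNIV. strong_norm p {..<m} (G i) (x i)) * weak_norm ?q (index_box m) H \<phi>"
    by (simp add: prod.distrib mult_ac)
qed

section \<open>The norm of multiplication\<close>

text \<open>The bound \<open>1\<close> is the one for products of functionals. It is optimal already for one tuple,
  consisting of ones.\<close>

lemma mCoh_norm_scalar_product:
  fixes \<iota> :: "'k::real_normed_field \<Rightarrow> 'a" and p :: real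
  assumes p: "1 < p" and inj: "inj \<iota>"
  shows "mCoh_norm p (\<lambda>i::'n::finite. scalar_copy \<iota>) (scalar_copy \<iota>)
      (\<lambda>x\<in>prod_carrier (\<lambda>i::'n. scalar_copy \<iota>). \<iota> (\<Prod>i\<in>UNIV. the_inv \<iota> (x i))) = 1"
proof -
  let ?K = "scalar_copy \<iota>"
  let ?T = "\<lambda>x\<in>prod_carrier (\<lambda>i::'n. ?K). \<iota> (\<Prod>i\<in>UNIV. the_inv \<iota> (x i))"
  note K = normed_space_scalar_copy[OF inj]
  have inv: "the_inv \<iota> (\<iota> c) = c" for c using inj by (rule the_inv_f_f)
  have sm: "c \<odot>\<^bsub>?K\<^esub> \<iota> 1 = \<iota> c" for c by (simp add: scalar_copy_def inv)
  have one: "\<iota> 1 \<in> carrier ?K" "vnorm ?K (\<iota> 1) = 1" by (simp_all add: scalar_copy_def inv)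
  have "mCoh_bound p (\<lambda>i::'n. ?K) ?K (\<lambda>x\<in>prod_carrier (\<lambda>i::'n. ?K). (\<Prod>i\<in>UNIV. the_inv \<iota> (x i)) \<odot>\<^bsub>?K\<^esub> \<iota> 1)
      ((\<Prod>i\<in>(UNIV::'n set). 1) * vnorm ?K (\<iota> 1))"
    by (rule mCoh_bound_product[OF p K K _ _ one(1)]) (auto simp: scalar_copy_def)
  then have 1: "mCoh_bound p (\<lambda>i::'n. ?K) ?K ?T 1" by (simp add: sm one(2))
  have ge: "1 \<le> C" if C: "mCoh_bound p (\<lambda>i::'n. ?K) ?K ?T C" for C
  proof -
    let ?\<phi> = "\<lambda>y\<in>carrier ?K. the_inv \<iota> y"
    have "?\<phi> \<in> dual ?K"
      unfolding dual_iff[OF K] by (auto simp: scalar_copy_def inv intro!: exI[of _ 1])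
    moreover have "norm (?\<phi> y) \<le> vnorm ?K y" if "y \<in> carrier ?K" for y
      using that by (simp add: scalar_copy_def)
    moreover have x: "(\<lambda>i::'n. \<iota> 1) \<in> prod_carrier (\<lambda>i::'n. ?K)" using one by (simp add: prod_carrier_iff)
    ultimately have "norm (?\<phi> (?T (\<lambda>i. \<iota> 1))) \<le> C * (\<Prod>i\<in>(UNIV::'n set). vnorm ?K (\<iota> 1))"
      using mCoh_bound_functional[OF p K K C] by blast
    then show ?thesis using x one by (simp add: inv)
  qed
  show ?thesis
  proof (rule antisym)
    show "mCoh_norm p (\<lambda>i::'n. ?K) ?K ?T \<le> 1" by (rule mCoh_norm_le[OF p K _ 1]) (use 1 in blast)
    show "1 \<le> mCoh_norm p (\<lambda>i::'n. ?K) ?K ?T"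
      by (rule ge, rule mCoh_bound_mCoh_norm[OF p K]) (use 1 in blast)
  qed
qed

section \<open>Completeness of the components\<close>

lemma ns_limit_unique:
  assumes F: "normed_space F" and s: "\<And>k. s k \<in> carrier F" and ab: "a \<in> carrier F" "b \<in> carrier F"
    and lim: "(\<lambda>k. vnorm F (s k \<ominus>\<^bsub>F\<^esub> a)) \<longlonglongrightarrow> 0" "(\<lambda>k. vnorm F (s k \<ominus>\<^bsub>F\<^esub> b)) \<longlonglongrightarrow> 0"
  shows "a = b"
proof -
  have "(\<lambda>k. vnorm F (s k \<ominus>\<^bsub>F\<^esub> a) + vnorm F (s k \<ominus>\<^bsub>F\<^esub> b)) \<longlonglongrightarrow> 0 + 0" by (intro tendsto_add lim)
  moreover have "vnorm F (a \<ominus>\<^bsub>F\<^esub> b) \<le> vnorm F (s k \<ominus>\<^bsub>F\<^esub> a) + vnorm F (s k \<ominus>\<^bsub>F\<^esub> b)" for k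
    using ns_norm_diff_triangle[OF F ab(1) s ab(2)] ns_norm_diff_commute[OF F ab(1) s] by simp
  ultimately have "vnorm F (a \<ominus>\<^bsub>F\<^esub> b) \<le> 0 + 0" by (intro LIMSEQ_le_const) auto
  then have "vnorm F (a \<ominus>\<^bsub>F\<^esub> b) = 0" using ns_norm_ge0[OF F ns_closed(4)[OF F ab]] by simp
  then show ?thesis using ns_norm_diff_eq0[OF F ab] by simp
qed

lemma ns_limit_add:
  assumes F: "normed_space F" and s: "\<And>k. s k \<in> carrier F" and t: "\<And>k. t k \<in> carrier F"
    and ab: "a \<in> carrier F" "b \<in> carrier F"
    and lim: "(\<lambda>k. vnorm F (s k \<ominus>\<^bsub>F\<^esub> a)) \<longlonglongrightarrow> 0" "(\<lambda>k. vnorm F (t k \<ominus>\<^bsub>F\<^esub> b)) \<longlonglongrightarrow> 0"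
  shows "(\<lambda>k. vnorm F ((s k \<oplus>\<^bsub>F\<^esub> t k) \<ominus>\<^bsub>F\<^esub> (a \<oplus>\<^bsub>F\<^esub> b))) \<longlonglongrightarrow> 0"
proof (rule Lim_null_comparison)
  have "(s k \<oplus>\<^bsub>F\<^esub> t k) \<ominus>\<^bsub>F\<^esub> (a \<oplus>\<^bsub>F\<^esub> b) = (s k \<ominus>\<^bsub>F\<^esub> a) \<oplus>\<^bsub>F\<^esub> (t k \<ominus>\<^bsub>F\<^esub> b)" for k
    using F s[of k] t[of k] ab by (simp add: ns_diff_eq ns_distrib(2) ns_add)
  then have "vnorm F ((s k \<oplus>\<^bsub>F\<^esub> t k) \<ominus>\<^bsub>F\<^esub> (a \<oplus>\<^bsub>F\<^esub> b)) \<le> vnorm F (s k \<ominus>\<^bsub>F\<^esub> a) + vnorm F (t k \<ominus>\<^bsub>F\<^esub> b)" for k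
    using ns_norm_triangle[OF F] F s t ab by simp
  then show "\<forall>\<^sub>F k in sequentially. norm (vnorm F ((s k \<oplus>\<^bsub>F\<^esub> t k) \<ominus>\<^bsub>F\<^esub> (a \<oplus>\<^bsub>F\<^esub> b)))
      \<le> vnorm F (s k \<ominus>\<^bsub>F\<^esub> a) + vnorm F (t k \<ominus>\<^bsub>F\<^esub> b)"
    using ns_norm_ge0[OF F] F s t ab by (intro always_eventually) simp
  show "(\<lambda>k. vnorm F (s k \<ominus>\<^bsub>F\<^esub> a) + vnorm F (t k \<ominus>\<^bsub>F\<^esub> b)) \<longlonglongrightarrow> 0"
    using tendsto_add[OF lim] by simp
qed

lemma ns_limit_smult:
  assumes F: "normed_space F" and s: "\<And>k. s k \<in> carrier F" and a: "a \<in> carrier F"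
    and lim: "(\<lambda>k. vnorm F (s k \<ominus>\<^bsub>F\<^esub> a)) \<longlonglongrightarrow> 0"
  shows "(\<lambda>k. vnorm F (c \<odot>\<^bsub>F\<^esub> s k \<ominus>\<^bsub>F\<^esub> c \<odot>\<^bsub>F\<^esub> a)) \<longlonglongrightarrow> 0"
proof -
  have "c \<odot>\<^bsub>F\<^esub> s k \<ominus>\<^bsub>F\<^esub> c \<odot>\<^bsub>F\<^esub> a = c \<odot>\<^bsub>F\<^esub> (s k \<ominus>\<^bsub>F\<^esub> a)" for k
    using F s[of k] a by (simp add: ns_diff_eq ns_distrib(2))
  then have "(\<lambda>k. vnorm F (c \<odot>\<^bsub>F\<^esub> s k \<ominus>\<^bsub>F\<^esub> c \<odot>\<^bsub>F\<^esub> a)) = (\<lambda>k. norm c * vnorm F (s k \<ominus>\<^bsub>F\<^esub> a))"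
    using F s a by (simp add: ns_norm_smult)
  then show ?thesis using tendsto_mult_right_zero[OF lim] by simp
qed

locale mCoh_component =
  fixes p :: real and E :: "'n::finite \<Rightarrow> ('k::real_normed_field, 'u) nspace" and F :: "('k, 'u) nspace"
  assumes p: "1 < p" and banach_E: "\<And>i. banach_space (E i)" and banach_F: "banach_space F"
    and norming_F: "norming F"
begin

abbreviation "Z \<equiv> component_space (mCoh_class p) (mCoh_class_norm p) E F"

lemma E: "normed_space (E i)" and F: "normed_space F"
  using banach_E banach_F by (simp_all add: banach_space_def)

lemma carrier_Z: "component (mCoh_class p) E F = mCoh_ops p E F"
  using banach_E banach_F by (auto simp: component_def mCoh_class_def mCoh_ops_def)

lemma bound_norm:
  assumes "multilinear_map E F T" "mCoh_bound p E F T C" "x \<in> prod_carrier E"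
  shows "vnorm F (T x) \<le> C * (\<Prod>i\<in>UNIV. vnorm (E i) (x i))"
proof -
  obtain \<phi> where \<phi>: "\<phi> \<in> dual F" "\<And>y. y \<in> carrier F \<Longrightarrow> norm (\<phi> y) \<le> vnorm F y"
    "norm (\<phi> (T x)) = vnorm F (T x)"
    using norming_F multilinear_map_closed[OF assms(1,3)] unfolding norming_def by blast
  show ?thesis using mCoh_bound_functional[OF p E F assms(2,3) \<phi>(1,2)] \<phi>(3) by simp
qed

text \<open>The inequality implies continuity, since it controls the operator norm.\<close>

lemma mCoh_opsI:
  assumes "multilinear_map E F T" "mCoh_bound p E F T C"
  shows "T \<in> mCoh_ops p E F"
proof (rule mCoh_bound_imp_mCoh_ops[OF p E F _ assms(2)])
  show "T \<in> multilinear_ops E F"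
    unfolding multilinear_ops_iff[where E = E and F = F, OF E F]
    using assms bound_norm[OF assms] by (auto simp: mCoh_bound_def)
qed

lemma mCoh_opsD:
  assumes "T \<in> mCoh_ops p E F"
  shows "T \<in> multilinear_ops E F" "multilinear_map E F T" "mCoh_bound p E F T (mCoh_norm p E F T)"
    and "0 \<le> mCoh_norm p E F T"
    and "mCoh_bound p E F T C \<Longrightarrow> mCoh_norm p E F T \<le> C"
proof -
  note ex = mCoh_ops_imp_mCoh_bound[OF p E F assms]
  show "T \<in> multilinear_ops E F" "multilinear_map E F T"
    using assms by (simp_all add: mCoh_ops_def multilinear_ops_imp_map)
  show "mCoh_bound p E F T (mCoh_norm p E F T)" by (rule mCoh_bound_mCoh_norm[OF p F ex])
  show "0 \<le> mCoh_norm p E F T" by (rule mCoh_norm_nonneg[OF p F ex])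
  show "mCoh_bound p E F T C \<Longrightarrow> mCoh_norm p E F T \<le> C" by (rule mCoh_norm_le[OF p F ex])
qed

lemma mCoh_zero: "(\<lambda>x\<in>prod_carrier E. \<zero>\<^bsub>F\<^esub>) \<in> mCoh_ops p E F"
  by (rule mCoh_opsI[OF multilinear_map_zero_fun mCoh_bound_zero]) (rule E F)+

lemma mCoh_add:
  assumes "S \<in> mCoh_ops p E F" "T \<in> mCoh_ops p E F"
  shows "(\<lambda>x\<in>prod_carrier E. S x \<oplus>\<^bsub>F\<^esub> T x) \<in> mCoh_ops p E F"
    and "mCoh_norm p E F (\<lambda>x\<in>prod_carrier E. S x \<oplus>\<^bsub>F\<^esub> T x) \<le> mCoh_norm p E F S + mCoh_norm p E F T"
proof -
  note m = mCoh_opsD(2)[OF assms(1)] mCoh_opsD(2)[OF assms(2)]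
  note b = mCoh_bound_add[OF F m mCoh_opsD(3)[OF assms(1)] mCoh_opsD(3)[OF assms(2)]]
  show 1: "(\<lambda>x\<in>prod_carrier E. S x \<oplus>\<^bsub>F\<^esub> T x) \<in> mCoh_ops p E F"
    by (rule mCoh_opsI[OF multilinear_map_add[OF E F m] b])
  show "mCoh_norm p E F (\<lambda>x\<in>prod_carrier E. S x \<oplus>\<^bsub>F\<^esub> T x) \<le> mCoh_norm p E F S + mCoh_norm p E F T"
    by (rule mCoh_opsD(5)[OF 1 b])
qed

lemma mCoh_smult:
  assumes "T \<in> mCoh_ops p E F"
  shows "(\<lambda>x\<in>prod_carrier E. c \<odot>\<^bsub>F\<^esub> T x) \<in> mCoh_ops p E F"
    and "mCoh_norm p E F (\<lambda>x\<in>prod_carrier E. c \<odot>\<^bsub>F\<^esub> T x) \<le> norm c * mCoh_norm p E F T"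
proof -
  note m = mCoh_opsD(2)[OF assms]
  note b = mCoh_bound_smult[OF F m mCoh_opsD(3)[OF assms]]
  show 1: "(\<lambda>x\<in>prod_carrier E. c \<odot>\<^bsub>F\<^esub> T x) \<in> mCoh_ops p E F"
    by (rule mCoh_opsI[OF multilinear_map_smult[OF E F m] b])
  show "mCoh_norm p E F (\<lambda>x\<in>prod_carrier E. c \<odot>\<^bsub>F\<^esub> T x) \<le> norm c * mCoh_norm p E F T"
    by (rule mCoh_opsD(5)[OF 1 b])
qed

lemma mCoh_norm_smult:
  assumes T: "T \<in> mCoh_ops p E F"
  shows "mCoh_norm p E F (\<lambda>x\<in>prod_carrier E. c \<odot>\<^bsub>F\<^esub> T x) = norm c * mCoh_norm p E F T"
proof (rule antisym)
  show "mCoh_norm p E F (\<lambda>x\<in>prod_carrier E. c \<odot>\<^bsub>F\<^esub> T x) \<le> norm c * mCoh_norm p E F T"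
    by (rule mCoh_smult(2)[OF T])
  show "norm c * mCoh_norm p E F T \<le> mCoh_norm p E F (\<lambda>x\<in>prod_carrier E. c \<odot>\<^bsub>F\<^esub> T x)"
  proof (cases "c = 0")
    case True
    then show ?thesis using mCoh_opsD(4)[OF mCoh_smult(1)[OF T]] by simp
  next
    case False
    let ?S = "\<lambda>x\<in>prod_carrier E. c \<odot>\<^bsub>F\<^esub> T x"
    have "T = (\<lambda>x\<in>prod_carrier E. inverse c \<odot>\<^bsub>F\<^esub> ?S x)"
    proof (rule extensionalityI)
      show "T \<in> extensional (prod_carrier E)"
        using mCoh_opsD(2)[OF T] by (simp add: multilinear_map_def PiE_def)
      show "T x = (\<lambda>x\<in>prod_carrier E. inverse c \<odot>\<^bsub>F\<^esub> ?S x) x" if "x \<in> prod_carrier E" for x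
        using that False F multilinear_map_closed[OF mCoh_opsD(2)[OF T] that] by simp
    qed simp
    then have "mCoh_norm p E F T \<le> norm (inverse c) * mCoh_norm p E F ?S"
      using mCoh_smult(2)[OF mCoh_smult(1)[OF T], of "inverse c"] by metis
    then show ?thesis using False unfolding norm_inverse by (simp add: field_simps)
  qed
qed

lemma module_Z: "Module.module scalar_ring Z"
  by (rule module_of_operators[where E = E, OF F])
    (use mCoh_zero mCoh_add mCoh_smult mCoh_opsD(1) in \<open>auto simp: carrier_Z\<close>)

lemma module_multilinear: "Module.module scalar_ring (multilinear_module E F)"
  by (rule module_of_operators[where E = E, OF F])
    (use multilinear_ops_closed[where E = E and F = F, OF E F] in auto)

lemma submodule_component: "submodule (component (mCoh_class p) E F) scalar_ring (multilinear_module E F)"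
  unfolding carrier_Z
proof (rule Module.module.submoduleI[OF module_multilinear])
  show "mCoh_ops p E F \<subseteq> carrier (multilinear_module E F)" by (auto simp: mCoh_ops_def)
  then show "\<ominus>\<^bsub>multilinear_module E F\<^esub> T \<in> mCoh_ops p E F" if "T \<in> mCoh_ops p E F" for T
    using module_minus_eq(1)[OF module_multilinear, of T T] mCoh_smult(1)[OF that, of "-1"] that by auto
qed (simp_all add: mCoh_zero mCoh_add(1) mCoh_smult(1))

lemma finite_type_subset: "finite_type_ops E F \<subseteq> component (mCoh_class p) E F"
  unfolding carrier_Z finite_type_ops_def
proof safe
  fix N :: nat and \<phi> b assume "\<forall>k<N. (\<forall>i. \<phi> k i \<in> dual (E i)) \<and> b k \<in> carrier F"
  then show "(\<lambda>x\<in>prod_carrier E. \<Oplus>\<^bsub>F\<^esub>k\<in>{..<N}. (\<Prod>i\<in>UNIV. \<phi> k i (x i)) \<odot>\<^bsub>F\<^esub> b k) \<in> mCoh_ops p E F"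
  proof (induction N)
    case 0
    interpret abelian_monoid F by (rule abelian_group.axioms(1)[OF normed_space_abelian_group[OF F]])
    show ?case using mCoh_zero by (simp add: restrict_def)
  next
    case (Suc N)
    have \<phi>: "\<phi> N i \<in> dual (E i)" and b: "b N \<in> carrier F" for i using Suc.prems by auto
    let ?P = "\<lambda>x\<in>prod_carrier E. (\<Prod>i\<in>UNIV. \<phi> N i (x i)) \<odot>\<^bsub>F\<^esub> b N"
    have "\<forall>i. \<exists>B\<ge>0. \<forall>y\<in>carrier (E i). norm (\<phi> N i y) \<le> B * vnorm (E i) y"
      using dual_bound[OF E \<phi>] by metis
    then obtain B where B: "\<And>i. B i \<ge> 0" "\<And>i y. y \<in> carrier (E i) \<Longrightarrow> norm (\<phi> N i y) \<le> B i * vnorm (E i) y"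
      by metis
    have "multilinear_map E F ?P"
    proof (rule multilinear_mapI)
      have upd: "(\<Prod>j\<in>UNIV. \<phi> N j ((x(i := y)) j)) = \<phi> N i y * (\<Prod>j\<in>UNIV-{i}. \<phi> N j (x j))" for x i y
        by (subst prod.remove[of _ i]) auto
      show "?P (x(i := y \<oplus>\<^bsub>E i\<^esub> z)) = ?P (x(i := y)) \<oplus>\<^bsub>F\<^esub> ?P (x(i := z))"
        if "x \<in> prod_carrier E" "y \<in> carrier (E i)" "z \<in> carrier (E i)" for x i y z
        using that E b F dual_apply(1)[OF E \<phi>]
        by (simp add: fun_upd_prod_carrier upd ns_distrib(1) distrib_right del: fun_upd_apply)
      show "?P (x(i := c \<odot>\<^bsub>E i\<^esub> y)) = c \<odot>\<^bsub>F\<^esub> ?P (x(i := y))"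
        if "x \<in> prod_carrier E" "y \<in> carrier (E i)" for x i c y
        using that E b F dual_apply(2)[OF E \<phi>]
        by (simp add: fun_upd_prod_carrier upd mult.assoc del: fun_upd_apply)
    qed (use b F in simp_all)
    moreover have "mCoh_bound p E F ?P ((\<Prod>i\<in>UNIV. B i) * vnorm F (b N))"
      by (rule mCoh_bound_product[OF p E F B b])
    ultimately have P: "?P \<in> mCoh_ops p E F" by (rule mCoh_opsI)
    have "(\<Oplus>\<^bsub>F\<^esub>k\<in>{..<Suc N}. (\<Prod>i\<in>UNIV. \<phi> k i (x i)) \<odot>\<^bsub>F\<^esub> b k)
        = (\<Prod>i\<in>UNIV. \<phi> N i (x i)) \<odot>\<^bsub>F\<^esub> b N \<oplus>\<^bsub>F\<^esub> (\<Oplus>\<^bsub>F\<^esub>k\<in>{..<N}. (\<Prod>i\<in>UNIV. \<phi> k i (x i)) \<odot>\<^bsub>F\<^esub> b k)" for x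
    proof -
      interpret abelian_monoid F by (rule abelian_group.axioms(1)[OF normed_space_abelian_group[OF F]])
      show ?thesis unfolding lessThan_Suc by (rule finsum_insert) (use Suc.prems F in auto)
    qed
    then show ?case
      using mCoh_add(1)[OF P Suc.IH] Suc.prems by (simp add: restrict_def cong: if_cong)
  qed
qed

text \<open>Definiteness is where the norming functionals enter: without them, an operator could be nonzero
  and still be annihilated by all functionals.\<close>

lemma normed_Z: "normed_space Z"
  unfolding normed_space_def
proof (intro conjI ballI allI module_Z)
  show "0 \<le> vnorm Z T" if "T \<in> carrier Z" for T
    using mCoh_opsD(4) that by (simp add: carrier_Z mCoh_class_norm_def)
  show "vnorm Z (S \<oplus>\<^bsub>Z\<^esub> T) \<le> vnorm Z S + vnorm Z T" if "S \<in> carrier Z" "T \<in> carrier Z" for S T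
    using mCoh_add(2) that by (simp add: carrier_Z mCoh_class_norm_def)
  show "vnorm Z (c \<odot>\<^bsub>Z\<^esub> T) = norm c * vnorm Z T" if "T \<in> carrier Z" for c T
    using mCoh_norm_smult that by (simp add: carrier_Z mCoh_class_norm_def)
  show "vnorm Z T = 0 \<longleftrightarrow> T = \<zero>\<^bsub>Z\<^esub>" if T: "T \<in> carrier Z" for T
  proof
    assume "vnorm Z T = 0"
    then have 0: "mCoh_bound p E F T 0" and m: "multilinear_map E F T"
      using mCoh_opsD(2,3)[of T] T by (simp_all add: carrier_Z mCoh_class_norm_def)
    have "T x = \<zero>\<^bsub>F\<^esub>" if x: "x \<in> prod_carrier E" for x
      using bound_norm[OF m 0 x] ns_norm_ge0[OF F multilinear_map_closed[OF m x]]
        ns_norm_eq0[OF F multilinear_map_closed[OF m x]] by simp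
    then show "T = \<zero>\<^bsub>Z\<^esub>"
      using m by (intro extensionalityI[of _ "prod_carrier E"]) (auto simp: multilinear_map_def PiE_def)
  next
    assume "T = \<zero>\<^bsub>Z\<^esub>"
    then show "vnorm Z T = 0"
      using mCoh_opsD(4,5)[OF mCoh_zero] mCoh_bound_zero[OF F, of p E]
      by (simp add: mCoh_class_norm_def order_antisym)
  qed
qed

lemma diff_Z:
  assumes "S \<in> mCoh_ops p E F" "T \<in> mCoh_ops p E F"
  shows "S \<ominus>\<^bsub>Z\<^esub> T \<in> mCoh_ops p E F"
    and "x \<in> prod_carrier E \<Longrightarrow> (S \<ominus>\<^bsub>Z\<^esub> T) x = S x \<ominus>\<^bsub>F\<^esub> T x"
proof -
  have eq: "S \<ominus>\<^bsub>Z\<^esub> T = S \<oplus>\<^bsub>Z\<^esub> (- 1) \<odot>\<^bsub>Z\<^esub> T"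
    by (rule ns_diff_eq[OF normed_Z]) (use assms in \<open>simp_all add: carrier_Z\<close>)
  show "S \<ominus>\<^bsub>Z\<^esub> T \<in> mCoh_ops p E F"
    using ns_closed(4)[OF normed_Z] assms by (simp add: carrier_Z)
  show "(S \<ominus>\<^bsub>Z\<^esub> T) x = S x \<ominus>\<^bsub>F\<^esub> T x" if x: "x \<in> prod_carrier E"
    unfolding eq using x ns_diff_eq[OF F] multilinear_map_closed[OF mCoh_opsD(2)[OF assms(1)] x]
      multilinear_map_closed[OF mCoh_opsD(2)[OF assms(2)] x] by simp
qed

text \<open>A Cauchy sequence converges pointwise to some multilinear \<open>L\<close>, because its norm dominates the
  operator norm. The inequality for \<open>\<sigma> l - \<sigma> k\<close> involves finite sums only, so it survives the
  limit \<open>l \<rightarrow> \<infinity>\<close>. This gives the inequality for \<open>L - \<sigma> k\<close> with small constants, which yields at the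
  same time that \<open>L\<close> belongs to the space and that \<open>\<sigma>\<close> converges to it in norm.\<close>

lemma banach_Z: "banach_space Z"
  unfolding banach_space_iff
proof (intro conjI normed_Z allI impI)
  fix \<sigma> :: "nat \<Rightarrow> ('n \<Rightarrow> 'u) \<Rightarrow> 'u"
  assume "range \<sigma> \<subseteq> carrier Z \<and> (\<forall>\<epsilon>>0. \<exists>N. \<forall>k\<ge>N. \<forall>l\<ge>N. vnorm Z (\<sigma> k \<ominus>\<^bsub>Z\<^esub> \<sigma> l) < \<epsilon>)"
  then have \<sigma>: "\<sigma> k \<in> mCoh_ops p E F"
    and cauchy: "\<epsilon> > 0 \<Longrightarrow> \<exists>N. \<forall>k\<ge>N. \<forall>l\<ge>N. mCoh_norm p E F (\<sigma> k \<ominus>\<^bsub>Z\<^esub> \<sigma> l) < \<epsilon>" for k \<epsilon>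
    by (auto simp: carrier_Z mCoh_class_norm_def)
  note \<sigma>m = mCoh_opsD(2)[OF \<sigma>]
  note \<sigma>c = multilinear_map_closed[OF \<sigma>m]
  have "\<exists>y\<in>carrier F. (\<lambda>k. vnorm F (\<sigma> k x \<ominus>\<^bsub>F\<^esub> y)) \<longlonglongrightarrow> 0" if x: "x \<in> prod_carrier E" for x
  proof -
    let ?P = "\<Prod>i\<in>UNIV. vnorm (E i) (x i)"
    have P: "?P \<ge> 0" using x ns_norm_ge0[OF E] by (intro prod_nonneg) (simp add: prod_carrier_iff)
    have "\<exists>N. \<forall>k\<ge>N. \<forall>l\<ge>N. vnorm F (\<sigma> k x \<ominus>\<^bsub>F\<^esub> \<sigma> l x) < \<epsilon>" if e: "\<epsilon> > 0" for \<epsilon>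
    proof -
      have "\<epsilon> / (?P + 1) > 0" using e P by simp
      then obtain N where N: "\<forall>k\<ge>N. \<forall>l\<ge>N. mCoh_norm p E F (\<sigma> k \<ominus>\<^bsub>Z\<^esub> \<sigma> l) < \<epsilon> / (?P + 1)"
        using cauchy by blast
      have "vnorm F (\<sigma> k x \<ominus>\<^bsub>F\<^esub> \<sigma> l x) < \<epsilon>" if "k \<ge> N" "l \<ge> N" for k l
      proof -
        note d = diff_Z(1)[OF \<sigma> \<sigma>, of k l]
        have "vnorm F (\<sigma> k x \<ominus>\<^bsub>F\<^esub> \<sigma> l x) \<le> mCoh_norm p E F (\<sigma> k \<ominus>\<^bsub>Z\<^esub> \<sigma> l) * ?P"
          using bound_norm[OF mCoh_opsD(2,3)[OF d] x] diff_Z(2)[OF \<sigma> \<sigma> x] by simp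
        also have "\<dots> \<le> \<epsilon> / (?P + 1) * ?P"
          using N that P by (intro mult_right_mono) (auto intro: less_imp_le)
        also have "\<dots> < \<epsilon>" using e P by (simp add: field_simps)
        finally show ?thesis .
      qed
      then show ?thesis by blast
    qed
    moreover have "range (\<lambda>k. \<sigma> k x) \<subseteq> carrier F" using \<sigma>c[OF x] by auto
    ultimately show ?thesis using banach_F unfolding banach_space_iff by blast
  qed
  then obtain L' where L': "\<forall>x\<in>prod_carrier E. L' x \<in> carrier F \<and> (\<lambda>k. vnorm F (\<sigma> k x \<ominus>\<^bsub>F\<^esub> L' x)) \<longlonglongrightarrow> 0"
    by metis
  define L where "L = restrict L' (prod_carrier E)"
  have Lc: "L x \<in> carrier F" and lim: "(\<lambda>k. vnorm F (\<sigma> k x \<ominus>\<^bsub>F\<^esub> L x)) \<longlonglongrightarrow> 0"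
    if "x \<in> prod_carrier E" for x
    using L' that by (simp_all add: L_def)
  have Lm: "multilinear_map E F L"
  proof (rule multilinear_mapI[OF Lc])
    show "L \<in> extensional (prod_carrier E)" by (simp add: L_def)
  next
    fix x i y z assume xyz: "x \<in> prod_carrier E" "y \<in> carrier (E i)" "z \<in> carrier (E i)"
    note c = fun_upd_prod_carrier[OF xyz(1)]
    note y = c[OF xyz(2)] and z = c[OF xyz(3)] and yz = c[OF ns_closed(2)[OF E xyz(2,3)]]
    have "(\<lambda>k. vnorm F (\<sigma> k (x(i := y \<oplus>\<^bsub>E i\<^esub> z)) \<ominus>\<^bsub>F\<^esub> (L (x(i := y)) \<oplus>\<^bsub>F\<^esub> L (x(i := z))))) \<longlonglongrightarrow> 0"
      using ns_limit_add[OF F \<sigma>c[OF y] \<sigma>c[OF z] Lc[OF y] Lc[OF z] lim[OF y] lim[OF z]]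
      by (simp add: multilinear_mapD(1)[OF \<sigma>m xyz] del: fun_upd_apply)
    then show "L (x(i := y \<oplus>\<^bsub>E i\<^esub> z)) = L (x(i := y)) \<oplus>\<^bsub>F\<^esub> L (x(i := z))"
      by (rule ns_limit_unique[OF F \<sigma>c[OF yz] Lc[OF yz] ns_closed(2)[OF F Lc[OF y] Lc[OF z]] lim[OF yz]])
  next
    fix x i c y assume xy: "x \<in> prod_carrier E" "y \<in> carrier (E i)"
    note d = fun_upd_prod_carrier[OF xy(1)]
    note y = d[OF xy(2)] and cy = d[OF ns_closed(3)[OF E xy(2), of c]]
    have "(\<lambda>k. vnorm F (\<sigma> k (x(i := c \<odot>\<^bsub>E i\<^esub> y)) \<ominus>\<^bsub>F\<^esub> (c \<odot>\<^bsub>F\<^esub> L (x(i := y))))) \<longlonglongrightarrow> 0"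
      using ns_limit_smult[OF F \<sigma>c[OF y] Lc[OF y] lim[OF y], of c]
      by (simp add: multilinear_mapD(2)[OF \<sigma>m xy] del: fun_upd_apply)
    then show "L (x(i := c \<odot>\<^bsub>E i\<^esub> y)) = c \<odot>\<^bsub>F\<^esub> L (x(i := y))"
      by (rule ns_limit_unique[OF F \<sigma>c[OF cy] Lc[OF cy] ns_closed(3)[OF F Lc[OF y]] lim[OF cy]])
  qed
  define D where "D k = (\<lambda>x\<in>prod_carrier E. L x \<oplus>\<^bsub>F\<^esub> (\<lambda>x\<in>prod_carrier E. (- 1) \<odot>\<^bsub>F\<^esub> \<sigma> k x) x)" for k
  have Dm: "multilinear_map E F (D k)" for k
    unfolding D_def by (rule multilinear_map_add[OF E F Lm multilinear_map_smult[OF E F \<sigma>m]])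
  have D: "D k x = L x \<ominus>\<^bsub>F\<^esub> \<sigma> k x" if "x \<in> prod_carrier E" for k x
    using that ns_diff_eq[OF F Lc[OF that] \<sigma>c[OF that]] by (simp add: D_def)
  have Db: "\<exists>N. \<forall>k\<ge>N. mCoh_bound p E F (D k) \<epsilon>" if e: "\<epsilon> > 0" for \<epsilon>
  proof -
    obtain N where N: "\<And>k l. k \<ge> N \<Longrightarrow> l \<ge> N \<Longrightarrow> mCoh_norm p E F (\<sigma> l \<ominus>\<^bsub>Z\<^esub> \<sigma> k) < \<epsilon>"
      using cauchy[OF e] by blast
    have "mCoh_bound p E F (D k) \<epsilon>" if k: "k \<ge> N" for k
    proof (rule mCoh_boundI)
      show "0 \<le> \<epsilon>" using e by simp
      fix m x and \<phi> :: "('n \<Rightarrow> nat) \<Rightarrow> 'u \<Rightarrow> 'k"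
      assume x: "\<And>i j. j < m \<Longrightarrow> x i j \<in> carrier (E i)" and \<phi>: "\<And>j. j \<in> index_box m \<Longrightarrow> \<phi> j \<in> dual F"
      let ?P = "\<Prod>i\<in>UNIV. strong_norm p {..<m} (E i) (x i)" and ?W = "weak_norm (conj_exponent p) (index_box m) F \<phi>"
      have W: "?W \<ge> 0" using weak_norm_finite_nonneg[where I = "index_box m" and \<phi> = \<phi>, OF F finite_index_box _ \<phi>]
          conj_exponent(1)[OF p] by simp
      let ?s = "\<lambda>l. \<Sum>j\<in>index_box m. norm (\<phi> j ((\<sigma> l \<ominus>\<^bsub>Z\<^esub> \<sigma> k) (\<lambda>i. x i (j i))))"
      have "?s \<longlonglongrightarrow> (\<Sum>j\<in>index_box m. norm (\<phi> j (D k (\<lambda>i. x i (j i)))))"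
      proof (intro tendsto_sum tendsto_norm)
        fix j :: "'n \<Rightarrow> nat" assume j: "j \<in> index_box m"
        note z = index_tuple_closed[where E = E and x = x, OF x j]
        let ?z = "\<lambda>i. x i (j i)"
        obtain B where B: "\<And>y. y \<in> carrier F \<Longrightarrow> norm (\<phi> j y) \<le> B * vnorm F y"
          using dual_bound[OF F \<phi>[OF j]] by blast
        have "(\<lambda>l. \<phi> j (\<sigma> l ?z) - \<phi> j (L ?z)) \<longlonglongrightarrow> 0"
        proof (rule Lim_null_comparison)
          show "\<forall>\<^sub>F l in sequentially. norm (\<phi> j (\<sigma> l ?z) - \<phi> j (L ?z)) \<le> B * vnorm F (\<sigma> l ?z \<ominus>\<^bsub>F\<^esub> L ?z)"
            using B[OF ns_closed(4)[OF F \<sigma>c[OF z] Lc[OF z]]] dual_apply(4)[OF F \<phi>[OF j] \<sigma>c[OF z] Lc[OF z]]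
            by (intro always_eventually) simp
          show "(\<lambda>l. B * vnorm F (\<sigma> l ?z \<ominus>\<^bsub>F\<^esub> L ?z)) \<longlonglongrightarrow> 0"
            by (rule tendsto_mult_right_zero[OF lim[OF z]])
        qed
        then have "(\<lambda>l. \<phi> j (\<sigma> l ?z)) \<longlonglongrightarrow> \<phi> j (L ?z)" by (rule LIM_zero_cancel)
        then have "(\<lambda>l. \<phi> j (\<sigma> l ?z) - \<phi> j (\<sigma> k ?z)) \<longlonglongrightarrow> \<phi> j (L ?z) - \<phi> j (\<sigma> k ?z)"
          by (rule tendsto_diff) simp
        then show "(\<lambda>l. \<phi> j ((\<sigma> l \<ominus>\<^bsub>Z\<^esub> \<sigma> k) ?z)) \<longlonglongrightarrow> \<phi> j (D k ?z)"
          using dual_apply(4)[OF F \<phi>[OF j] \<sigma>c[OF z] \<sigma>c[OF z]] dual_apply(4)[OF F \<phi>[OF j] Lc[OF z] \<sigma>c[OF z]]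
          by (simp add: diff_Z(2)[OF \<sigma> \<sigma> z] D[OF z])
      qed
      moreover have "?s l \<le> \<epsilon> * ?P * ?W" if "l \<ge> N" for l
      proof -
        have "?s l \<le> mCoh_norm p E F (\<sigma> l \<ominus>\<^bsub>Z\<^esub> \<sigma> k) * ?P * ?W"
          by (rule mCoh_boundD[OF mCoh_opsD(3)[OF diff_Z(1)[OF \<sigma> \<sigma>]] x \<phi>])
        also have "\<dots> \<le> \<epsilon> * ?P * ?W"
          using N[OF k that] W by (intro mult_right_mono prod_strong_norm_nonneg) auto
        finally show ?thesis .
      qed
      ultimately show "(\<Sum>j\<in>index_box m. norm (\<phi> j (D k (\<lambda>i. x i (j i))))) \<le> \<epsilon> * ?P * ?W"
        by (intro LIMSEQ_le_const2) auto
    qed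
    then show ?thesis by blast
  qed
  have L: "L \<in> mCoh_ops p E F"
  proof -
    obtain N where "mCoh_bound p E F (D N) 1" using Db[of 1] by auto
    then have "D N \<in> mCoh_ops p E F" by (rule mCoh_opsI[OF Dm])
    then have "(\<lambda>x\<in>prod_carrier E. D N x \<oplus>\<^bsub>F\<^esub> \<sigma> N x) \<in> mCoh_ops p E F" by (rule mCoh_add(1)[OF _ \<sigma>])
    also have "(\<lambda>x\<in>prod_carrier E. D N x \<oplus>\<^bsub>F\<^esub> \<sigma> N x) = L"
    proof (rule extensionalityI)
      show "L \<in> extensional (prod_carrier E)" by (simp add: L_def)
      show "(\<lambda>x\<in>prod_carrier E. D N x \<oplus>\<^bsub>F\<^esub> \<sigma> N x) x = L x" if "x \<in> prod_carrier E" for x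
        using that F Lc[OF that] \<sigma>c[OF that] by (simp add: D)
    qed simp
    finally show ?thesis .
  qed
  \<comment> \<open>By definition, \<open>D k\<close> is the difference of \<open>L\<close> and \<open>\<sigma> k\<close> in \<open>Z\<close>, once that is written with \<open>-1\<close>.\<close>
  have LD: "vnorm Z (\<sigma> k \<ominus>\<^bsub>Z\<^esub> L) = mCoh_norm p E F (D k)" for k
  proof -
    have "vnorm Z (\<sigma> k \<ominus>\<^bsub>Z\<^esub> L) = vnorm Z (L \<ominus>\<^bsub>Z\<^esub> \<sigma> k)"
      by (rule ns_norm_diff_commute[OF normed_Z]) (simp_all add: carrier_Z \<sigma> L)
    also have "L \<ominus>\<^bsub>Z\<^esub> \<sigma> k = D k"
      using ns_diff_eq[OF normed_Z, of L "\<sigma> k"] \<sigma> L by (simp add: carrier_Z D_def)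
    finally show ?thesis by (simp add: mCoh_class_norm_def)
  qed
  have "(\<lambda>k. mCoh_norm p E F (D k)) \<longlonglongrightarrow> 0"
  proof (rule LIMSEQ_I)
    fix \<epsilon> :: real assume "\<epsilon> > 0"
    then obtain N where N: "\<And>k. k \<ge> N \<Longrightarrow> mCoh_bound p E F (D k) (\<epsilon> / 2)" using Db[of "\<epsilon> / 2"] by auto
    have "norm (mCoh_norm p E F (D k) - 0) < \<epsilon>" if "k \<ge> N" for k
      using mCoh_opsD(4,5)[OF mCoh_opsI[OF Dm N[OF that]]] N[OF that] \<open>\<epsilon> > 0\<close> by fastforce
    then show "\<exists>N. \<forall>k\<ge>N. norm (mCoh_norm p E F (D k) - 0) < \<epsilon>" by blast
  qed
  then show "\<exists>T\<in>carrier Z. (\<lambda>k. vnorm Z (\<sigma> k \<ominus>\<^bsub>Z\<^esub> T)) \<longlonglongrightarrow> 0"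
    using L LD by (intro bexI[of _ L]) (simp_all add: carrier_Z)
qed

end

lemma multilinear_map_compose:
  assumes E: "\<And>i. normed_space (E i)" and G: "\<And>i. normed_space (G i)"
    and T: "multilinear_map E F T" and u: "\<And>i. u i \<in> linear_ops (G i) (E i)" and t: "t \<in> linear_ops F H"
  shows "multilinear_map G H (\<lambda>x\<in>prod_carrier G. t (T (\<lambda>i. u i (x i))))"
proof (rule multilinear_mapI)
  have u': "u i y \<in> carrier (E i)" "z \<in> carrier (G i) \<Longrightarrow> u i (y \<oplus>\<^bsub>G i\<^esub> z) = u i y \<oplus>\<^bsub>E i\<^esub> u i z"
    "u i (c \<odot>\<^bsub>G i\<^esub> y) = c \<odot>\<^bsub>E i\<^esub> u i y" if "y \<in> carrier (G i)" for i y z c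
    using u[of i] that unfolding linear_ops_def by auto
  have t': "t y \<in> carrier H" "z \<in> carrier F \<Longrightarrow> t (y \<oplus>\<^bsub>F\<^esub> z) = t y \<oplus>\<^bsub>H\<^esub> t z" "t (c \<odot>\<^bsub>F\<^esub> y) = c \<odot>\<^bsub>H\<^esub> t y"
    if "y \<in> carrier F" for y z c
    using t that unfolding linear_ops_def by auto
  have ux: "(\<lambda>i. u i (x i)) \<in> prod_carrier E" if "x \<in> prod_carrier G" for x
    using that u'(1) by (simp add: prod_carrier_iff)
  have upd: "(\<lambda>j. u j ((x(i := y)) j)) = (\<lambda>j. u j (x j))(i := u i y)" for x i y by auto
  show "(\<lambda>x\<in>prod_carrier G. t (T (\<lambda>i. u i (x i)))) x \<in> carrier H" if "x \<in> prod_carrier G" for x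
    using that t'(1)[OF multilinear_map_closed[OF T ux[OF that]]] by simp
  have app: "(\<lambda>x\<in>prod_carrier G. t (T (\<lambda>i. u i (x i)))) (x(i := y)) = t (T ((\<lambda>j. u j (x j))(i := u i y)))"
    if "x \<in> prod_carrier G" "y \<in> carrier (G i)" for x i y
    unfolding upd[symmetric] by (rule restrict_apply') (rule fun_upd_prod_carrier[OF that])
  show "(\<lambda>x\<in>prod_carrier G. t (T (\<lambda>i. u i (x i)))) (x(i := y \<oplus>\<^bsub>G i\<^esub> z)) =
      (\<lambda>x\<in>prod_carrier G. t (T (\<lambda>i. u i (x i)))) (x(i := y)) \<oplus>\<^bsub>H\<^esub>
      (\<lambda>x\<in>prod_carrier G. t (T (\<lambda>i. u i (x i)))) (x(i := z))"
    if x: "x \<in> prod_carrier G" and y: "y \<in> carrier (G i)" and z: "z \<in> carrier (G i)" for x i y z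
    unfolding app[OF x y] app[OF x z] app[OF x ns_closed(2)[OF G y z]] u'(2)[OF y z]
      multilinear_mapD(1)[OF T ux[OF x] u'(1)[OF y] u'(1)[OF z]]
    by (intro t'(2) multilinear_map_closed[OF T] fun_upd_prod_carrier ux[OF x] u'(1) y z)
  show "(\<lambda>x\<in>prod_carrier G. t (T (\<lambda>i. u i (x i)))) (x(i := c \<odot>\<^bsub>G i\<^esub> y)) =
      c \<odot>\<^bsub>H\<^esub> (\<lambda>x\<in>prod_carrier G. t (T (\<lambda>i. u i (x i)))) (x(i := y))"
    if x: "x \<in> prod_carrier G" and y: "y \<in> carrier (G i)" for x i c y
    unfolding app[OF x y] app[OF x ns_closed(3)[OF G y]] u'(3)[OF y]
      multilinear_mapD(2)[OF T ux[OF x] u'(1)[OF y]]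
    by (intro t'(3) multilinear_map_closed[OF T] fun_upd_prod_carrier ux[OF x] u'(1) y)
qed simp

section \<open>The ideal\<close>

theorem complete_normed_ideal_mCoh:
  fixes p :: real
  assumes p: "1 < p" and norming: "\<And>F :: ('k::real_normed_field, 'u) nspace. normed_space F \<Longrightarrow> norming F"
  shows "complete_normed_ideal (mCoh_class p :: ('k, 'n::finite, 'u) operator set) (mCoh_class_norm p)"
proof -
  let ?M = "mCoh_class p :: ('k, 'n, 'u) operator set"
  have component: "mCoh_component p E F"
    if "\<forall>i. banach_space (E i)" "banach_space F" for E :: "'n \<Rightarrow> ('k, 'u) nspace" and F
    using that p by unfold_locales (auto simp: banach_space_def intro: norming)
  have sub: "?M \<subseteq> continuous_multilinear"
    by (auto simp: mCoh_class_def continuous_multilinear_def mCoh_ops_def)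
  have nonneg: "0 \<le> mCoh_class_norm p A" if "A \<in> ?M" for A
  proof -
    obtain E F T where A: "A = (E, F, T)" by (cases A)
    with that have b: "\<forall>i. banach_space (E i)" "banach_space F" and T: "T \<in> mCoh_ops p E F"
      by (auto simp: mCoh_class_def)
    interpret mCoh_component p E F by (rule component[OF b])
    show ?thesis using mCoh_opsD(4)[OF T] by (simp add: A mCoh_class_norm_def)
  qed
  have comp: "submodule (component ?M E F) scalar_ring (multilinear_module E F)"
    "finite_type_ops E F \<subseteq> component ?M E F" "banach_space (component_space ?M (mCoh_class_norm p) E F)"
    if b: "\<forall>i. banach_space (E i)" "banach_space F" for E F
  proof -
    interpret mCoh_component p E F by (rule component[OF b])
    show "submodule (component ?M E F) scalar_ring (multilinear_module E F)" by (rule submodule_component)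
    show "finite_type_ops E F \<subseteq> component ?M E F" by (rule finite_type_subset)
    show "banach_space (component_space ?M (mCoh_class_norm p) E F)" by (rule banach_Z)
  qed
  have scalars: "mCoh_class_norm p (\<lambda>i::'n. scalar_copy \<iota>, scalar_copy \<iota>,
      \<lambda>x\<in>prod_carrier (\<lambda>i::'n. scalar_copy \<iota>). \<iota> (\<Prod>i\<in>UNIV. the_inv \<iota> (x i))) = 1"
    if "inj \<iota>" for \<iota> :: "'k \<Rightarrow> 'u"
    using mCoh_norm_scalar_product[OF p that] by (simp add: mCoh_class_norm_def)
  have ideal: "(\<lambda>x\<in>prod_carrier G. t (T (\<lambda>i. u i (x i)))) \<in> component ?M G H \<and>
      mCoh_class_norm p (G, H, \<lambda>x\<in>prod_carrier G. t (T (\<lambda>i. u i (x i))))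
        \<le> opnorm F H t * mCoh_class_norm p (E, F, T) * (\<Prod>i\<in>UNIV. opnorm (G i) (E i) (u i))"
    if h: "(\<forall>i. banach_space (E i)) \<and> banach_space F \<and> (\<forall>i. banach_space (G i)) \<and> banach_space H \<and>
        T \<in> component ?M E F \<and> (\<forall>i. u i \<in> linear_ops (G i) (E i)) \<and> t \<in> linear_ops F H"
    for E F G H T u t
  proof -
    from h have b: "\<forall>i. banach_space (E i)" "banach_space F" "\<forall>i. banach_space (G i)" "banach_space H"
      and T: "T \<in> component ?M E F" and u: "\<forall>i. u i \<in> linear_ops (G i) (E i)" and t: "t \<in> linear_ops F H"
      by - (elim conjE, assumption)+
    interpret EF: mCoh_component p E F by (rule component[OF b(1,2)])
    interpret GH: mCoh_component p G H by (rule component[OF b(3,4)])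
    have T': "T \<in> mCoh_ops p E F" using T by (simp add: EF.carrier_Z)
    note u' = u[rule_format]
    note m = multilinear_map_compose[OF EF.E GH.E EF.mCoh_opsD(2)[OF T'] u' t]
    note bd = mCoh_bound_compose[OF p EF.E EF.F GH.E GH.F EF.mCoh_opsD(2,3)[OF T'] u' t]
    note S = GH.mCoh_opsI[OF m bd]
    from S GH.mCoh_opsD(5)[OF S bd] show ?thesis by (simp add: GH.carrier_Z mCoh_class_norm_def)
  qed
  show ?thesis
    unfolding complete_normed_ideal_def Let_def
  proof (intro conjI ballI allI impI)
    show "?M \<subseteq> continuous_multilinear" by (rule sub)
    show "0 \<le> mCoh_class_norm p A" if "A \<in> ?M" for A by (rule nonneg[OF that])
  next
    fix E :: "'n \<Rightarrow> ('k, 'u) nspace" and F :: "('k, 'u) nspace"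
    assume b: "(\<forall>i. banach_space (E i)) \<and> banach_space F"
    note c = comp[OF conjunct1[OF b] conjunct2[OF b]]
    show "submodule (component ?M E F) scalar_ring (multilinear_module E F)" by (rule c(1))
    show "finite_type_ops E F \<subseteq> component ?M E F" by (rule c(2))
    show "banach_space (component_space ?M (mCoh_class_norm p) E F)" by (rule c(3))
  next
    fix \<iota> :: "'k \<Rightarrow> 'u" assume "inj \<iota>"
    then show "mCoh_class_norm p (\<lambda>i::'n. scalar_copy \<iota>, scalar_copy \<iota>,
      \<lambda>x\<in>prod_carrier (\<lambda>i::'n. scalar_copy \<iota>). \<iota> (\<Prod>i\<in>UNIV. the_inv \<iota> (x i))) = 1"
      by (rule scalars)
  next
    fix E G :: "'n \<Rightarrow> ('k, 'u) nspace" and F H :: "('k, 'u) nspace" and T u t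
    assume h: "(\<forall>i. banach_space (E i)) \<and> banach_space F \<and> (\<forall>i. banach_space (G i)) \<and> banach_space H \<and>
        T \<in> component ?M E F \<and> (\<forall>i. u i \<in> linear_ops (G i) (E i)) \<and> t \<in> linear_ops F H"
    show "(\<lambda>x\<in>prod_carrier G. t (T (\<lambda>i. u i (x i)))) \<in> component ?M G H"
      by (rule conjunct1[OF ideal[OF h]])
    show "mCoh_class_norm p (G, H, \<lambda>x\<in>prod_carrier G. t (T (\<lambda>i. u i (x i))))
        \<le> opnorm F H t * mCoh_class_norm p (E, F, T) * (\<Prod>i\<in>UNIV. opnorm (G i) (E i) (u i))"
      by (rule conjunct2[OF ideal[OF h]])
  qed
qed

theorem theorem5p12:
  fixes p :: real
  assumes "1 < p"
  shows "complete_normed_ideal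
           (mCoh_class p :: (real, 'n::finite, 'u) operator set) (mCoh_class_norm p) \<and>
         complete_normed_ideal
           (mCoh_class p :: (complex, 'n::finite, 'u) operator set) (mCoh_class_norm p)"
  using complete_normed_ideal_mCoh[OF assms norming_real] complete_normed_ideal_mCoh[OF assms norming_complex]
  by blast

end
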